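(* Assume that (VD), (PI$_p(\Psi)$) and (cap$_p(\Psi)_{\le}$) hold. Then any uniform domain $U$ of $X$ satisfies the extension property (E).
   Context: **Setting.** $(X,d)$ is a locally compact, separable, complete metric space with at least two points, $m$ is a Radon measure on $X$ with full topological support, and $p\in(1,\infty)$. $B(x,r)=\{y\in X: d(x,y)<r\}$; $u_A=\frac1{m(A)}\int_A u\,dm$; $C_c(X)$ is the set of compactly supported continuous functions on $X$; $\mathbf{1}_A$ is the indicator function of $A$. $\mathcal{F}_p$ is a linear subspace of $L^p(X,m)$, $\mathcal{E}_p:\mathcal{F}_p\to[0,\infty)$ is such that $\mathcal{E}_p^{1/p}$ is a seminorm on $\mathcal{F}_p$, and $\{\Gamma_p\langle u\rangle\}_{u\in\mathcal{F}_p}$ is a family of finite Borel measures on $X$ such that: (1) for any $u\in\mathcal{F}_p$ and any $1$-Lipschitz $\varphi:\mathbb{R}\to\mathbb{R}$ with $\varphi(0)=0$, $\varphi(u)\in\mathcal{F}_p$ and $\mathcal{E}_p(\varphi(u))\le\mathcal{E}_p(u)$; and $\mathcal{E}_p^{-1}(0)\subset\mathbb{R}\mathbf{1}_X$; (2) $\mathcal{F}_p$ with the norm $\|\cdot\|_{L^p(X,m)}+\mathcal{E}_p(\cdot)^{1/p}$ is a reflexive Banach space; (3) $\mathcal{F}_p\cap C_c(X)$ is dense in $\mathcal{F}_p$ and is dense in $C_c(X)$ with respect to the uniform norm; (4) for any Borel $A\subset X$, $u\mapsto\Gamma_p\langle u\rangle(A)^{1/p}$ is a seminorm on $\mathcal{F}_p$;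 (5) $\mathcal{E}_p(u)=\Gamma_p\langle u\rangle(X)$ for any $u\in\mathcal{F}_p$; (6) if $u,v\in\mathcal{F}_p\cap C_c(X)$, $U\subset X$ is open and $(u-v)|_U$ is constant, then $\Gamma_p\langle u\rangle|_U=\Gamma_p\langle v\rangle|_U$ (restrictions to Borel subsets of $U$). **Scale function.** $\Psi:(0,\infty)\to(0,\infty)$ is a fixed continuous increasing bijection for which there are constants $C_\Psi\in[1,\infty)$, $\beta_1,\beta_2\in(0,\infty)$ with $C_\Psi^{-1}(R/r)^{\beta_1}\le\Psi(R)/\Psi(r)\le C_\Psi(R/r)^{\beta_2}$ for all $0<r\le R$. **(VD)**: there is $c_{\mathrm D}\in[1,\infty)$ with $m(B(x,2r))\le c_{\mathrm D}m(B(x,r))$ for all $x\in X$, $r>0$. **(PI$_p(\Psi)$)**: there are $C_{\mathrm P}\in(0,\infty)$, $A_{\mathrm P}\in[1,\infty)$ such that for all $x\in X$, $r>0$, $u\in\mathcal{F}_p$: $\int_{B(x,r)}|u-u_{B(x,r)}|^p\,dm\le C_{\mathrm P}\Psi(r)\,\Gamma_p\langle u\rangle(B(x,A_{\mathrm P}r))$. **(cap$_p(\Psi)_{\le}$)**: there are $C_{\mathrm{cap}},A_{\mathrm{cap},1},A_{\mathrm{cap},2}\in(1,\infty)$ such that for all $x\in X$ and $0<R<\operatorname{diam}(X,d)/A_{\mathrm{cap},2}$: $\inf\{\mathcal{E}_p(u): u\in\mathcal{F}_p,\ u=1\ m\text{-a.e. on }B(x,R),\ u=0\ m\text{-a.e.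 on }X\setminus B(x,A_{\mathrm{cap},1}R)\}\le C_{\mathrm{cap}}\,m(B(x,R))/\Psi(R)$. **Local spaces.** For a non-empty open $U\subset X$, $\mathcal{F}_{p,\mathrm{loc}}(U)$ is the set of ($m$-equivalence classes of) real-valued Borel functions $u$ on $U$ such that for each relatively compact open subset $A$ of $U$ there is $u^\#\in\mathcal{F}_p$ with $u=u^\#$ $m$-a.e. on $A$. For $u\in\mathcal{F}_{p,\mathrm{loc}}(U)$, the Radon measure $\Gamma_{p,U}\langle u\rangle$ on $U$ is given by $\Gamma_{p,U}\langle u\rangle(E)=\Gamma_p\langle u^\#\rangle(E)$ for relatively compact Borel $E$ in $U$ (where $A$ is any relatively compact open subset of $U$ with $E\subset A$ and $u^\#\in\mathcal{F}_p$ is any function with $u=u^\#$ $m$-a.e. on $A$; the value is independent of these choices), extended by monotone limits along exhaustions of $U$ by relatively compact open subsets. $\mathcal{F}_p(U)=\{u\in\mathcal{F}_{p,\mathrm{loc}}(U):\int_U|u|^p\,dm+\Gamma_{p,U}\langle u\rangle(U)<\infty\}$. **Extension property (E).** An open $\Omega\subset X$ with $\Omega\ne X$ satisfies (E) if for any $f\in\mathcal{F}_p(\Omega)$ there is $F\in\mathcal{F}_p$ with $f=F$ $m$-a.e. on $\Omega$ and $\Gamma_p\langle F\rangle(\partial\Omega)=0$. **Uniform domains.** For $A\ge1$, a connected, non-empty open set $U\subset X$ with $U\ne X$ is an $A$-uniform domain if for every $x,y\in U$ there is a continuous curve $\gamma:[a,b]\to U$ from $x$ to $y$ with $\operatorname{diam}(\gamma)\le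 A\,d(x,y)$ and $\delta_U(z):=d(z,X\setminus U)\ge A^{-1}\min\{d(x,z),d(y,z)\}$ for every $z\in\gamma([a,b])$. $U$ is a uniform domain if it is an $A$-uniform domain for some $A\ge1$. *)

theory Defs
  imports "HOL-Analysis.Analysis"
begin

section \<open>Seminormed function spaces\<close>

text \<open>
  Spaces of \<open>m\<close>-equivalence classes are represented by the saturated set of all their Borel
  representatives, so a norm on classes becomes a seminorm on functions.  Vector space operations
  on functions are pointwise.
\<close>

definition function_subspace :: "('s \<Rightarrow> real) set \<Rightarrow> bool" where
  "function_subspace V \<longleftrightarrow>
     (\<lambda>x. 0) \<in> V \<and>
     (\<forall>u\<in>V. \<forall>v\<in>V. (\<lambda>x. u x + v x) \<in> V) \<and>
     (\<forall>c. \<forall>u\<in>V. (\<lambda>x. c * u x) \<in> V)"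

definition seminorm_on :: "('s \<Rightarrow> real) set \<Rightarrow> (('s \<Rightarrow> real) \<Rightarrow> real) \<Rightarrow> bool" where
  "seminorm_on V N \<longleftrightarrow>
     (\<forall>u\<in>V. 0 \<le> N u) \<and>
     (\<forall>u\<in>V. \<forall>v\<in>V. N (\<lambda>x. u x + v x) \<le> N u + N v) \<and>
     (\<forall>c. \<forall>u\<in>V. N (\<lambda>x. c * u x) = \<bar>c\<bar> * N u)"

definition complete_seminorm_on :: "('s \<Rightarrow> real) set \<Rightarrow> (('s \<Rightarrow> real) \<Rightarrow> real) \<Rightarrow> bool" where
  "complete_seminorm_on V N \<longleftrightarrow>
     (\<forall>f. (\<forall>n::nat. f n \<in> V) \<and>
          (\<forall>e>0. \<exists>k. \<forall>i\<ge>k. \<forall>j\<ge>k. N (\<lambda>x. f i x - f j x) < e) \<longrightarrow>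
        (\<exists>u\<in>V. (\<lambda>n. N (\<lambda>x. f n x - u x)) \<longlonglongrightarrow> 0))"

text \<open>
  A bounded linear functional for a seminorm factors through the quotient by the null space, so this
  is the topological dual of the quotient.  Setting functionals to 0 off \<open>V\<close> makes
  them unique as functions and turns the dual into a function space again, so that the
  construction can be iterated to form the bidual.
\<close>

definition dual_space :: "('s \<Rightarrow> real) set \<Rightarrow> (('s \<Rightarrow> real) \<Rightarrow> real) \<Rightarrow> (('s \<Rightarrow> real) \<Rightarrow> real) set" where
  "dual_space V N =
     {l. (\<forall>u. u \<notin> V \<longrightarrow> l u = 0) \<and>
         (\<forall>u\<in>V. \<forall>v\<in>V. l (\<lambda>x. u x + v x) = l u + l v) \<and>
         (\<forall>c. \<forall>u\<in>V. l (\<lambda>x. c * u x) = c * l u) \<and>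
         (\<exists>C. \<forall>u\<in>V. \<bar>l u\<bar> \<le> C * N u)}"

definition dual_norm :: "('s \<Rightarrow> real) set \<Rightarrow> (('s \<Rightarrow> real) \<Rightarrow> real) \<Rightarrow> (('s \<Rightarrow> real) \<Rightarrow> real) \<Rightarrow> real" where
  "dual_norm V N l = (SUP u\<in>{u \<in> V. N u \<le> 1}. \<bar>l u\<bar>)"

definition reflexive_seminorm_on :: "('s \<Rightarrow> real) set \<Rightarrow> (('s \<Rightarrow> real) \<Rightarrow> real) \<Rightarrow> bool" where
  "reflexive_seminorm_on V N \<longleftrightarrow>
     (\<forall>\<xi> \<in> dual_space (dual_space V N) (dual_norm V N).
        \<exists>u\<in>V. \<forall>l \<in> dual_space V N. \<xi> l = l u)"


section \<open>The metric measure space and the \<open>p\<close>-energy form\<close>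

definition radon_measure :: "'a::topological_space measure \<Rightarrow> bool" where
  "radon_measure m \<longleftrightarrow>
     sets m = sets borel \<and>
     (\<forall>K. compact K \<longrightarrow> emeasure m K < \<infinity>) \<and>
     (\<forall>A\<in>sets borel. emeasure m A = (SUP K\<in>{K. compact K \<and> K \<subseteq> A}. emeasure m K))"

definition Cc :: "('a::topological_space \<Rightarrow> real) set" where
  "Cc = {u. continuous_on UNIV u \<and> compact (closure {x. u x \<noteq> 0})}"

definition Lp_space :: "'a measure \<Rightarrow> real \<Rightarrow> ('a \<Rightarrow> real) set" where
  "Lp_space m p = {u \<in> borel_measurable m. integrable m (\<lambda>x. \<bar>u x\<bar> powr p)}"

definition Lp_norm :: "'a measure \<Rightarrow> real \<Rightarrow> ('a \<Rightarrow> real) \<Rightarrow> real" where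
  "Lp_norm m p u = (LINT x|m. \<bar>u x\<bar> powr p) powr (1 / p)"

definition energy_norm ::
  "'a measure \<Rightarrow> real \<Rightarrow> (('a \<Rightarrow> real) \<Rightarrow> real) \<Rightarrow> ('a \<Rightarrow> real) \<Rightarrow> real" where
  "energy_norm m p \<E> u = Lp_norm m p u + \<E> u powr (1 / p)"

text \<open>
  The class \<open>polish_space\<close> provides a fixed complete separable metric.
  The assumptions \<open>F_saturated\<close>, \<open>E_AE\<close> and \<open>\<Gamma>_AE\<close> say that
  \<open>\<F>\<close>, \<open>\<E>\<close> and \<open>\<Gamma>\<close> live on \<open>m\<close>-equivalence classes.
\<close>

locale p_energy_space =
  fixes m :: "'a::polish_space measure"
    and p :: real
    and \<F> :: "('a \<Rightarrow> real) set"
    and \<E> :: "('a \<Rightarrow> real) \<Rightarrow> real"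
    and \<Gamma> :: "('a \<Rightarrow> real) \<Rightarrow> 'a measure"
  assumes locally_compact: "locally compact (UNIV :: 'a set)"
    and two_points: "\<exists>x y :: 'a. x \<noteq> y"
    and radon: "radon_measure m"
    and full_support: "\<And>U. open U \<Longrightarrow> U \<noteq> {} \<Longrightarrow> emeasure m U > 0"
    and p_gt_1: "1 < p"
    and F_Lp: "\<F> \<subseteq> Lp_space m p"
    and F_subspace: "function_subspace \<F>"
    and F_saturated:
      "\<And>u v. u \<in> \<F> \<Longrightarrow> v \<in> borel_measurable m \<Longrightarrow> (AE x in m. u x = v x) \<Longrightarrow> v \<in> \<F>"
    and E_nonneg: "\<And>u. u \<in> \<F> \<Longrightarrow> 0 \<le> \<E> u"
    and E_AE: "\<And>u v. u \<in> \<F> \<Longrightarrow> v \<in> \<F> \<Longrightarrow> (AE x in m. u x = v x) \<Longrightarrow> \<E> u = \<E> v"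
    and E_seminorm: "seminorm_on \<F> (\<lambda>u. \<E> u powr (1 / p))"
    and \<Gamma>_borel: "\<And>u. u \<in> \<F> \<Longrightarrow> sets (\<Gamma> u) = sets borel"
    and \<Gamma>_finite: "\<And>u. u \<in> \<F> \<Longrightarrow> finite_measure (\<Gamma> u)"
    and \<Gamma>_AE: "\<And>u v. u \<in> \<F> \<Longrightarrow> v \<in> \<F> \<Longrightarrow> (AE x in m. u x = v x) \<Longrightarrow> \<Gamma> u = \<Gamma> v"
    and lipschitz_in_F:
      "\<And>u \<phi>. u \<in> \<F> \<Longrightarrow> 1-lipschitz_on UNIV (\<phi> :: real \<Rightarrow> real) \<Longrightarrow> \<phi> 0 = 0 \<Longrightarrow>
         (\<lambda>x. \<phi> (u x)) \<in> \<F>"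
    and lipschitz_contraction:
      "\<And>u \<phi>. u \<in> \<F> \<Longrightarrow> 1-lipschitz_on UNIV (\<phi> :: real \<Rightarrow> real) \<Longrightarrow> \<phi> 0 = 0 \<Longrightarrow>
         \<E> (\<lambda>x. \<phi> (u x)) \<le> \<E> u"
    and E_zero: "\<And>u. u \<in> \<F> \<Longrightarrow> \<E> u = 0 \<Longrightarrow> \<exists>c. AE x in m. u x = c"
    and F_complete: "complete_seminorm_on \<F> (energy_norm m p \<E>)"
    and F_reflexive: "reflexive_seminorm_on \<F> (energy_norm m p \<E>)"
    and dense_F:
      "\<And>u e. u \<in> \<F> \<Longrightarrow> 0 < e \<Longrightarrow> \<exists>v \<in> \<F> \<inter> Cc. energy_norm m p \<E> (\<lambda>x. u x - v x) < e"
    and dense_Cc: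
      "\<And>u e. u \<in> Cc \<Longrightarrow> 0 < e \<Longrightarrow> \<exists>v \<in> \<F> \<inter> Cc. \<forall>x. \<bar>u x - v x\<bar> < e"
    and \<Gamma>_seminorm:
      "\<And>A. A \<in> sets borel \<Longrightarrow> seminorm_on \<F> (\<lambda>u. measure (\<Gamma> u) A powr (1 / p))"
    and E_eq_\<Gamma>: "\<And>u. u \<in> \<F> \<Longrightarrow> \<E> u = measure (\<Gamma> u) UNIV"
    and strongly_local:
      "\<And>u v U c B. u \<in> \<F> \<inter> Cc \<Longrightarrow> v \<in> \<F> \<inter> Cc \<Longrightarrow> open U \<Longrightarrow> (\<And>x. x \<in> U \<Longrightarrow> u x - v x = c) \<Longrightarrow>
         B \<in> sets borel \<Longrightarrow> B \<subseteq> U \<Longrightarrow> emeasure (\<Gamma> u) B = emeasure (\<Gamma> v) B"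


section \<open>Volume doubling, Poincare inequality and capacity upper bound\<close>

definition scale_function :: "(real \<Rightarrow> real) \<Rightarrow> bool" where
  "scale_function \<Psi> \<longleftrightarrow>
     continuous_on {0<..} \<Psi> \<and> strict_mono_on {0<..} \<Psi> \<and> bij_betw \<Psi> {0<..} {0<..} \<and>
     (\<exists>C \<beta>1 \<beta>2. 1 \<le> C \<and> 0 < \<beta>1 \<and> 0 < \<beta>2 \<and>
        (\<forall>r R. 0 < r \<and> r \<le> R \<longrightarrow>
           inverse C * (R / r) powr \<beta>1 \<le> \<Psi> R / \<Psi> r \<and>
           \<Psi> R / \<Psi> r \<le> C * (R / r) powr \<beta>2))"

definition volume_doubling :: "'a::metric_space measure \<Rightarrow> bool" where
  "volume_doubling m \<longleftrightarrow>
     (\<exists>c\<ge>1. \<forall>x. \<forall>r>0. emeasure m (ball x (2 * r)) \<le> ennreal c * emeasure m (ball x r))"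

definition mean_on :: "'a measure \<Rightarrow> 'a set \<Rightarrow> ('a \<Rightarrow> real) \<Rightarrow> real" where
  "mean_on m A u = (1 / measure m A) * (LINT x:A|m. u x)"

definition poincare_inequality ::
  "'a::metric_space measure \<Rightarrow> real \<Rightarrow> ('a \<Rightarrow> real) set \<Rightarrow> (('a \<Rightarrow> real) \<Rightarrow> 'a measure) \<Rightarrow>
   (real \<Rightarrow> real) \<Rightarrow> bool" where
  "poincare_inequality m p \<F> \<Gamma> \<Psi> \<longleftrightarrow>
     (\<exists>C A. 0 < C \<and> 1 \<le> A \<and>
        (\<forall>x. \<forall>r>0. \<forall>u\<in>\<F>.
           (\<integral>\<^sup>+y\<in>ball x r. ennreal (\<bar>u y - mean_on m (ball x r) u\<bar> powr p) \<partial>m)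
             \<le> ennreal (C * \<Psi> r) * emeasure (\<Gamma> u) (ball x (A * r))))"

text \<open>The library's \<open>diameter\<close> is real-valued and hence not usable for unbounded sets.\<close>

definition ediameter :: "'a::metric_space set \<Rightarrow> ereal" where
  "ediameter S = (SUP (x, y) \<in> S \<times> S. ereal (dist x y))"

text \<open>The infimum is taken in \<open>ennreal\<close>, so that it is \<open>\<infinity>\<close> when there is no admissible function.\<close>

definition capacity_upper_bound ::
  "'a::metric_space measure \<Rightarrow> ('a \<Rightarrow> real) set \<Rightarrow> (('a \<Rightarrow> real) \<Rightarrow> real) \<Rightarrow>
   (real \<Rightarrow> real) \<Rightarrow> bool" where
  "capacity_upper_bound m \<F> \<E> \<Psi> \<longleftrightarrow>
     (\<exists>C A1 A2. 1 < C \<and> 1 < A1 \<and> 1 < A2 \<and>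
        (\<forall>x R. 0 < R \<and> ereal R < ediameter (UNIV :: 'a set) / ereal A2 \<longrightarrow>
           (INF u \<in> {u \<in> \<F>. (AE y in m. y \<in> ball x R \<longrightarrow> u y = 1) \<and>
                            (AE y in m. y \<notin> ball x (A1 * R) \<longrightarrow> u y = 0)}. ennreal (\<E> u))
             \<le> ennreal C * emeasure m (ball x R) / ennreal (\<Psi> R)))"


section \<open>Local spaces and the extension property\<close>

definition relatively_compact_in :: "'a::topological_space set \<Rightarrow> 'a set \<Rightarrow> bool" where
  "relatively_compact_in U A \<longleftrightarrow> compact (closure A) \<and> closure A \<subseteq> U"

text \<open>Functions on \<open>U\<close> are represented by functions on the whole space whose values off \<open>U\<close> are irrelevant.\<close>

definition F_loc ::
  "'a::topological_space measure \<Rightarrow> ('a \<Rightarrow> real) set \<Rightarrow> 'a set \<Rightarrow> ('a \<Rightarrow> real) set" where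
  "F_loc m \<F> U =
     {u \<in> borel_measurable (restrict_space borel U).
        \<forall>A. open A \<and> relatively_compact_in U A \<longrightarrow>
            (\<exists>v\<in>\<F>. AE x in m. x \<in> A \<longrightarrow> u x = v x)}"

definition local_extension ::
  "'a measure \<Rightarrow> ('a \<Rightarrow> real) set \<Rightarrow> ('a \<Rightarrow> real) \<Rightarrow> 'a set \<Rightarrow> ('a \<Rightarrow> real)" where
  "local_extension m \<F> u A = (SOME v. v \<in> \<F> \<and> (AE x in m. x \<in> A \<longrightarrow> u x = v x))"

text \<open>
  For \<open>E \<subseteq> A\<close> with \<open>A\<close> open and relatively compact in \<open>U\<close>, the energy measure of \<open>u\<close> on \<open>E\<close>
  is that of any \<open>v \<in> \<F>\<close> agreeing with \<open>u\<close> on \<open>A\<close>; the supremum over the directed family of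
  all such \<open>A\<close> is the monotone limit along any exhaustion of \<open>U\<close>.
\<close>

definition \<Gamma>_loc ::
  "'a::topological_space measure \<Rightarrow> ('a \<Rightarrow> real) set \<Rightarrow> (('a \<Rightarrow> real) \<Rightarrow> 'a measure) \<Rightarrow>
   'a set \<Rightarrow> ('a \<Rightarrow> real) \<Rightarrow> 'a measure" where
  "\<Gamma>_loc m \<F> \<Gamma> U u =
     measure_of U (sets (restrict_space borel U))
       (\<lambda>E. SUP A \<in> {A. open A \<and> relatively_compact_in U A}.
              emeasure (\<Gamma> (local_extension m \<F> u A)) (E \<inter> A))"

definition F_on ::
  "'a::topological_space measure \<Rightarrow> real \<Rightarrow> ('a \<Rightarrow> real) set \<Rightarrow> (('a \<Rightarrow> real) \<Rightarrow> 'a measure) \<Rightarrow>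
   'a set \<Rightarrow> ('a \<Rightarrow> real) set" where
  "F_on m p \<F> \<Gamma> U =
     {u \<in> F_loc m \<F> U.
        (\<integral>\<^sup>+x\<in>U. ennreal (\<bar>u x\<bar> powr p) \<partial>m) + emeasure (\<Gamma>_loc m \<F> \<Gamma> U u) U < \<infinity>}"

definition extension_property ::
  "'a::topological_space measure \<Rightarrow> real \<Rightarrow> ('a \<Rightarrow> real) set \<Rightarrow> (('a \<Rightarrow> real) \<Rightarrow> 'a measure) \<Rightarrow>
   'a set \<Rightarrow> bool" where
  "extension_property m p \<F> \<Gamma> \<Omega> \<longleftrightarrow>
     open \<Omega> \<and> \<Omega> \<noteq> UNIV \<and>
     (\<forall>f \<in> F_on m p \<F> \<Gamma> \<Omega>. \<exists>F\<in>\<F>.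
        (AE x in m. x \<in> \<Omega> \<longrightarrow> f x = F x) \<and> emeasure (\<Gamma> F) (frontier \<Omega>) = 0)"


section \<open>Uniform domains\<close>

definition A_uniform_domain :: "real \<Rightarrow> 'a::metric_space set \<Rightarrow> bool" where
  "A_uniform_domain A U \<longleftrightarrow>
     1 \<le> A \<and> connected U \<and> U \<noteq> {} \<and> open U \<and> U \<noteq> UNIV \<and>
     (\<forall>x\<in>U. \<forall>y\<in>U. \<exists>\<gamma>.
        path \<gamma> \<and> path_image \<gamma> \<subseteq> U \<and> pathstart \<gamma> = x \<and> pathfinish \<gamma> = y \<and>
        diameter (path_image \<gamma>) \<le> A * dist x y \<and>
        (\<forall>z \<in> path_image \<gamma>. infdist z (- U) \<ge> inverse A * min (dist x z) (dist y z)))"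

definition uniform_domain :: "'a::metric_space set \<Rightarrow> bool" where
  "uniform_domain U \<longleftrightarrow> (\<exists>A\<ge>1. A_uniform_domain A U)"

end

theory Submission
  imports Defs
begin

text \<open>
  No Leibniz rule is available, and gluing across the boundary of \<open>U\<close> is the main difficulty, so the
  extension is obtained as a weak limit of globally defined discrete approximations.
  At scale \<open>r\<close> take a net whose local radius is \<open>r\<close> near \<open>U\<close> and grows like the distance to \<open>U\<close> up to
  a fixed size, a subordinate partition of unity of controlled energy, and for each net point the mean
  value of \<open>f\<close> on a reflected ball that lies deep in \<open>U\<close> and has comparable size (0 for the net points
  far from \<open>U\<close>).  The Poincare inequality along chains of balls in \<open>U\<close> bounds the jumps between
  neighbouring coefficients by the energy of \<open>f\<close> on deep regions of bounded overlap, so the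
  approximations are bounded in \<open>\<F>\<close>.  By reflexivity and Mazur's lemma they have a weak limit in \<open>\<F>\<close>; it
  equals \<open>f\<close> on \<open>U\<close> because the approximations converge to \<open>f\<close> locally in \<open>L\<^sup>p\<close>.
  The energy of an approximation on the boundary is controlled by the energy of \<open>f\<close> on a
  shell around the boundary of width \<open>r\<close>, which tends to 0.
\<close>

section \<open>Weak limits in seminormed function spaces\<close>

text \<open>The scales cancel: the p-th power of the difference of means over neighbouring balls of
  radius \<open>\<rho>\<close> costs \<open>\<Psi> \<rho>\<close> divided by the volume, and a
  cutoff of that radius has energy of order volume divided by \<open>\<Psi> \<rho>\<close>. Each net
  point thus contributes the measure of a region that is deep in \<open>U\<close> relative to its
  radius; were the radii not growing with the distance to \<open>U\<close>, a point of
  \<open>U\<close> could lie in arbitrarily many such regions. Weak limits inherit only closed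
  convex conditions, so both conclusions come from bounds on \<open>gN\<close> over a Borel set and
  on a local p-th power integral. Strong locality is assumed for compactly supported continuous
  functions only; cutoffs and local extensions of \<open>f\<close> are general elements of
  \<open>\<F>\<close>, so it is first extended to differences that are constant almost everywhere on
  an open set. Only finite sums are known to lie in \<open>\<F>\<close>, which forces a truncation
  of the coefficients far away. Adding \<open>\<bar>f\<bar> powr p\<close> to the energy measure of
  \<open>f\<close> yields one finite measure that also pays for the jumps to the coefficient
  0.\<close>

definition sublinear_on :: "('s \<Rightarrow> real) set \<Rightarrow> (('s \<Rightarrow> real) \<Rightarrow> real) \<Rightarrow> bool" where
  "sublinear_on V q \<longleftrightarrow>
     (\<forall>u\<in>V. \<forall>v\<in>V. q (\<lambda>x. u x + v x) \<le> q u + q v) \<and>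
     (\<forall>c\<ge>0. \<forall>u\<in>V. q (\<lambda>x. c * u x) \<le> c * q u)"

definition linear_functional_on :: "('s \<Rightarrow> real) set \<Rightarrow> (('s \<Rightarrow> real) \<Rightarrow> real) \<Rightarrow> bool" where
  "linear_functional_on V l \<longleftrightarrow>
     (\<forall>u\<in>V. \<forall>v\<in>V. l (\<lambda>x. u x + v x) = l u + l v) \<and>
     (\<forall>c. \<forall>u\<in>V. l (\<lambda>x. c * u x) = c * l u)"

definition convex_funs :: "('s \<Rightarrow> real) set \<Rightarrow> bool" where
  "convex_funs C \<longleftrightarrow>
     (\<forall>u\<in>C. \<forall>v\<in>C. \<forall>t. 0 \<le> t \<and> t \<le> 1 \<longrightarrow> (\<lambda>x. t * u x + (1 - t) * v x) \<in> C)"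

lemma linear_functional_onD:
  assumes "linear_functional_on V l"
  shows "u \<in> V \<Longrightarrow> v \<in> V \<Longrightarrow> l (\<lambda>x. u x + v x) = l u + l v"
    and "u \<in> V \<Longrightarrow> l (\<lambda>x. c * u x) = c * l u"
    and "u \<in> V \<Longrightarrow> l (\<lambda>x. - u x) = - l u"
proof -
  show "u \<in> V \<Longrightarrow> v \<in> V \<Longrightarrow> l (\<lambda>x. u x + v x) = l u + l v"
    using assms unfolding linear_functional_on_def by blast
  show scale: "u \<in> V \<Longrightarrow> l (\<lambda>x. c * u x) = c * l u" for c
    using assms unfolding linear_functional_on_def by blast
  show "u \<in> V \<Longrightarrow> l (\<lambda>x. - u x) = - l u"
    using scale[of "-1"] by simp
qed

lemma function_subspaceD:
  assumes "function_subspace V"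
  shows "(\<lambda>x. 0) \<in> V"
    and "u \<in> V \<Longrightarrow> v \<in> V \<Longrightarrow> (\<lambda>x. u x + v x) \<in> V"
    and "u \<in> V \<Longrightarrow> (\<lambda>x. c * u x) \<in> V"
    and "u \<in> V \<Longrightarrow> v \<in> V \<Longrightarrow> (\<lambda>x. u x - v x) \<in> V"
    and "u \<in> V \<Longrightarrow> (\<lambda>x. - u x) \<in> V"
proof -
  show add: "u \<in> V \<Longrightarrow> v \<in> V \<Longrightarrow> (\<lambda>x. u x + v x) \<in> V" for u v
    using assms by (auto simp: function_subspace_def)
  show mult: "u \<in> V \<Longrightarrow> (\<lambda>x. c * u x) \<in> V" for c u
    using assms by (auto simp: function_subspace_def)
  show "(\<lambda>x. 0) \<in> V"
    using assms by (auto simp: function_subspace_def)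
  show minus: "u \<in> V \<Longrightarrow> (\<lambda>x. - u x) \<in> V" for u
    using mult[of u "-1"] by simp
  show "u \<in> V \<Longrightarrow> v \<in> V \<Longrightarrow> (\<lambda>x. u x - v x) \<in> V"
    using add[of u "\<lambda>x. - v x"] minus[of v] by simp
qed

lemma function_subspace_sum:
  assumes V: "function_subspace V" and "finite I" and "\<And>i. i \<in> I \<Longrightarrow> u i \<in> V"
  shows "(\<lambda>x. \<Sum>i\<in>I. c i * u i x) \<in> V"
  using assms(2,3)
proof (induction I rule: finite_induct)
  case empty
  then show ?case using function_subspaceD(1)[OF V] by simp
next
  case (insert i I)
  then show ?case
    using function_subspaceD(2)[OF V function_subspaceD(3)[OF V, of "u i" "c i"], of "\<lambda>x. \<Sum>i\<in>I. c i * u i x"]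
    by simp
qed

lemma seminorm_onD:
  assumes "seminorm_on V N"
  shows "u \<in> V \<Longrightarrow> 0 \<le> N u"
    and "u \<in> V \<Longrightarrow> v \<in> V \<Longrightarrow> N (\<lambda>x. u x + v x) \<le> N u + N v"
    and "u \<in> V \<Longrightarrow> N (\<lambda>x. c * u x) = \<bar>c\<bar> * N u"
  using assms by (auto simp: seminorm_on_def)

lemma seminorm_on_zero:
  assumes "function_subspace V" "seminorm_on V N"
  shows "N (\<lambda>x. 0) = 0"
  using seminorm_onD(3)[OF assms(2) function_subspaceD(1)[OF assms(1)], of 0] by simp

lemma seminorm_on_minus:
  assumes "function_subspace V" "seminorm_on V N" "u \<in> V"
  shows "N (\<lambda>x. - u x) = N u"
  using seminorm_onD(3)[OF assms(2,3), of "-1"] by simp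

lemma seminorm_on_diff:
  assumes "function_subspace V" "seminorm_on V N" "u \<in> V" "v \<in> V"
  shows "N (\<lambda>x. u x - v x) \<le> N u + N v"
  using seminorm_onD(2)[OF assms(2,3) function_subspaceD(5)[OF assms(1,4)]]
    seminorm_on_minus[OF assms(1,2,4)] by simp

lemma seminorm_on_triangle:
  assumes "function_subspace V" "seminorm_on V N" "u \<in> V" "v \<in> V"
  shows "N u \<le> N v + N (\<lambda>x. u x - v x)"
  using seminorm_onD(2)[OF assms(2,4) function_subspaceD(4)[OF assms(1,3,4)]] by simp

lemma seminorm_on_sum:
  assumes V: "function_subspace V" and N: "seminorm_on V N"
    and "finite I" and "\<And>i. i \<in> I \<Longrightarrow> u i \<in> V"
  shows "N (\<lambda>x. \<Sum>i\<in>I. c i * u i x) \<le> (\<Sum>i\<in>I. \<bar>c i\<bar> * N (u i))"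
  using assms(3,4)
proof (induction I rule: finite_induct)
  case empty
  then show ?case using seminorm_on_zero[OF V N] by simp
next
  case (insert i I)
  have "N (\<lambda>x. c i * u i x + (\<Sum>i\<in>I. c i * u i x))
      \<le> N (\<lambda>x. c i * u i x) + N (\<lambda>x. \<Sum>i\<in>I. c i * u i x)"
    by (rule seminorm_onD(2)[OF N]) (use insert in \<open>auto intro!: function_subspaceD(3)[OF V] function_subspace_sum[OF V]\<close>)
  then show ?case
    using insert seminorm_onD(3)[OF N, of "u i" "c i"] by simp
qed

lemma sublinear_onD:
  assumes "sublinear_on V q"
  shows "u \<in> V \<Longrightarrow> v \<in> V \<Longrightarrow> q (\<lambda>x. u x + v x) \<le> q u + q v"
    and "0 \<le> c \<Longrightarrow> u \<in> V \<Longrightarrow> q (\<lambda>x. c * u x) \<le> c * q u"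
  using assms by (auto simp: sublinear_on_def)

lemma sublinear_on_zero:
  assumes V: "function_subspace V" and q: "sublinear_on V q"
  shows "q (\<lambda>x. 0) = 0"
  using sublinear_onD(2)[OF q, of 0 "\<lambda>x. 0"]
    sublinear_onD(1)[OF q, of "\<lambda>x. 0" "\<lambda>x. 0"] function_subspaceD(1)[OF V] by simp

lemma sublinear_on_scale:
  assumes V: "function_subspace V" and q: "sublinear_on V q" and "0 \<le> c" "u \<in> V"
  shows "q (\<lambda>x. c * u x) = c * q u"
proof (cases "c = 0")
  case True
  then show ?thesis using sublinear_on_zero[OF V q] by simp
next
  case False
  with assms have c: "c > 0" by simp
  have "q (\<lambda>x. inverse c * (c * u x)) \<le> inverse c * q (\<lambda>x. c * u x)"
    using c by (intro sublinear_onD(2)[OF q] function_subspaceD(3)[OF V] assms) auto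
  also have "(\<lambda>x. inverse c * (c * u x)) = u"
    using c by (auto simp: fun_eq_iff)
  finally have "c * q u \<le> q (\<lambda>x. c * u x)"
    using c by (simp add: field_simps)
  with sublinear_onD(2)[OF q assms(3,4)] show ?thesis by simp
qed

lemma sublinear_on_lower:
  assumes V: "function_subspace V" and q: "sublinear_on V q" and "u \<in> V"
  shows "- q (\<lambda>x. - u x) \<le> q u"
  using sublinear_onD(1)[OF q assms(3) function_subspaceD(5)[OF V assms(3)]]
    sublinear_on_zero[OF V q] by simp

text \<open>The value 0 off \<open>V\<close> lets functionals be compared pointwise on all functions
  and matches the normalisation in \<open>dual_space\<close>.\<close>

lemma sublinear_on_restrict:
  assumes "function_subspace V" "sublinear_on V q"
  shows "sublinear_on V (\<lambda>u. if u \<in> V then q u else 0)"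
  using assms(2) by (simp add: sublinear_on_def function_subspaceD[OF assms(1)])

text \<open>One criterion serves three infima: over a chain in Zorn's lemma, over multiples of a
  fixed direction, and over the cone used for separation. A single index beating each sum replaces
  attained infima.\<close>

lemma sublinear_on_INF:
  fixes g :: "'i \<Rightarrow> ('s \<Rightarrow> real) \<Rightarrow> real"
  assumes V: "function_subspace V"
    and bdd: "\<And>u. u \<in> V \<Longrightarrow> bdd_below ((\<lambda>i. g i u) ` I)"
    and zero: "\<exists>i\<in>I. g i (\<lambda>x. 0) \<le> 0"
    and add: "\<And>i j u v. i \<in> I \<Longrightarrow> j \<in> I \<Longrightarrow> u \<in> V \<Longrightarrow> v \<in> V \<Longrightarrow> \<exists>k\<in>I. g k (\<lambda>x. u x + v x) \<le> g i u + g j v"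
    and scale: "\<And>i c u. i \<in> I \<Longrightarrow> 0 < c \<Longrightarrow> u \<in> V \<Longrightarrow> \<exists>k\<in>I. g k (\<lambda>x. c * u x) \<le> c * g i u"
  shows "sublinear_on V (\<lambda>u. INF i\<in>I. g i u)"
proof -
  let ?q = "\<lambda>u. INF i\<in>I. g i u"
  have ne: "I \<noteq> {}" using zero by blast
  have lower: "?q u \<le> g i u" if "i \<in> I" "u \<in> V" for i u
    by (rule cINF_lower[OF bdd]) (use that in auto)
  show ?thesis
    unfolding sublinear_on_def
  proof (intro conjI ballI allI impI)
    fix u v assume uv: "u \<in> V" "v \<in> V"
    note uv' = function_subspaceD(2)[OF V uv]
    have le: "?q (\<lambda>x. u x + v x) \<le> g i u + g j v" if "i \<in> I" "j \<in> I" for i j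
      using add[OF that uv] lower[OF _ uv'] by force
    have "?q (\<lambda>x. u x + v x) - g j v \<le> ?q u" if "j \<in> I" for j
      by (rule cINF_greatest[OF ne]) (use le[OF _ that] in \<open>simp add: algebra_simps\<close>)
    then have "?q (\<lambda>x. u x + v x) - ?q u \<le> ?q v"
      by (intro cINF_greatest[OF ne]) (simp add: algebra_simps)
    then show "?q (\<lambda>x. u x + v x) \<le> ?q u + ?q v" by simp
  next
    fix c :: real and u assume c: "0 \<le> c" and u: "u \<in> V"
    note cu = function_subspaceD(3)[OF V u, of c]
    show "?q (\<lambda>x. c * u x) \<le> c * ?q u"
    proof (cases "c = 0")
      case True
      then show ?thesis using zero lower[OF _ function_subspaceD(1)[OF V]] by force
    next
      case False
      then have c0: "0 < c" using c by simp
      have le: "?q (\<lambda>x. c * u x) \<le> c * g i u" if "i \<in> I" for i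
        using scale[OF that c0 u] lower[OF _ cu] by force
      have "?q (\<lambda>x. c * u x) / c \<le> ?q u"
        by (rule cINF_greatest[OF ne]) (use le c0 in \<open>simp add: field_simps\<close>)
      then show ?thesis using c0 by (simp add: field_simps)
    qed
  qed
qed

text \<open>Hahn--Banach: a minimal sublinear functional below \<open>q\<close> is linear.\<close>

lemma linear_functional_below_sublinear:
  assumes V: "function_subspace V" and q: "sublinear_on V q"
  obtains l where "linear_functional_on V l" "\<And>u. u \<in> V \<Longrightarrow> l u \<le> q u" "\<And>u. u \<notin> V \<Longrightarrow> l u = 0"
proof -
  define A where "A = {q'. sublinear_on V q' \<and> (\<forall>u\<in>V. q' u \<le> q u) \<and> (\<forall>u. u \<notin> V \<longrightarrow> q' u = 0)}"
  \<comment> \<open>This bound depends on \<open>q\<close> only, so infima over chains stay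
    finite.\<close>
  have low: "- q (\<lambda>x. - u x) \<le> q' u" if "q' \<in> A" "u \<in> V" for q' u
  proof -
    have "q' (\<lambda>x. - u x) \<le> q (\<lambda>x. - u x)"
      using that function_subspaceD(5)[OF V that(2)] by (auto simp: A_def)
    with sublinear_on_lower[OF V _ that(2), of q'] that show ?thesis by (auto simp: A_def)
  qed
  have "\<exists>l\<in>A. \<forall>a\<in>A. a \<le> l \<longrightarrow> a = l"
  proof (rule predicate_Zorn)
    show "partial_order_on A (relation_of (\<lambda>x y. y \<le> x) A)"
      by (rule partial_order_on_relation_ofI) auto
  next
    fix C assume C: "C \<in> Chains (relation_of (\<lambda>x y. y \<le> x) A)"
    show "\<exists>u\<in>A. \<forall>a\<in>C. u \<le> a"
    proof (cases "C = {}")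
      case True
      have "(\<lambda>u. if u \<in> V then q u else 0) \<in> A"
        using q by (auto simp: A_def sublinear_on_def function_subspaceD[OF V])
      with True show ?thesis by auto
    next
      case False
      have CA: "C \<subseteq> A" using C by (rule Chains_relation_of)
      have tot: "a \<le> b \<or> b \<le> a" if "a \<in> C" "b \<in> C" for a b
        using C that unfolding Chains_def relation_of_def by blast
      define i where "i u = (if u \<in> V then INF a\<in>C. a u else 0)" for u
      have bdd: "bdd_below ((\<lambda>a. a u) ` C)" if "u \<in> V" for u
        using low that CA by (intro bdd_belowI2[where m="- q (\<lambda>x. - u x)"]) auto
      have i_le: "i u \<le> a u" if "a \<in> C" "u \<in> V" for a u
        using bdd[OF that(2)] that by (auto simp: i_def intro: cINF_lower)
      have "sublinear_on V (\<lambda>u. INF a\<in>C. a u)"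
      proof (rule sublinear_on_INF[OF V bdd])
        obtain a where "a \<in> C" using False by blast
        moreover from this have "a (\<lambda>x. 0) = 0"
          using CA by (intro sublinear_on_zero[OF V]) (auto simp: A_def)
        ultimately show "\<exists>a\<in>C. a (\<lambda>x. 0) \<le> 0" by (intro bexI[of _ a]) simp_all
      next
        fix a b u v assume ab: "a \<in> C" "b \<in> C" and uv: "u \<in> V" "v \<in> V"
        obtain d where d: "d \<in> C" "d \<le> a" "d \<le> b" using tot[OF ab] ab by blast
        have "d (\<lambda>x. u x + v x) \<le> d u + d v"
          using d(1) CA uv by (auto simp: A_def sublinear_on_def)
        also have "\<dots> \<le> a u + b v" using d by (auto simp: le_fun_def intro: add_mono)
        finally show "\<exists>d\<in>C. d (\<lambda>x. u x + v x) \<le> a u + b v" using d(1) by blast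
      next
        fix a and c :: real and u assume "a \<in> C" "0 < c" "u \<in> V"
        then show "\<exists>b\<in>C. b (\<lambda>x. c * u x) \<le> c * a u"
          using CA sublinear_onD(2)[of V a c u] by (intro bexI[of _ a]) (auto simp: A_def)
      qed
      then have "sublinear_on V i" unfolding i_def[abs_def] by (rule sublinear_on_restrict[OF V])
      moreover have "i u \<le> q u" if "u \<in> V" for u
      proof -
        obtain a where "a \<in> C" using False by blast
        then show ?thesis using i_le[of a u] CA that by (force simp: A_def)
      qed
      ultimately have "i \<in> A" by (auto simp: A_def i_def)
      moreover have "i \<le> a" if "a \<in> C" for a
      proof (rule le_funI)
        fix u show "i u \<le> a u"
          using i_le[OF that, of u] that CA by (cases "u \<in> V") (auto simp: A_def i_def)
      qed
      ultimately show ?thesis by blast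
    qed
  qed
  then obtain l where lA: "l \<in> A" and min: "\<And>a. a \<in> A \<Longrightarrow> a \<le> l \<Longrightarrow> a = l" by blast
  have l: "sublinear_on V l" using lA by (auto simp: A_def)
  have super: "l u + l y \<le> l (\<lambda>x. u x + y x)" if u: "u \<in> V" and y: "y \<in> V" for u y
  proof -
    \<comment> \<open>The classical lowering of \<open>l\<close> in the direction \<open>y\<close>:
      the infimum is sublinear and lies below \<open>l\<close>, so minimality makes it equal to
      \<open>l\<close>, and \<open>t = 1\<close> then gives superadditivity.\<close>
    define i where "i u = (if u \<in> V then INF t\<in>{0..}. l (\<lambda>x. u x + t * y x) - t * l y else 0)" for u
    have mem: "(\<lambda>x. u x + t * y x) \<in> V" if "u \<in> V" for u t
      using function_subspaceD(2,3)[OF V] y that by blast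
    have lower: "- l (\<lambda>x. - u x) \<le> l (\<lambda>x. u x + t * y x) - t * l y" if "u \<in> V" "0 \<le> t" for u t
    proof -
      have "l (\<lambda>x. (u x + t * y x) + - u x) \<le> l (\<lambda>x. u x + t * y x) + l (\<lambda>x. - u x)"
        by (intro sublinear_onD(1)[OF l] mem that function_subspaceD(5)[OF V])
      moreover have "(\<lambda>x. (u x + t * y x) + - u x) = (\<lambda>x. t * y x)" by auto
      ultimately show ?thesis using sublinear_on_scale[OF V l that(2) y] by simp
    qed
    have bdd: "bdd_below ((\<lambda>t. l (\<lambda>x. u x + t * y x) - t * l y) ` {0..})" if "u \<in> V" for u
      using lower that by (intro bdd_belowI2[where m="- l (\<lambda>x. - u x)"]) auto
    have i_le: "i u \<le> l (\<lambda>x. u x + t * y x) - t * l y" if "u \<in> V" "0 \<le> t" for u t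
    proof -
      have "Inf ((\<lambda>t. l (\<lambda>x. u x + t * y x) - t * l y) ` {0..}) \<le> l (\<lambda>x. u x + t * y x) - t * l y"
        by (rule cINF_lower[OF bdd[OF that(1)]]) (use that in auto)
      then show ?thesis using that by (simp add: i_def)
    qed
    have i_l: "i u \<le> l u" if "u \<in> V" for u
      using i_le[OF that, of 0] by simp
    have "sublinear_on V (\<lambda>u. INF t\<in>{0..}. l (\<lambda>x. u x + t * y x) - t * l y)"
    proof (rule sublinear_on_INF[OF V bdd])
      show "\<exists>t\<in>{0..}. l (\<lambda>x. 0 + t * y x) - t * l y \<le> 0"
        using sublinear_on_zero[OF V l] by (intro bexI[of _ 0]) auto
    next
      fix s t u v assume st: "s \<in> {0::real..}" "t \<in> {0::real..}" and uv: "u \<in> V" "v \<in> V"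
      have "(\<lambda>x. (u x + v x) + (s + t) * y x) = (\<lambda>x. (u x + s * y x) + (v x + t * y x))"
        by (auto simp: algebra_simps)
      then have "l (\<lambda>x. (u x + v x) + (s + t) * y x) \<le> l (\<lambda>x. u x + s * y x) + l (\<lambda>x. v x + t * y x)"
        using sublinear_onD(1)[OF l mem[OF uv(1), of s] mem[OF uv(2), of t]] by simp
      then show "\<exists>k\<in>{0..}. l (\<lambda>x. (u x + v x) + k * y x) - k * l y
          \<le> (l (\<lambda>x. u x + s * y x) - s * l y) + (l (\<lambda>x. v x + t * y x) - t * l y)"
        using st by (intro bexI[of _ "s + t"]) (auto simp: distrib_right)
    next
      fix t c u assume t: "t \<in> {0::real..}" and c: "0 < (c::real)" and u: "u \<in> V"
      have "(\<lambda>x. c * u x + (c * t) * y x) = (\<lambda>x. c * (u x + t * y x))"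
        by (auto simp: algebra_simps)
      then have "l (\<lambda>x. c * u x + (c * t) * y x) \<le> c * l (\<lambda>x. u x + t * y x)"
        using sublinear_onD(2)[OF l _ mem[OF u], of c t] c by simp
      then show "\<exists>k\<in>{0..}. l (\<lambda>x. c * u x + k * y x) - k * l y \<le> c * (l (\<lambda>x. u x + t * y x) - t * l y)"
        using t c by (intro bexI[of _ "c * t"]) (auto simp: right_diff_distrib)
    qed
    then have "sublinear_on V i" unfolding i_def[abs_def] by (rule sublinear_on_restrict[OF V])
    moreover have "i u \<le> q u" if "u \<in> V" for u
      using i_l[OF that] lA that by (force simp: A_def)
    ultimately have "i \<in> A" by (auto simp: A_def i_def)
    moreover have "i \<le> l"
    proof (rule le_funI)
      fix u show "i u \<le> l u"
        using i_l[of u] lA by (cases "u \<in> V") (auto simp: A_def i_def)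
    qed
    ultimately have "i = l" by (rule min)
    then show ?thesis using i_le[OF u, of 1] by simp
  qed
  have add: "l (\<lambda>x. u x + v x) = l u + l v" if "u \<in> V" "v \<in> V" for u v
    using super[OF that] sublinear_onD(1)[OF l that] by simp
  have minus: "l (\<lambda>x. - u x) = - l u" if "u \<in> V" for u
    using add[OF that function_subspaceD(5)[OF V that]] sublinear_on_zero[OF V l] by simp
  have scale: "l (\<lambda>x. c * u x) = c * l u" if u: "u \<in> V" for c u
  proof (cases "c \<ge> 0")
    case True
    then show ?thesis using sublinear_on_scale[OF V l _ u] by simp
  next
    case False
    then have "l (\<lambda>x. (- c) * u x) = (- c) * l u" by (intro sublinear_on_scale[OF V l _ u]) simp
    moreover have "l (\<lambda>x. - ((- c) * u x)) = - l (\<lambda>x. (- c) * u x)"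
      by (rule minus) (rule function_subspaceD(3)[OF V u])
    ultimately show ?thesis by simp
  qed
  show thesis
    using that[of l] add scale lA by (auto simp: linear_functional_on_def A_def)
qed

text \<open>Hahn-Banach is applied to the infimum of \<open>N (u + t (w - c)) - t e\<close> over
  nonnegative \<open>t\<close> and \<open>c\<close> in \<open>C\<close>. It lies below
  \<open>N\<close> (take \<open>t = 0\<close>), which makes the functional bounded, and is at most
  \<open>- e\<close> at \<open>c - w\<close> (take \<open>t = 1\<close>), which gives the
  gap.\<close>

lemma separating_functional:
  assumes V: "function_subspace V" and N: "seminorm_on V N"
    and CV: "C \<subseteq> V" and C: "convex_funs C" and ne: "C \<noteq> {}" and w: "w \<in> V"
    and far: "\<And>c. c \<in> C \<Longrightarrow> e \<le> N (\<lambda>x. w x - c x)"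
  obtains l where "l \<in> dual_space V N" "\<And>c. c \<in> C \<Longrightarrow> l c + e \<le> l w"
proof -
  define g where "g u tc = N (\<lambda>x. u x + fst tc * (w x - snd tc x)) - fst tc * e" for u tc
  define I where "I = {0::real..} \<times> C"
  define q where "q u = (INF tc\<in>I. g u tc)" for u
  have Ine: "I \<noteq> {}" using ne by (auto simp: I_def)
  have d: "(\<lambda>x. w x - c x) \<in> V" if "c \<in> C" for c
    using function_subspaceD(4)[OF V w] CV that by blast
  have td: "(\<lambda>x. t * (w x - c x)) \<in> V" if "c \<in> C" for c t
    using function_subspaceD(3)[OF V d[OF that]] .
  have utd: "(\<lambda>x. u x + t * (w x - c x)) \<in> V" if "u \<in> V" "c \<in> C" for u c t
    using function_subspaceD(2)[OF V that(1) td[OF that(2)]] .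
  \<comment> \<open>The distance hypothesis enters here: \<open>t * e\<close> is absorbed by
    \<open>t * N (w - c)\<close>, so the infimum is finite.\<close>
  have low: "- N u \<le> g u tc" if u: "u \<in> V" and tcI: "tc \<in> I" for u tc
  proof -
    obtain t c where tc: "tc = (t, c)" "0 \<le> t" "c \<in> C" using tcI unfolding I_def by blast
    have "N (\<lambda>x. (u x + t * (w x - c x)) - u x) \<le> N (\<lambda>x. u x + t * (w x - c x)) + N u"
      by (intro seminorm_on_diff[OF V N] utd u tc)
    moreover have "N (\<lambda>x. t * (w x - c x)) = t * N (\<lambda>x. w x - c x)"
      using seminorm_onD(3)[OF N d[OF tc(3)]] tc by simp
    moreover have "t * e \<le> t * N (\<lambda>x. w x - c x)"
      using far[OF tc(3)] tc by (intro mult_left_mono)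
    ultimately show ?thesis by (simp add: g_def tc)
  qed
  have bdd: "bdd_below (g u ` I)" if "u \<in> V" for u
    using low[OF that] by (intro bdd_belowI2[where m="- N u"]) auto
  have q_le: "q u \<le> g u (t, c)" if "u \<in> V" "0 \<le> t" "c \<in> C" for u t c
    unfolding q_def by (rule cINF_lower[OF bdd]) (use that in \<open>auto simp: I_def\<close>)
  have q_N: "q u \<le> N u" if "u \<in> V" for u
  proof -
    obtain c where "c \<in> C" using ne by blast
    from q_le[OF that _ this, of 0] show ?thesis by (simp add: g_def)
  qed
  have "sublinear_on V (\<lambda>u. INF tc\<in>I. g u tc)"
  proof (rule sublinear_on_INF[OF V bdd])
    obtain c where "c \<in> C" using ne by blast
    then show "\<exists>tc\<in>I. g (\<lambda>x. 0) tc \<le> 0"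
      using seminorm_on_zero[OF V N] by (intro bexI[of _ "(0, c)"]) (auto simp: I_def g_def)
  next
    fix i j u v assume ij: "i \<in> I" "j \<in> I" and uv: "u \<in> V" "v \<in> V"
    obtain s c where i: "i = (s, c)" "0 \<le> s" "c \<in> C" using ij(1) unfolding I_def by blast
    obtain t d where j: "j = (t, d)" "0 \<le> t" "d \<in> C" using ij(2) unfolding I_def by blast
    \<comment> \<open>Convexity makes the cone over \<open>w - C\<close> closed under addition, with
      weights \<open>s / (s + t)\<close> and \<open>t / (s + t)\<close>. If both parameters are 0,
      any point of \<open>C\<close> will do.\<close>
    define b where "b = (if s + t = 0 then c else (\<lambda>x. (s / (s + t)) * c x + (1 - s / (s + t)) * d x))"
    have b: "b \<in> C"
    proof (cases "s + t = 0")
      case False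
      with i j have "0 \<le> s / (s + t)" "s / (s + t) \<le> 1" by (auto simp: divide_simps)
      with C i(3) j(3) have "(\<lambda>x. (s / (s + t)) * c x + (1 - s / (s + t)) * d x) \<in> C"
        unfolding convex_funs_def by blast
      then show ?thesis unfolding b_def using False by simp
    qed (use i in \<open>simp add: b_def\<close>)
    have eq: "(s + t) * (w x - b x) = s * (w x - c x) + t * (w x - d x)" for x
      using i(2) j(2) by (cases "s + t = 0")
        (auto simp: b_def add_nonneg_eq_0_iff divide_simps, auto simp: algebra_simps)
    have "g (\<lambda>x. u x + v x) (s + t, b) = N (\<lambda>x. (u x + s * (w x - c x)) + (v x + t * (w x - d x))) - (s + t) * e"
      by (simp only: g_def eq fst_conv snd_conv) (simp only: add.assoc add.left_commute)
    also have "\<dots> \<le> g u i + g v j"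
      using seminorm_onD(2)[OF N utd[OF uv(1) i(3)] utd[OF uv(2) j(3)], of s t]
      by (simp add: g_def i j algebra_simps)
    finally show "\<exists>k\<in>I. g (\<lambda>x. u x + v x) k \<le> g u i + g v j"
      using i j b by (intro bexI[of _ "(s + t, b)"]) (auto simp: I_def)
  next
    fix i a u assume "i \<in> I" and a: "0 < (a::real)" and u: "u \<in> V"
    then obtain t c where i: "i = (t, c)" "0 \<le> t" "c \<in> C" unfolding I_def by blast
    have "g (\<lambda>x. a * u x) (a * t, c) = N (\<lambda>x. a * (u x + t * (w x - c x))) - a * t * e"
      by (simp add: g_def algebra_simps)
    also have "\<dots> = a * g u i"
      using seminorm_onD(3)[OF N utd[OF u i(3)], of a t] a by (simp add: g_def i algebra_simps)
    finally show "\<exists>k\<in>I. g (\<lambda>x. a * u x) k \<le> a * g u i"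
      using i a by (intro bexI[of _ "(a * t, c)"]) (auto simp: I_def)
  qed
  then have "sublinear_on V q" unfolding q_def[abs_def] .
  from linear_functional_below_sublinear[OF V this] obtain l where
    l: "linear_functional_on V l" "\<And>u. u \<in> V \<Longrightarrow> l u \<le> q u" "\<And>u. u \<notin> V \<Longrightarrow> l u = 0" by blast
  have minus: "l (\<lambda>x. - u x) = - l u" if "u \<in> V" for u
    using linear_functional_onD(3)[OF l(1) that] .
  have bound: "\<bar>l u\<bar> \<le> 1 * N u" if u: "u \<in> V" for u
  proof -
    have "l u \<le> N u" using l(2)[OF u] q_N[OF u] by simp
    moreover have "- l u \<le> N u"
      using l(2)[OF function_subspaceD(5)[OF V u]] q_N[OF function_subspaceD(5)[OF V u]]
        minus[OF u] seminorm_on_minus[OF V N u] by simp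
    ultimately show ?thesis by simp
  qed
  have "l \<in> dual_space V N"
    unfolding dual_space_def mem_Collect_eq using l(1,3) bound unfolding linear_functional_on_def by blast
  moreover have "l c + e \<le> l w" if c: "c \<in> C" for c
  proof -
    have dV: "(\<lambda>x. c x - w x) \<in> V" using function_subspaceD(4)[OF V _ w] CV c by blast
    have "l (\<lambda>x. c x - w x) \<le> g (\<lambda>x. c x - w x) (1, c)"
      using l(2)[OF dV] q_le[OF dV _ c, of 1] by simp
    also have "\<dots> = - e" using seminorm_on_zero[OF V N] by (simp add: g_def)
    also have "l (\<lambda>x. c x - w x) = l c - l w"
    proof -
      have "l (\<lambda>x. c x + - w x) = l c + l (\<lambda>x. - w x)"
        by (rule linear_functional_onD(1)[OF l(1)]) (use c CV function_subspaceD(5)[OF V w] in auto)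
      then show ?thesis using minus[OF w] by simp
    qed
    finally show ?thesis by simp
  qed
  ultimately show thesis using that by blast
qed

section \<open>Duals, biduals and weak cluster points\<close>

lemma dual_space_bounded:
  assumes "l \<in> dual_space V N"
  obtains C where "\<And>u. u \<in> V \<Longrightarrow> \<bar>l u\<bar> \<le> C * N u"
  using assms unfolding dual_space_def by blast

lemma dual_space_subspace:
  assumes V: "function_subspace V"
  shows "function_subspace (dual_space V N)"
  unfolding function_subspace_def
proof (intro conjI ballI allI)
  show "(\<lambda>x. 0) \<in> dual_space V N"
    by (auto simp: dual_space_def intro!: exI[of _ 0])
next
  fix l l' assume l: "l \<in> dual_space V N" "l' \<in> dual_space V N"
  obtain C C' where C: "\<And>u. u \<in> V \<Longrightarrow> \<bar>l u\<bar> \<le> C * N u" "\<And>u. u \<in> V \<Longrightarrow> \<bar>l' u\<bar> \<le> C' * N u"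
    using dual_space_bounded[OF l(1)] dual_space_bounded[OF l(2)] by metis
  have "\<bar>l u + l' u\<bar> \<le> (C + C') * N u" if "u \<in> V" for u
    using C[OF that] by (simp add: algebra_simps)
  then show "(\<lambda>x. l x + l' x) \<in> dual_space V N"
    using l by (auto simp: dual_space_def algebra_simps intro!: exI[of _ "C + C'"])
next
  fix c l assume l: "l \<in> dual_space V N"
  obtain C where C: "\<And>u. u \<in> V \<Longrightarrow> \<bar>l u\<bar> \<le> C * N u"
    using l unfolding dual_space_def by blast
  have "\<bar>c * l u\<bar> \<le> (\<bar>c\<bar> * C) * N u" if "u \<in> V" for u
    using mult_left_mono[OF C[OF that], of "\<bar>c\<bar>"] by (simp add: abs_mult algebra_simps)
  then show "(\<lambda>x. c * l x) \<in> dual_space V N"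
    using l by (auto simp: dual_space_def algebra_simps intro!: exI[of _ "\<bar>c\<bar> * C"])
qed

lemma dual_norm_bdd_above:
  assumes N: "seminorm_on V N" and l: "l \<in> dual_space V N"
  shows "bdd_above ((\<lambda>u. \<bar>l u\<bar>) ` {u \<in> V. N u \<le> 1})"
proof -
  obtain C where C: "\<And>u. u \<in> V \<Longrightarrow> \<bar>l u\<bar> \<le> C * N u"
    using l by (rule dual_space_bounded) blast
  show ?thesis
  proof (rule bdd_aboveI2[where M="\<bar>C\<bar>"])
    fix u assume "u \<in> {u \<in> V. N u \<le> 1}"
    then have u: "u \<in> V" "N u \<le> 1" "0 \<le> N u" using seminorm_onD(1)[OF N] by auto
    have "C * N u \<le> \<bar>C\<bar> * 1" using u by (intro mult_mono) auto
    then show "\<bar>l u\<bar> \<le> \<bar>C\<bar>" using C[OF u(1)] by simp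
  qed
qed

lemma dual_norm_bound:
  assumes V: "function_subspace V" and N: "seminorm_on V N" and l: "l \<in> dual_space V N" and u: "u \<in> V"
  shows "\<bar>l u\<bar> \<le> dual_norm V N l * N u"
proof -
  obtain C where C: "\<And>u. u \<in> V \<Longrightarrow> \<bar>l u\<bar> \<le> C * N u"
    using l unfolding dual_space_def by blast
  have bdd: "bdd_above ((\<lambda>u. \<bar>l u\<bar>) ` {u \<in> V. N u \<le> 1})"
    by (rule dual_norm_bdd_above[OF N l])
  show ?thesis
  proof (cases "N u = 0")
    case True
    then show ?thesis using C[OF u] by simp
  next
    case False
    then have pos: "N u > 0" using seminorm_onD(1)[OF N u] by simp
    define v where "v = (\<lambda>x. inverse (N u) * u x)"
    have v: "v \<in> V" using function_subspaceD(3)[OF V u] by (simp add: v_def)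
    have "N v = 1" using seminorm_onD(3)[OF N u, of "inverse (N u)"] pos by (simp add: v_def)
    then have "\<bar>l v\<bar> \<le> dual_norm V N l"
      unfolding dual_norm_def using v by (intro cSUP_upper[OF _ bdd]) auto
    moreover have "l v = inverse (N u) * l u"
      using l u by (auto simp: dual_space_def v_def)
    ultimately show ?thesis using pos by (simp add: abs_mult field_simps)
  qed
qed

text \<open>A combination of weak sequential compactness and Mazur's lemma.  The weak limit is taken along a
  Banach limit, which exists by Hahn--Banach as well.\<close>

lemma weak_cluster:
  fixes V :: "('a \<Rightarrow> real) set"
  assumes V: "function_subspace V" and N: "seminorm_on V N" and refl: "reflexive_seminorm_on V N"
    and u: "\<And>n::nat. u n \<in> V" and M: "\<And>n. N (u n) \<le> M"
  obtains w where "w \<in> V"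
    "\<And>C e. C \<subseteq> V \<Longrightarrow> convex_funs C \<Longrightarrow> \<forall>\<^sub>F n in sequentially. u n \<in> C \<Longrightarrow> 0 < e \<Longrightarrow>
        \<exists>c\<in>C. N (\<lambda>x. w x - c x) < e"
proof -
  let ?D = "dual_space V N"
  have M0: "0 \<le> M" using seminorm_onD(1)[OF N u, of 0] M[of 0] by simp
  have D: "function_subspace ?D" by (rule dual_space_subspace[OF V])
  \<comment> \<open>\<open>q l\<close> is the limit superior of \<open>l (u n)\<close>, written as
    the infimum of the eventual upper bounds; a linear functional below it is a Banach
    limit.\<close>
  define B where "B l = {c::real. \<forall>\<^sub>F n in sequentially. l (u n) \<le> c}" for l :: "('a \<Rightarrow> real) \<Rightarrow> real"
  define q where "q l = Inf (B l)" for l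
  have dn: "\<bar>l (u n)\<bar> \<le> dual_norm V N l * M" if "l \<in> ?D" for l n
  proof -
    have "0 \<le> dual_norm V N l"
    proof -
      from cSUP_upper[OF _ dual_norm_bdd_above[OF N that], of "\<lambda>x. 0"] have "\<bar>l (\<lambda>x. 0)\<bar> \<le> dual_norm V N l"
        using function_subspaceD(1)[OF V] seminorm_on_zero[OF V N] by (simp add: dual_norm_def)
      then show ?thesis by linarith
    qed
    then show ?thesis
      using dual_norm_bound[OF V N that u, of n] mult_left_mono[OF M[of n], of "dual_norm V N l"] by linarith
  qed
  have ne: "dual_norm V N l * M \<in> B l" if "l \<in> ?D" for l
    using dn[OF that] unfolding B_def by (simp add: abs_le_iff)
  have low: "- (dual_norm V N l * M) \<le> c" if "l \<in> ?D" "c \<in> B l" for l c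
  proof -
    from that(2) have "\<forall>\<^sub>F n in sequentially. l (u n) \<le> c" by (simp add: B_def)
    then obtain n where "l (u n) \<le> c" by (auto simp: eventually_sequentially)
    with dn[OF that(1), of n] show ?thesis by linarith
  qed
  have bdd: "bdd_below (B l)" if "l \<in> ?D" for l
    using low[OF that] by (intro bdd_belowI) auto
  have q_le: "q l \<le> c" if "l \<in> ?D" "c \<in> B l" for l c
    unfolding q_def using bdd that by (intro cInf_lower) auto
  have q_ge: "a \<le> q l" if "l \<in> ?D" "\<And>c. c \<in> B l \<Longrightarrow> a \<le> c" for a l
    unfolding q_def using ne[OF that(1)] that by (intro cInf_greatest) auto
  have "sublinear_on ?D q"
    unfolding sublinear_on_def
  proof (intro conjI ballI allI impI)
    fix l l' assume ll: "l \<in> ?D" "l' \<in> ?D"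
    have ll': "(\<lambda>x. l x + l' x) \<in> ?D" using function_subspaceD(2)[OF D] ll by auto
    have *: "q (\<lambda>x. l x + l' x) \<le> c + c'" if "c \<in> B l" "c' \<in> B l'" for c c'
    proof (rule q_le[OF ll'])
      have "\<forall>\<^sub>F n in sequentially. l (u n) \<le> c" "\<forall>\<^sub>F n in sequentially. l' (u n) \<le> c'"
        using that by (simp_all add: B_def)
      then have "\<forall>\<^sub>F n in sequentially. l (u n) + l' (u n) \<le> c + c'"
        by eventually_elim simp
      then show "c + c' \<in> B (\<lambda>x. l x + l' x)" by (simp add: B_def)
    qed
    have "q (\<lambda>x. l x + l' x) - c' \<le> q l" if "c' \<in> B l'" for c'
      by (rule q_ge) (use *[OF _ that] ll in \<open>auto simp: algebra_simps\<close>)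
    then have "q (\<lambda>x. l x + l' x) - q l \<le> q l'"
      by (intro q_ge ll) (auto simp: algebra_simps)
    then show "q (\<lambda>x. l x + l' x) \<le> q l + q l'" by simp
  next
    fix c :: real and l assume c: "0 \<le> c" and l: "l \<in> ?D"
    have cl: "(\<lambda>x. c * l x) \<in> ?D" using function_subspaceD(3)[OF D] l by auto
    have *: "q (\<lambda>x. c * l x) \<le> c * a" if "a \<in> B l" for a
    proof (rule q_le[OF cl])
      have "\<forall>\<^sub>F n in sequentially. l (u n) \<le> a" using that by (simp add: B_def)
      then have "\<forall>\<^sub>F n in sequentially. c * l (u n) \<le> c * a"
        by eventually_elim (rule mult_left_mono[OF _ c])
      then show "c * a \<in> B (\<lambda>x. c * l x)" by (simp add: B_def)
    qed
    show "q (\<lambda>x. c * l x) \<le> c * q l"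
    proof (cases "c = 0")
      case True
      then show ?thesis using *[OF ne[OF l]] by simp
    next
      case False
      then have c0: "c > 0" using c by simp
      have "q (\<lambda>x. c * l x) / c \<le> q l"
        by (rule q_ge[OF l]) (use * c0 in \<open>auto simp: field_simps\<close>)
      then show ?thesis using c0 by (simp add: field_simps)
    qed
  qed
  from linear_functional_below_sublinear[OF D this] obtain \<xi> where
    \<xi>: "linear_functional_on ?D \<xi>" "\<And>l. l \<in> ?D \<Longrightarrow> \<xi> l \<le> q l" "\<And>l. l \<notin> ?D \<Longrightarrow> \<xi> l = 0" by blast
  have bound: "\<bar>\<xi> l\<bar> \<le> M * dual_norm V N l" if l: "l \<in> ?D" for l
  proof -
    have ml: "(\<lambda>x. - l x) \<in> ?D" using function_subspaceD(5)[OF D l] .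
    have "\<xi> l \<le> M * dual_norm V N l"
      using \<xi>(2)[OF l] q_le[OF l ne[OF l]] by (simp add: mult.commute)
    moreover have "\<xi> (\<lambda>x. - l x) = - \<xi> l"
      using linear_functional_onD(3)[OF \<xi>(1) l] .
    moreover have "dual_norm V N (\<lambda>x. - l x) = dual_norm V N l" by (simp add: dual_norm_def)
    ultimately show ?thesis
      using \<xi>(2)[OF ml] q_le[OF ml ne[OF ml]] by (simp add: mult.commute abs_le_iff)
  qed
  have "\<xi> \<in> dual_space ?D (dual_norm V N)"
    unfolding dual_space_def[of ?D] mem_Collect_eq using \<xi>(1,3) bound
    unfolding linear_functional_on_def by blast
  then obtain w where w: "w \<in> V" "\<And>l. l \<in> ?D \<Longrightarrow> \<xi> l = l w"
    using refl unfolding reflexive_seminorm_on_def by blast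
  show thesis
  proof (rule that[OF w(1)])
    fix C and e :: real
    assume C: "C \<subseteq> V" "convex_funs C" "\<forall>\<^sub>F n in sequentially. u n \<in> C" "0 < e"
    show "\<exists>c\<in>C. N (\<lambda>x. w x - c x) < e"
    proof (rule ccontr)
      assume "\<not> ?thesis"
      \<comment> \<open>A separating \<open>l\<close> satisfies \<open>l (u n) \<le> l w - e\<close>
        eventually, hence \<open>\<xi> l \<le> l w - e\<close>, although
        \<open>\<xi> l = l w\<close>.\<close>
      then have far: "e \<le> N (\<lambda>x. w x - c x)" if "c \<in> C" for c using that by force
      have "C \<noteq> {}" using C(3) by (auto simp: eventually_sequentially)
      from separating_functional[OF V N C(1,2) this w(1) far] obtain l where
        l: "l \<in> ?D" "\<And>c. c \<in> C \<Longrightarrow> l c + e \<le> l w" by blast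
      have "l w - e \<in> B l"
        unfolding B_def mem_Collect_eq using C(3)
      proof (rule eventually_mono)
        show "u n \<in> C \<Longrightarrow> l (u n) \<le> l w - e" for n using l(2)[of "u n"] by simp
      qed
      then have "l w \<le> l w - e" using q_le[OF l(1)] \<xi>(2)[OF l(1)] w(2)[OF l(1)] by fastforce
      then show False using C(4) by simp
    qed
  qed
qed

section \<open>The energy space\<close>

lemma powr_add_le:
  fixes a b p :: real
  assumes "0 \<le> a" "0 \<le> b" "0 \<le> p"
  shows "(a + b) powr p \<le> 2 powr p * (a powr p + b powr p)"
proof -
  have "(a + b) powr p \<le> (2 * max a b) powr p"
    using assms by (intro powr_mono2) auto
  also have "\<dots> = 2 powr p * max a b powr p"
    by (rule powr_mult)
  also have "\<dots> \<le> 2 powr p * (a powr p + b powr p)"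
    by (intro mult_left_mono) (auto simp: max_def)
  finally show ?thesis .
qed

lemma abs_add_powr_le:
  fixes a b p :: real
  assumes "0 \<le> p"
  shows "\<bar>a + b\<bar> powr p \<le> 2 powr p * (\<bar>a\<bar> powr p + \<bar>b\<bar> powr p)"
proof -
  have "\<bar>a + b\<bar> powr p \<le> (\<bar>a\<bar> + \<bar>b\<bar>) powr p"
    using assms by (intro powr_mono2) auto
  also note powr_add_le[OF abs_ge_zero abs_ge_zero assms, of a b]
  finally show ?thesis .
qed

text \<open>If one argument is 0, the inequality reduces to \<open>s powr p \<le> s\<close> on the
  unit interval; otherwise it is convexity of the power function.\<close>

lemma abs_powr_convex:
  fixes a b t p :: real
  assumes p: "1 \<le> p" and t: "0 \<le> t" "t \<le> 1"
  shows "\<bar>t * a + (1 - t) * b\<bar> powr p \<le> t * \<bar>a\<bar> powr p + (1 - t) * \<bar>b\<bar> powr p"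
proof -
  have le: "s powr p \<le> s" if "0 \<le> s" "s \<le> 1" for s :: real
    using powr_mono'[of 1 p s] p that by (cases "s = 0") auto
  have "\<bar>t * a + (1 - t) * b\<bar> powr p \<le> (t * \<bar>a\<bar> + (1 - t) * \<bar>b\<bar>) powr p"
    using t p by (intro powr_mono2 order.trans[OF abs_triangle_ineq]) (auto simp: abs_mult)
  also have "\<dots> \<le> t * \<bar>a\<bar> powr p + (1 - t) * \<bar>b\<bar> powr p"
  proof (cases "a = 0 \<or> b = 0")
    case True
    then show ?thesis
    proof
      assume "a = 0"
      then show ?thesis
        using t p mult_right_mono[OF le[of "1 - t"], of "\<bar>b\<bar> powr p"] by (simp add: powr_mult)
    next
      assume "b = 0"
      then show ?thesis
        using t p mult_right_mono[OF le[of t], of "\<bar>a\<bar> powr p"] by (simp add: powr_mult)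
    qed
  next
    case False
    then show ?thesis
      using convex_onD[OF powr_convex[OF p], of "1 - t" "\<bar>a\<bar>" "\<bar>b\<bar>"] t by simp
  qed
  finally show ?thesis .
qed

lemma Lp_space_mono:
  assumes v: "v \<in> Lp_space m p" and u: "u \<in> borel_measurable m"
    and le: "AE x in m. \<bar>u x\<bar> \<le> \<bar>v x\<bar>" and p: "0 \<le> p"
  shows "u \<in> Lp_space m p" and "Lp_norm m p u \<le> Lp_norm m p v"
proof -
  have iv: "integrable m (\<lambda>x. \<bar>v x\<bar> powr p)" using v by (simp add: Lp_space_def)
  have le': "AE x in m. \<bar>u x\<bar> powr p \<le> \<bar>v x\<bar> powr p"
    using le by eventually_elim (use p in \<open>auto intro: powr_mono2\<close>)
  have iu: "integrable m (\<lambda>x. \<bar>u x\<bar> powr p)"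
    by (rule Bochner_Integration.integrable_bound[OF iv]) (use u le' in auto)
  then show "u \<in> Lp_space m p" using u by (simp add: Lp_space_def)
  have "(LINT x|m. \<bar>u x\<bar> powr p) \<le> (LINT x|m. \<bar>v x\<bar> powr p)"
    by (rule integral_mono_AE[OF iu iv le'])
  then show "Lp_norm m p u \<le> Lp_norm m p v"
    unfolding Lp_norm_def using p by (intro powr_mono2) auto
qed

lemma Lp_space_subspace:
  assumes p: "0 \<le> p"
  shows "function_subspace (Lp_space m p)"
  unfolding function_subspace_def
proof (intro conjI ballI allI)
  show "(\<lambda>x. 0) \<in> Lp_space m p" by (simp add: Lp_space_def)
next
  fix u v assume uv: "u \<in> Lp_space m p" "v \<in> Lp_space m p"
  have "integrable m (\<lambda>x. 2 powr p * (\<bar>u x\<bar> powr p + \<bar>v x\<bar> powr p))"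
    using uv by (simp add: Lp_space_def)
  then have "integrable m (\<lambda>x. \<bar>u x + v x\<bar> powr p)"
    by (rule Bochner_Integration.integrable_bound) (use uv abs_add_powr_le[OF p] in \<open>auto simp: Lp_space_def\<close>)
  then show "(\<lambda>x. u x + v x) \<in> Lp_space m p" using uv by (auto simp: Lp_space_def)
next
  fix c u assume u: "u \<in> Lp_space m p"
  have "integrable m (\<lambda>x. \<bar>c\<bar> powr p * \<bar>u x\<bar> powr p)" using u by (simp add: Lp_space_def)
  then show "(\<lambda>x. c * u x) \<in> Lp_space m p"
    using u by (auto simp: Lp_space_def abs_mult powr_mult)
qed

lemma Lp_norm_powr:
  assumes "0 < p"
  shows "Lp_norm m p u powr p = (LINT x|m. \<bar>u x\<bar> powr p)"
  using assms by (simp add: Lp_norm_def powr_powr)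

text \<open>Minkowski's inequality: after normalising, it is the convexity of \<open>t \<mapsto> \<bar>t\<bar> powr p\<close>.\<close>

lemma Lp_norm_add:
  assumes p: "1 \<le> p" and u: "u \<in> Lp_space m p" and v: "v \<in> Lp_space m p"
  shows "Lp_norm m p (\<lambda>x. u x + v x) \<le> Lp_norm m p u + Lp_norm m p v"
proof (rule field_le_epsilon)
  fix e :: real assume e: "0 < e"
  \<comment> \<open>Adding \<open>e / 2\<close> keeps both normalising factors positive even when a
    norm vanishes.\<close>
  define a where "a = Lp_norm m p u + e / 2"
  define b where "b = Lp_norm m p v + e / 2"
  have nn: "0 \<le> Lp_norm m p w" for w by (simp add: Lp_norm_def)
  have ab: "a > 0" "b > 0" using e nn[of u] nn[of v] by (auto simp: a_def b_def)
  define t where "t = a / (a + b)"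
  have t: "0 \<le> t" "t \<le> 1" "1 - t = b / (a + b)" using ab by (auto simp: t_def field_simps)
  have iu: "integrable m (\<lambda>x. \<bar>u x\<bar> powr p)" and iv: "integrable m (\<lambda>x. \<bar>v x\<bar> powr p)"
    using u v by (auto simp: Lp_space_def)
  have iuv: "integrable m (\<lambda>x. \<bar>u x + v x\<bar> powr p)"
    using function_subspaceD(2)[OF Lp_space_subspace u v] p by (simp add: Lp_space_def)
  have pt: "\<bar>u x + v x\<bar> powr p \<le> (a + b) powr p * (t * (\<bar>u x\<bar> powr p / a powr p) + (1 - t) * (\<bar>v x\<bar> powr p / b powr p))" for x
  proof -
    have "u x + v x = (a + b) * (t * (u x / a) + (1 - t) * (v x / b))"
      using ab unfolding t(3) by (simp add: t_def divide_simps)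
    then have "\<bar>u x + v x\<bar> powr p = (a + b) powr p * \<bar>t * (u x / a) + (1 - t) * (v x / b)\<bar> powr p"
      using ab by (simp add: abs_mult powr_mult)
    also have "\<dots> \<le> (a + b) powr p * (t * \<bar>u x / a\<bar> powr p + (1 - t) * \<bar>v x / b\<bar> powr p)"
      by (intro mult_left_mono abs_powr_convex p t) auto
    also have "\<bar>u x / a\<bar> powr p = \<bar>u x\<bar> powr p / a powr p" using ab by (simp add: abs_divide powr_divide)
    also have "\<bar>v x / b\<bar> powr p = \<bar>v x\<bar> powr p / b powr p" using ab by (simp add: abs_divide powr_divide)
    finally show ?thesis .
  qed
  have Ia: "(LINT x|m. \<bar>u x\<bar> powr p) \<le> a powr p"
    using Lp_norm_powr[of p m u] p nn[of u] e by (auto simp: a_def intro!: powr_mono2 simp flip: Lp_norm_powr)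
  have Ib: "(LINT x|m. \<bar>v x\<bar> powr p) \<le> b powr p"
    using Lp_norm_powr[of p m v] p nn[of v] e by (auto simp: b_def intro!: powr_mono2 simp flip: Lp_norm_powr)
  have "(LINT x|m. \<bar>u x + v x\<bar> powr p)
      \<le> (LINT x|m. (a + b) powr p * (t * (\<bar>u x\<bar> powr p / a powr p) + (1 - t) * (\<bar>v x\<bar> powr p / b powr p)))"
    by (rule integral_mono[OF iuv]) (use iu iv pt in auto)
  also have "\<dots> = (a + b) powr p * (t * ((LINT x|m. \<bar>u x\<bar> powr p) / a powr p) + (1 - t) * ((LINT x|m. \<bar>v x\<bar> powr p) / b powr p))"
    using iu iv by simp
  also have "\<dots> \<le> (a + b) powr p * (t * 1 + (1 - t) * 1)"
    using Ia Ib ab t by (intro mult_left_mono add_mono) auto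
  finally have "(LINT x|m. \<bar>u x + v x\<bar> powr p) \<le> (a + b) powr p" by simp
  then have "Lp_norm m p (\<lambda>x. u x + v x) \<le> ((a + b) powr p) powr (1 / p)"
    unfolding Lp_norm_def using p by (intro powr_mono2) auto
  also have "\<dots> = a + b" using ab p by (simp add: powr_powr)
  finally show "Lp_norm m p (\<lambda>x. u x + v x) \<le> Lp_norm m p u + Lp_norm m p v + e"
    by (simp add: a_def b_def)
qed

lemma Lp_norm_scale:
  assumes p: "1 \<le> p"
  shows "Lp_norm m p (\<lambda>x. c * u x) = \<bar>c\<bar> * Lp_norm m p u"
  using p by (simp add: Lp_norm_def abs_mult powr_mult powr_powr)

lemma seminorm_on_Lp_norm:
  assumes "1 \<le> p" "V \<subseteq> Lp_space m p"
  shows "seminorm_on V (Lp_norm m p)"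
  unfolding seminorm_on_def
proof (intro conjI ballI allI)
  show "0 \<le> Lp_norm m p u" for u by (simp add: Lp_norm_def)
  show "Lp_norm m p (\<lambda>x. u x + v x) \<le> Lp_norm m p u + Lp_norm m p v" if "u \<in> V" "v \<in> V" for u v
    using Lp_norm_add[OF assms(1)] that assms(2) by blast
qed (rule Lp_norm_scale[OF assms(1)])

lemma nn_integral_Lp_norm:
  assumes "0 < p" "u \<in> Lp_space m p"
  shows "(\<integral>\<^sup>+x. ennreal (\<bar>u x\<bar> powr p) \<partial>m) = ennreal (Lp_norm m p u powr p)"
  using assms by (subst Lp_norm_powr) (auto simp: Lp_space_def intro!: nn_integral_eq_integral)

lemma seminorm_on_add:
  assumes "seminorm_on V M" "seminorm_on V N"
  shows "seminorm_on V (\<lambda>u. M u + N u)"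
  unfolding seminorm_on_def
proof (intro conjI ballI allI)
  show "0 \<le> M u + N u" if "u \<in> V" for u
    using assms[THEN seminorm_onD(1), OF that] by simp
  show "M (\<lambda>x. u x + v x) + N (\<lambda>x. u x + v x) \<le> M u + N u + (M v + N v)" if "u \<in> V" "v \<in> V" for u v
    using assms[THEN seminorm_onD(2), OF that] by simp
  show "M (\<lambda>x. c * u x) + N (\<lambda>x. c * u x) = \<bar>c\<bar> * (M u + N u)" if "u \<in> V" for c u
    using assms[THEN seminorm_onD(3), OF that, of c] by (simp add: algebra_simps)
qed

lemma Cc_vanishing_compose:
  assumes "u \<in> Cc" "continuous_on UNIV v" "\<And>x. u x = 0 \<Longrightarrow> v x = 0"
  shows "v \<in> Cc"
proof -
  have "closure {x. v x \<noteq> 0} \<subseteq> closure {x. u x \<noteq> 0}"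
    using assms(3) by (intro closure_mono) auto
  then have "compact (closure {x. v x \<noteq> 0})"
    using assms(1) unfolding Cc_def by (metis (no_types, lifting) closed_closure compact_Int_closed inf.absorb_iff2 mem_Collect_eq)
  with assms(2) show ?thesis by (simp add: Cc_def)
qed

section \<open>Lattice operations, local p-integrals and weak limits in the energy space\<close>

context p_energy_space
begin

abbreviation eN :: "('a \<Rightarrow> real) \<Rightarrow> real" where
  "eN u \<equiv> \<E> u powr (1 / p)"

abbreviation gN :: "'a set \<Rightarrow> ('a \<Rightarrow> real) \<Rightarrow> real" where
  "gN A u \<equiv> measure (\<Gamma> u) A powr (1 / p)"

lemma p_pos: "0 < p" and p_ge_1: "1 \<le> p" using p_gt_1 by auto

lemma sets_m [simp, measurable_cong]: "sets m = sets borel"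
  using radon by (simp add: radon_measure_def)

lemma space_m [simp]: "space m = UNIV"
  using sets_eq_imp_space_eq[OF sets_m] by simp

lemma F_measurable: "u \<in> \<F> \<Longrightarrow> u \<in> borel_measurable borel"
  using F_Lp by (auto simp: Lp_space_def)

lemma energy_norm_seminorm: "seminorm_on \<F> (energy_norm m p \<E>)"
proof -
  have "seminorm_on \<F> (\<lambda>u. Lp_norm m p u + eN u)"
    by (intro seminorm_on_add seminorm_on_Lp_norm E_seminorm p_ge_1 F_Lp)
  then show ?thesis unfolding energy_norm_def .
qed

lemma gN_le_eN:
  assumes "u \<in> \<F>" "A \<in> sets borel"
  shows "gN A u \<le> eN u"
proof -
  interpret finite_measure "\<Gamma> u" using \<Gamma>_finite assms by auto
  have "space (\<Gamma> u) = UNIV"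
    using sets_eq_imp_space_eq[OF \<Gamma>_borel[OF assms(1)]] by simp
  then have "measure (\<Gamma> u) A \<le> measure (\<Gamma> u) UNIV"
    using finite_measure_mono[of A UNIV] \<Gamma>_borel[OF assms(1)] assms by auto
  then show ?thesis using E_eq_\<Gamma>[OF assms(1)] p_pos by (auto intro!: powr_mono2)
qed

lemma F_lipschitz:
  assumes "u \<in> \<F>" "\<And>s t :: real. \<bar>\<phi> s - \<phi> t\<bar> \<le> \<bar>s - t\<bar>" "\<phi> 0 = 0"
  shows "(\<lambda>x. \<phi> (u x)) \<in> \<F>" and "eN (\<lambda>x. \<phi> (u x)) \<le> eN u"
proof -
  have L: "1-lipschitz_on UNIV \<phi>"
    using assms(2) by (intro lipschitz_onI) (auto simp: dist_real_def)
  show *: "(\<lambda>x. \<phi> (u x)) \<in> \<F>" using lipschitz_in_F[OF assms(1) L assms(3)] .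
  show "eN (\<lambda>x. \<phi> (u x)) \<le> eN u"
    using lipschitz_contraction[OF assms(1) L assms(3)] E_nonneg[OF *] p_pos by (intro powr_mono2) auto
qed

lemma F_pos:
  assumes "u \<in> \<F>"
  shows "(\<lambda>x. max 0 (u x)) \<in> \<F>" and "eN (\<lambda>x. max 0 (u x)) \<le> eN u"
  using F_lipschitz[OF assms, of "max 0"] by auto

text \<open>Contraction is available for functions of one variable only, so the maximum is written
  as half of \<open>u + v + \<bar>u - v\<bar>\<close>.\<close>

lemma F_max:
  assumes "u \<in> \<F>" "v \<in> \<F>"
  shows "(\<lambda>x. max (u x) (v x)) \<in> \<F>" and "eN (\<lambda>x. max (u x) (v x)) \<le> eN u + eN v"
proof -
  note Fs = function_subspaceD[OF F_subspace]
  have d: "(\<lambda>x. u x - v x) \<in> \<F>" using Fs(4) assms by blast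
  have a: "(\<lambda>x. \<bar>u x - v x\<bar>) \<in> \<F>" "eN (\<lambda>x. \<bar>u x - v x\<bar>) \<le> eN (\<lambda>x. u x - v x)"
    using F_lipschitz[OF d, of abs] by auto
  have s: "(\<lambda>x. u x + v x) \<in> \<F>" using Fs(2) assms by blast
  have t: "(\<lambda>x. (u x + v x) + \<bar>u x - v x\<bar>) \<in> \<F>" using Fs(2)[OF s a(1)] .
  have eq: "(\<lambda>x. max (u x) (v x)) = (\<lambda>x. (1 / 2) * ((u x + v x) + \<bar>u x - v x\<bar>))"
    by (auto simp: max_def)
  show "(\<lambda>x. max (u x) (v x)) \<in> \<F>" unfolding eq using Fs(3)[OF t] .
  have "eN (\<lambda>x. max (u x) (v x)) = 1 / 2 * eN (\<lambda>x. (u x + v x) + \<bar>u x - v x\<bar>)"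
    unfolding eq using seminorm_onD(3)[OF E_seminorm t, of "1 / 2"] by (simp only:)
  also have "\<dots> \<le> 1 / 2 * ((eN u + eN v) + (eN u + eN v))"
    using seminorm_onD(2)[OF E_seminorm s a(1)] a(2) seminorm_onD(2)[OF E_seminorm assms]
      seminorm_on_diff[OF F_subspace E_seminorm assms] by simp
  finally show "eN (\<lambda>x. max (u x) (v x)) \<le> eN u + eN v" by simp
qed

lemma F_Max:
  assumes "finite I" "\<And>i. i \<in> I \<Longrightarrow> u i \<in> \<F>"
  shows "(\<lambda>x. Max (insert 0 ((\<lambda>i. u i x) ` I))) \<in> \<F> \<and>
    eN (\<lambda>x. Max (insert 0 ((\<lambda>i. u i x) ` I))) \<le> (\<Sum>i\<in>I. eN (u i))"
  using assms
proof (induction I rule: finite_induct)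
  case empty
  then show ?case
    using function_subspaceD(1)[OF F_subspace] seminorm_on_zero[OF F_subspace E_seminorm] by simp
next
  case (insert i I)
  have eq: "(\<lambda>x. Max (insert 0 ((\<lambda>i. u i x) ` insert i I)))
      = (\<lambda>x. max (u i x) (Max (insert 0 ((\<lambda>i. u i x) ` I))))"
  proof
    fix x
    have "insert 0 ((\<lambda>i. u i x) ` insert i I) = insert (u i x) (insert 0 ((\<lambda>i. u i x) ` I))" by auto
    also have "Max \<dots> = max (u i x) (Max (insert 0 ((\<lambda>i. u i x) ` I)))"
      using insert(1) by (intro Max_insert) auto
    finally show "Max (insert 0 ((\<lambda>i. u i x) ` insert i I)) = max (u i x) (Max (insert 0 ((\<lambda>i. u i x) ` I)))" .
  qed
  show ?case unfolding eq
    using F_max[of "u i" "\<lambda>x. Max (insert 0 ((\<lambda>i. u i x) ` I))"] insert by force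
qed

lemma F_cong:
  assumes "u \<in> \<F>" "v \<in> borel_measurable borel" "AE x in m. u x = v x"
  shows "v \<in> \<F>" "\<E> v = \<E> u" "\<Gamma> v = \<Gamma> u"
proof -
  show "v \<in> \<F>" using F_saturated assms by simp
  then show "\<E> v = \<E> u" "\<Gamma> v = \<Gamma> u" using E_AE \<Gamma>_AE assms by metis+
qed

text \<open>The p-th power of a local p-norm, with values in \<open>ennreal\<close> so that
  comparisons need no integrability.\<close>

definition Jp :: "'a set \<Rightarrow> ('a \<Rightarrow> real) \<Rightarrow> ennreal" where
  "Jp D g = (\<integral>\<^sup>+x\<in>D. ennreal (\<bar>g x\<bar> powr p) \<partial>m)"

lemma Jp_mono_set: "D \<subseteq> D' \<Longrightarrow> Jp D g \<le> Jp D' g"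
  unfolding Jp_def by (intro nn_integral_mono) (auto simp: indicator_def)

lemma Jp_le_Lp_norm:
  assumes "u \<in> Lp_space m p"
  shows "Jp D u \<le> ennreal (Lp_norm m p u powr p)"
proof -
  have "Jp D u \<le> (\<integral>\<^sup>+x. ennreal (\<bar>u x\<bar> powr p) \<partial>m)"
    unfolding Jp_def by (intro nn_integral_mono) (auto simp: indicator_def)
  then show ?thesis using nn_integral_Lp_norm[OF p_pos assms] by simp
qed

lemma Jp_add:
  assumes [measurable]: "u \<in> borel_measurable borel" "v \<in> borel_measurable borel" "D \<in> sets borel"
  shows "Jp D (\<lambda>x. u x + v x) \<le> ennreal (2 powr p) * (Jp D u + Jp D v)"
proof -
  have "Jp D (\<lambda>x. u x + v x) \<le> (\<integral>\<^sup>+x. ennreal (2 powr p) * (ennreal (\<bar>u x\<bar> powr p) * indicator D x + ennreal (\<bar>v x\<bar> powr p) * indicator D x) \<partial>m)"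
    unfolding Jp_def
  proof (intro nn_integral_mono)
    fix x
    have "ennreal (\<bar>u x + v x\<bar> powr p) \<le> ennreal (2 powr p * (\<bar>u x\<bar> powr p + \<bar>v x\<bar> powr p))"
      using abs_add_powr_le[of p] p_pos by (intro ennreal_leI) auto
    also have "\<dots> = ennreal (2 powr p) * (ennreal (\<bar>u x\<bar> powr p) + ennreal (\<bar>v x\<bar> powr p))"
      by (simp add: ennreal_mult ennreal_plus)
    finally show "ennreal (\<bar>u x + v x\<bar> powr p) * indicator D x
       \<le> ennreal (2 powr p) * (ennreal (\<bar>u x\<bar> powr p) * indicator D x + ennreal (\<bar>v x\<bar> powr p) * indicator D x)"
      by (auto simp: indicator_def)
  qed
  also have "\<dots> = ennreal (2 powr p) * (Jp D u + Jp D v)"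
    unfolding Jp_def by (simp add: nn_integral_cmult nn_integral_add)
  finally show ?thesis .
qed

lemma Jp_diff_trans:
  assumes [measurable]: "u \<in> borel_measurable borel" "v \<in> borel_measurable borel" "w \<in> borel_measurable borel" "D \<in> sets borel"
  shows "Jp D (\<lambda>x. u x - w x) \<le> ennreal (2 powr p) * (Jp D (\<lambda>x. u x - v x) + Jp D (\<lambda>x. v x - w x))"
  using Jp_add[of "\<lambda>x. u x - v x" "\<lambda>x. v x - w x" D] by simp

lemma Jp_diff_commute: "Jp D (\<lambda>x. u x - v x) = Jp D (\<lambda>x. v x - u x)"
  unfolding Jp_def by (simp add: abs_minus_commute)

text \<open>Both conclusions stem from convex sublevel sets that eventually contain
  \<open>u n\<close> and hence come arbitrarily close to the limit in norm. \<open>gN\<close> is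
  dominated by the energy norm; for \<open>Jp\<close> the triangle inequality with factor
  \<open>2 powr p\<close> suffices, since the bound tends to 0.\<close>

lemma weak_limit:
  assumes u: "\<And>n. u n \<in> \<F>" and M: "\<And>n. energy_norm m p \<E> (u n) \<le> M"
  obtains w where "w \<in> \<F>"
    "\<And>A a. A \<in> sets borel \<Longrightarrow> \<forall>\<^sub>F n in sequentially. gN A (u n) \<le> a \<Longrightarrow> gN A w \<le> a"
    "\<And>D f. D \<in> sets borel \<Longrightarrow> f \<in> borel_measurable borel \<Longrightarrow>
        (\<lambda>n. Jp D (\<lambda>x. u n x - f x)) \<longlonglongrightarrow> 0 \<Longrightarrow> AE x in m. x \<in> D \<longrightarrow> w x = f x"
proof -
  let ?N = "energy_norm m p \<E>"
  obtain w where w: "w \<in> \<F>"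
    "\<And>C e. C \<subseteq> \<F> \<Longrightarrow> convex_funs C \<Longrightarrow> \<forall>\<^sub>F n in sequentially. u n \<in> C \<Longrightarrow> 0 < e \<Longrightarrow>
        \<exists>c\<in>C. ?N (\<lambda>x. w x - c x) < e"
    by (rule weak_cluster[where u=u and M=M, OF F_subspace energy_norm_seminorm F_reflexive u M]) blast
  note Fs = function_subspaceD[OF F_subspace]
  show thesis
  proof (rule that[OF w(1)])
    fix A :: "'a set" and a assume A: "A \<in> sets borel" and ev: "\<forall>\<^sub>F n in sequentially. gN A (u n) \<le> a"
    have sn: "seminorm_on \<F> (gN A)" using \<Gamma>_seminorm[OF A] .
    define C where "C = {v\<in>\<F>. gN A v \<le> a}"
    have "convex_funs C"
      unfolding convex_funs_def
    proof (intro ballI allI impI)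
      fix v v' t assume v: "v \<in> C" "v' \<in> C" and t: "0 \<le> t \<and> t \<le> (1::real)"
      have F: "(\<lambda>x. t * v x) \<in> \<F>" "(\<lambda>x. (1 - t) * v' x) \<in> \<F>"
        using v Fs(3) by (auto simp: C_def)
      have "gN A (\<lambda>x. t * v x + (1 - t) * v' x) \<le> t * gN A v + (1 - t) * gN A v'"
        using seminorm_onD(2)[OF sn F] seminorm_onD(3)[OF sn, of v t] seminorm_onD(3)[OF sn, of v' "1 - t"] v t
        by (simp add: C_def)
      also have "\<dots> \<le> t * a + (1 - t) * a"
        using v t by (intro add_mono mult_left_mono) (auto simp: C_def)
      finally show "(\<lambda>x. t * v x + (1 - t) * v' x) \<in> C"
        using Fs(2)[OF F] by (simp add: C_def algebra_simps)
    qed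
    moreover have "\<forall>\<^sub>F n in sequentially. u n \<in> C"
      using ev by eventually_elim (use u in \<open>simp add: C_def\<close>)
    moreover have "C \<subseteq> \<F>" by (auto simp: C_def)
    ultimately have *: "\<exists>c\<in>C. ?N (\<lambda>x. w x - c x) < e" if "0 < e" for e
      using w(2) that by blast
    show "gN A w \<le> a"
    proof (rule field_le_epsilon)
      fix e :: real assume "0 < e"
      then obtain c where c: "c \<in> \<F>" "gN A c \<le> a" "?N (\<lambda>x. w x - c x) < e"
        using * by (auto simp: C_def)
      have d: "(\<lambda>x. w x - c x) \<in> \<F>" using Fs(4) w(1) c by blast
      have "gN A w \<le> gN A c + gN A (\<lambda>x. w x - c x)"
        by (rule seminorm_on_triangle[OF F_subspace sn w(1) c(1)])
      also have "gN A (\<lambda>x. w x - c x) \<le> eN (\<lambda>x. w x - c x)" by (rule gN_le_eN[OF d A])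
      also have "\<dots> \<le> ?N (\<lambda>x. w x - c x)" by (simp add: energy_norm_def Lp_norm_def)
      finally show "gN A w \<le> a + e" using c by simp
    qed
  next
    fix D :: "'a set" and f :: "'a \<Rightarrow> real"
    assume D [measurable]: "D \<in> sets borel" and f [measurable]: "f \<in> borel_measurable borel"
      and lim: "(\<lambda>n. Jp D (\<lambda>x. u n x - f x)) \<longlonglongrightarrow> 0"
    note [measurable] = F_measurable
    have small: "Jp D (\<lambda>x. w x - f x) \<le> ennreal (2 powr p) * (ennreal e + ennreal e)" if e: "0 < e" for e
    proof -
      define C where "C = {v\<in>\<F>. Jp D (\<lambda>x. v x - f x) \<le> ennreal e}"
      have "convex_funs C"
        unfolding convex_funs_def
      proof (intro ballI allI impI)
        fix v v' t assume v: "v \<in> C" "v' \<in> C" and t: "0 \<le> t \<and> t \<le> (1::real)"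
        have vF: "v \<in> \<F>" "v' \<in> \<F>" using v by (auto simp: C_def)
        note [measurable] = F_measurable[OF vF(1)] F_measurable[OF vF(2)]
        have F: "(\<lambda>x. t * v x) \<in> \<F>" "(\<lambda>x. (1 - t) * v' x) \<in> \<F>"
          using vF Fs(3) by auto
        have "Jp D (\<lambda>x. t * v x + (1 - t) * v' x - f x)
            \<le> (\<integral>\<^sup>+x. ennreal t * (ennreal (\<bar>v x - f x\<bar> powr p) * indicator D x) +
                  ennreal (1 - t) * (ennreal (\<bar>v' x - f x\<bar> powr p) * indicator D x) \<partial>m)"
          unfolding Jp_def
        proof (intro nn_integral_mono)
          fix x
          have "t * v x + (1 - t) * v' x - f x = t * (v x - f x) + (1 - t) * (v' x - f x)"
            by (simp add: algebra_simps)
          then have "ennreal (\<bar>t * v x + (1 - t) * v' x - f x\<bar> powr p)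
             \<le> ennreal (t * \<bar>v x - f x\<bar> powr p + (1 - t) * \<bar>v' x - f x\<bar> powr p)"
            using abs_powr_convex[of p t "v x - f x" "v' x - f x"] p_ge_1 t by (intro ennreal_leI) auto
          also have "\<dots> = ennreal t * ennreal (\<bar>v x - f x\<bar> powr p) + ennreal (1 - t) * ennreal (\<bar>v' x - f x\<bar> powr p)"
            using t by (subst ennreal_plus) (auto simp: ennreal_mult)
          finally show "ennreal (\<bar>t * v x + (1 - t) * v' x - f x\<bar> powr p) * indicator D x
             \<le> ennreal t * (ennreal (\<bar>v x - f x\<bar> powr p) * indicator D x) +
                  ennreal (1 - t) * (ennreal (\<bar>v' x - f x\<bar> powr p) * indicator D x)"
            by (auto simp: indicator_def)
        qed
        also have "\<dots> = ennreal t * Jp D (\<lambda>x. v x - f x) + ennreal (1 - t) * Jp D (\<lambda>x. v' x - f x)"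
          unfolding Jp_def by (subst nn_integral_add) (auto simp: nn_integral_cmult)
        also have "\<dots> \<le> ennreal t * ennreal e + ennreal (1 - t) * ennreal e"
          using v by (intro add_mono mult_left_mono) (auto simp: C_def)
        also have "\<dots> = ennreal (t * e + (1 - t) * e)"
          using t e by (simp add: ennreal_mult ennreal_plus)
        also have "t * e + (1 - t) * e = e" by (simp add: algebra_simps)
        finally show "(\<lambda>x. t * v x + (1 - t) * v' x) \<in> C"
          using Fs(2)[OF F] by (simp add: C_def)
      qed
      moreover have "\<forall>\<^sub>F n in sequentially. u n \<in> C"
      proof -
        have "\<forall>\<^sub>F n in sequentially. Jp D (\<lambda>x. u n x - f x) < ennreal e"
          using lim e by (intro order_tendstoD(2)) auto
        then show ?thesis by eventually_elim (use u in \<open>simp add: C_def\<close>)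
      qed
      moreover have "C \<subseteq> \<F>" by (auto simp: C_def)
      \<comment> \<open>The tolerance in norm is chosen so that its p-th power, the scale of
        \<open>Jp\<close>, is \<open>e\<close>.\<close>
      moreover have "0 < e powr (1 / p)" using e by simp
      ultimately obtain c where c: "c \<in> C" "?N (\<lambda>x. w x - c x) < e powr (1 / p)"
        using w(2) by blast
      have cF: "c \<in> \<F>" using c by (simp add: C_def)
      have d: "(\<lambda>x. w x - c x) \<in> \<F>" using Fs(4) w(1) cF by blast
      have "Lp_norm m p (\<lambda>x. w x - c x) \<le> e powr (1 / p)"
        using c(2) by (simp add: energy_norm_def) (metis add_increasing2 less_eq_real_def linorder_not_le powr_ge_zero)
      then have "Lp_norm m p (\<lambda>x. w x - c x) powr p \<le> (e powr (1 / p)) powr p"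
        using p_pos by (intro powr_mono2) (auto simp: Lp_norm_def)
      then have "Lp_norm m p (\<lambda>x. w x - c x) powr p \<le> e" using e p_pos by (simp add: powr_powr)
      moreover have "Jp D (\<lambda>x. w x - c x) \<le> ennreal (Lp_norm m p (\<lambda>x. w x - c x) powr p)"
        using d F_Lp by (intro Jp_le_Lp_norm) auto
      ultimately have "Jp D (\<lambda>x. w x - c x) \<le> ennreal e"
        by (meson ennreal_leI order.trans)
      moreover have "Jp D (\<lambda>x. c x - f x) \<le> ennreal e" using c by (simp add: C_def)
      moreover have "Jp D (\<lambda>x. w x - f x) \<le> ennreal (2 powr p) * (Jp D (\<lambda>x. w x - c x) + Jp D (\<lambda>x. c x - f x))"
        by (rule Jp_diff_trans) (use w(1) cF F_measurable in auto)
      ultimately show ?thesis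
        by (meson add_mono mult_left_mono order.trans zero_le)
    qed
    have "Jp D (\<lambda>x. w x - f x) \<le> ennreal e" if e: "0 < e" for e
      using small[of "e / (2 * 2 powr p)"] e
      by (simp add: ennreal_plus[symmetric] ennreal_mult[symmetric] del: ennreal_plus)
    then have "Jp D (\<lambda>x. w x - f x) = 0"
      by (metis ennreal_le_epsilon add_0 le_zero_eq)
    moreover have [measurable]: "w \<in> borel_measurable borel" using w(1) F_measurable by auto
    ultimately have "AE x in m. ennreal (\<bar>w x - f x\<bar> powr p) * indicator D x = 0"
      unfolding Jp_def by (subst (asm) nn_integral_0_iff_AE) auto
    then show "AE x in m. x \<in> D \<longrightarrow> w x = f x"
      by eventually_elim (auto simp: indicator_def split: if_splits)
  qed
qed

end

section \<open>Locality of the energy measures\<close>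

lemma compact_cball_mono:
  fixes x :: "'a::metric_space"
  assumes "compact (cball x t)" "s \<le> t"
  shows "compact (cball x s)"
  using assms by (metis closed_cball compact_Int_closed inf.absorb_iff2 subset_cball)

context p_energy_space
begin

lemma compact_cball_ex:
  obtains s where "0 < s" "compact (cball (x::'a) s)"
proof -
  obtain U K where UK: "open U" "compact K" "x \<in> U" "U \<subseteq> K"
    using locally_compact unfolding locally_def
    by (metis UNIV_I open_UNIV open_openin openin_subtopology_self subtopology_UNIV)
  then obtain s where s: "0 < s" "cball x s \<subseteq> U"
    using open_contains_cball by blast
  have "compact (cball x s)"
    using UK s by (metis closed_cball compact_Int_closed inf.absorb_iff2 order.trans)
  then show thesis using that s by blast
qed

text \<open>A qualitative cutoff without energy bound, obtained from uniform density and
  truncation.\<close>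

lemma cutoff_exists:
  assumes "0 < s" "compact (cball (x::'a) (2 * s))"
  obtains \<phi> where "\<phi> \<in> \<F> \<inter> Cc" "\<And>y. 0 \<le> \<phi> y" "\<And>y. dist x y \<le> s \<Longrightarrow> \<phi> y = 1" "\<And>y. 2 * s \<le> dist x y \<Longrightarrow> \<phi> y = 0"
proof -
  \<comment> \<open>The plateau has height 2 and the approximation error is below 1/2, so
    \<open>v - 1 / 2\<close> exceeds 1 on the inner ball and is negative outside; truncation makes
    both values exact.\<close>
  define g where "g y = max 0 (min 2 (4 - 2 * dist x y / s))" for y
  have cont: "continuous_on UNIV g" unfolding g_def by (intro continuous_intros) (use assms in auto)
  have "{y. g y \<noteq> 0} \<subseteq> cball x (2 * s)"
    using assms(1) by (auto simp: g_def divide_simps max_def min_def split: if_splits)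
  then have "closure {y. g y \<noteq> 0} \<subseteq> cball x (2 * s)" by (intro closure_minimal) auto
  then have "compact (closure {y. g y \<noteq> 0})"
    by (metis assms(2) closed_closure compact_Int_closed inf.absorb_iff2)
  then have "g \<in> Cc" using cont by (simp add: Cc_def)
  from dense_Cc[OF this, of "1/2"] obtain v where v: "v \<in> \<F> \<inter> Cc" "\<And>y. \<bar>g y - v y\<bar> < 1 / 2" by auto
  define \<phi> where "\<phi> y = max 0 (min 1 (v y - 1 / 2))" for y
  have "\<phi> \<in> \<F>" unfolding \<phi>_def by (rule F_lipschitz(1)) (use v in auto)
  moreover have "\<phi> \<in> Cc"
  proof (rule Cc_vanishing_compose)
    show "v \<in> Cc" using v by simp
    have "continuous_on UNIV v" using v by (simp add: Cc_def)
    then show "continuous_on UNIV \<phi>" unfolding \<phi>_def by (intro continuous_intros)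
  qed (simp add: \<phi>_def)
  moreover have "\<phi> y = 1" if "dist x y \<le> s" for y
  proof -
    have "g y = 2" using that assms(1) by (auto simp: g_def max_def min_def divide_simps split: if_splits)
    then show ?thesis using v(2)[of y] unfolding \<phi>_def by linarith
  qed
  moreover have "\<phi> y = 0" if "2 * s \<le> dist x y" for y
  proof -
    have "g y = 0" using that assms(1) by (auto simp: g_def max_def min_def divide_simps split: if_splits)
    then show ?thesis using v(2)[of y] by (auto simp: \<phi>_def)
  qed
  ultimately show thesis using that[of \<phi>] by (auto simp: \<phi>_def)
qed

lemma F_diff: "u \<in> \<F> \<Longrightarrow> v \<in> \<F> \<Longrightarrow> (\<lambda>x. u x - v x) \<in> \<F>"
  and F_add: "u \<in> \<F> \<Longrightarrow> v \<in> \<F> \<Longrightarrow> (\<lambda>x. u x + v x) \<in> \<F>"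
  and F_scale: "u \<in> \<F> \<Longrightarrow> (\<lambda>x. c * u x) \<in> \<F>"
  and F_zero: "(\<lambda>x. 0) \<in> \<F>"
  using function_subspaceD[OF F_subspace] by blast+

lemma zero_in_Cc: "(\<lambda>x. 0) \<in> Cc"
  by (simp add: Cc_def)

lemma \<Gamma>_zero:
  assumes "B \<in> sets borel" shows "measure (\<Gamma> (\<lambda>x. 0)) B = 0"
  using seminorm_on_zero[OF F_subspace \<Gamma>_seminorm[OF assms]] by simp

lemma emeasure_\<Gamma>: "u \<in> \<F> \<Longrightarrow> emeasure (\<Gamma> u) B = ennreal (measure (\<Gamma> u) B)"
  using \<Gamma>_finite finite_measure.emeasure_eq_measure by metis

lemma \<Gamma>_const_Cc:
  assumes "u \<in> \<F> \<inter> Cc" "open U" "\<And>x. x \<in> U \<Longrightarrow> u x = c" "B \<in> sets borel" "B \<subseteq> U"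
  shows "measure (\<Gamma> u) B = 0"
proof -
  have "emeasure (\<Gamma> u) B = emeasure (\<Gamma> (\<lambda>x. 0)) B"
    by (rule strongly_local[of _ _ U c]) (use assms F_zero zero_in_Cc in auto)
  then show ?thesis using \<Gamma>_zero[OF assms(4)] by (simp add: measure_def)
qed

text \<open>A function in \<open>\<F>\<close> vanishing on a ball is approximated by functions in \<open>\<F> \<inter> C\<^sub>c\<close> vanishing on a smaller
  concentric ball: subtract a large multiple of a cutoff and take the positive part.\<close>

lemma \<Gamma>_vanish_bounded:
  assumes s: "0 < s" "compact (cball x (2 * s))" and u: "u \<in> \<F>" and nonneg: "\<And>y. 0 \<le> u y"
    and zero: "AE y in m. y \<in> ball x (2 * s) \<longrightarrow> u y = 0" and M: "0 \<le> M"
  shows "gN (ball x s) (\<lambda>y. min M (u y)) = 0"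
proof -
  obtain \<phi> where \<phi>: "\<phi> \<in> \<F> \<inter> Cc" "\<And>y. 0 \<le> \<phi> y" "\<And>y. dist x y \<le> s \<Longrightarrow> \<phi> y = 1" "\<And>y. 2 * s \<le> dist x y \<Longrightarrow> \<phi> y = 0"
    using cutoff_exists[OF s] by blast
  have "\<exists>v. v \<in> \<F> \<inter> Cc \<and> energy_norm m p \<E> (\<lambda>x. u x - v x) < 1 / Suc n" for n
    using dense_F[OF u, of "1 / Suc n"] by auto
  then obtain v where v: "\<And>n. v n \<in> \<F> \<inter> Cc" "\<And>n. energy_norm m p \<E> (\<lambda>x. u x - v n x) < 1 / Suc n"
    by metis
  \<comment> \<open>Where \<open>\<phi>\<close> is 1 the subtracted term is at least
    \<open>min M (v n)\<close>, so \<open>w n\<close> vanishes identically on the smaller ball.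
    Truncating at \<open>M\<close> is what makes a fixed multiple of \<open>\<phi>\<close> large
    enough.\<close>
  define w where "w n y = max 0 (min M (v n y) - M * \<phi> y)" for n y
  have vF: "v n \<in> \<F>" for n using v by auto
  have mv: "(\<lambda>y. min M (v n y)) \<in> \<F>" "eN (\<lambda>y. min M (v n y)) \<le> eN (v n)" for n
    using F_lipschitz[OF vF, of "min M"] M by auto
  have M\<phi>: "(\<lambda>y. M * \<phi> y) \<in> \<F>" using \<phi> F_scale by auto
  have wd: "(\<lambda>y. min M (v n y) - M * \<phi> y) \<in> \<F>" for n using F_diff mv M\<phi> by auto
  have wF: "w n \<in> \<F>" for n unfolding w_def using F_pos(1)[OF wd] .
  have wC: "w n \<in> Cc" for n
  proof (rule Cc_vanishing_compose)
    show "v n \<in> Cc" using v by auto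
    have "continuous_on UNIV (v n)" "continuous_on UNIV \<phi>" using v \<phi> by (auto simp: Cc_def)
    then show "continuous_on UNIV (w n)" unfolding w_def by (intro continuous_intros)
    show "v n y = 0 \<Longrightarrow> w n y = 0" for y using M \<phi>(2)[of y] by (simp add: w_def)
  qed
  have vb: "energy_norm m p \<E> (v n) \<le> energy_norm m p \<E> u + 1" for n
  proof -
    have "energy_norm m p \<E> (v n) \<le> energy_norm m p \<E> u + energy_norm m p \<E> (\<lambda>x. v n x - u x)"
      by (rule seminorm_on_triangle[OF F_subspace energy_norm_seminorm vF u])
    moreover have "energy_norm m p \<E> (\<lambda>x. v n x - u x) = energy_norm m p \<E> (\<lambda>x. u x - v n x)"
      using seminorm_on_minus[OF F_subspace energy_norm_seminorm F_diff[OF u vF]] by simp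
    moreover have "1 / real (Suc n) \<le> 1" by simp
    ultimately show ?thesis using v(2)[of n] by linarith
  qed
  \<comment> \<open>The energies of \<open>w n\<close> are merely bounded, because the cutoff
    contributes a fixed amount; hence a weak limit instead of norm convergence.\<close>
  have wb: "energy_norm m p \<E> (w n) \<le> energy_norm m p \<E> u + 1 + eN (\<lambda>y. M * \<phi> y)" for n
  proof -
    have "Lp_norm m p (w n) \<le> Lp_norm m p (v n)"
    proof (rule Lp_space_mono)
      show "v n \<in> Lp_space m p" using vF F_Lp by auto
      show "w n \<in> borel_measurable m" using F_measurable[OF wF] by simp
      have "\<bar>w n y\<bar> \<le> \<bar>v n y\<bar>" for y
        using mult_nonneg_nonneg[OF M \<phi>(2)[of y]] by (auto simp: w_def)
      then show "AE y in m. \<bar>w n y\<bar> \<le> \<bar>v n y\<bar>" by simp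
    qed (use p_pos in simp)
    moreover have "eN (w n) \<le> eN (v n) + eN (\<lambda>y. M * \<phi> y)"
      unfolding w_def
      using F_pos(2)[OF wd, of n] seminorm_on_diff[OF F_subspace E_seminorm mv(1)[of n] M\<phi>] mv(2)[of n] by linarith
    ultimately show ?thesis using vb[of n] by (simp add: energy_norm_def)
  qed
  obtain z where z: "z \<in> \<F>"
    "\<And>A a. A \<in> sets borel \<Longrightarrow> \<forall>\<^sub>F n in sequentially. gN A (w n) \<le> a \<Longrightarrow> gN A z \<le> a"
    "\<And>D f. D \<in> sets borel \<Longrightarrow> f \<in> borel_measurable borel \<Longrightarrow>
        (\<lambda>n. Jp D (\<lambda>x. w n x - f x)) \<longlonglongrightarrow> 0 \<Longrightarrow> AE x in m. x \<in> D \<longrightarrow> z x = f x"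
    by (rule weak_limit[of w, OF wF wb]) blast
  have gw: "gN (ball x s) (w n) = 0" for n
  proof -
    have "w n y = 0" if "y \<in> ball x s" for y using \<phi>(3)[of y] that by (simp add: w_def)
    then have "measure (\<Gamma> (w n)) (ball x s) = 0"
      using wF wC by (intro \<Gamma>_const_Cc[of _ "ball x s" 0]) auto
    then show ?thesis by simp
  qed
  have "gN (ball x s) z \<le> 0" by (rule z(2)) (use gw in auto)
  then have gz: "gN (ball x s) z = 0" by (simp add: order_antisym)
  have mu: "(\<lambda>y. min M (u y)) \<in> \<F>" using F_lipschitz(1)[OF u, of "min M"] M by auto
  have "AE y in m. y \<in> UNIV \<longrightarrow> z y = min M (u y)"
  proof (rule z(3))
    show "(\<lambda>y. min M (u y)) \<in> borel_measurable borel" using F_measurable[OF mu] .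
    have J: "Jp UNIV (\<lambda>y. w n y - min M (u y)) \<le> ennreal ((1 / Suc n) powr p)" for n
    proof -
      have d: "(\<lambda>x. u x - v n x) \<in> \<F>" using F_diff[OF u vF] .
      \<comment> \<open>On the larger ball \<open>u\<close> is 0 and \<open>w n\<close> is dominated
        by \<open>v n\<close>; off it \<open>\<phi>\<close> is 0 and truncation is a
        contraction.\<close>
      have "AE y in m. \<bar>w n y - min M (u y)\<bar> \<le> \<bar>u y - v n y\<bar>"
        using zero
      proof eventually_elim
        fix y assume y: "y \<in> ball x (2 * s) \<longrightarrow> u y = 0"
        have *: "0 \<le> M * \<phi> y" using mult_nonneg_nonneg[OF M \<phi>(2)[of y]] .
        show "\<bar>w n y - min M (u y)\<bar> \<le> \<bar>u y - v n y\<bar>"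
        proof (cases "y \<in> ball x (2 * s)")
          case True
          then show ?thesis using y * M by (auto simp: w_def)
        next
          case False
          then have "\<phi> y = 0" using \<phi>(4)[of y] by simp
          then show ?thesis using nonneg[of y] M by (auto simp: w_def)
        qed
      qed
      then have "Jp UNIV (\<lambda>y. w n y - min M (u y)) \<le> Jp UNIV (\<lambda>y. u y - v n y)"
        unfolding Jp_def
        by (intro nn_integral_mono_AE) (use p_pos in \<open>auto intro!: ennreal_leI powr_mono2 elim!: eventually_mono\<close>)
      also have "\<dots> \<le> ennreal (Lp_norm m p (\<lambda>y. u y - v n y) powr p)"
        using d F_Lp by (intro Jp_le_Lp_norm) auto
      also have "\<dots> \<le> ennreal ((1 / Suc n) powr p)"
      proof (intro ennreal_leI powr_mono2)
        show "Lp_norm m p (\<lambda>y. u y - v n y) \<le> 1 / real (Suc n)"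
          using v(2)[of n] powr_ge_zero[of "\<E> (\<lambda>y. u y - v n y)" "1 / p"] unfolding energy_norm_def by linarith
      qed (use p_pos in \<open>auto simp: Lp_norm_def\<close>)
      finally show ?thesis .
    qed
    show "(\<lambda>n. Jp UNIV (\<lambda>y. w n y - min M (u y))) \<longlonglongrightarrow> 0"
    proof (rule tendsto_sandwich[OF _ _ tendsto_const])
      have "(\<lambda>n. 1 / real (Suc n)) \<longlonglongrightarrow> 0" by (rule LIMSEQ_Suc[OF lim_1_over_n])
      then have "(\<lambda>n. (1 / real (Suc n)) powr p) \<longlonglongrightarrow> 0 powr p"
        by (rule tendsto_powr') (use p_pos in auto)
      then have "(\<lambda>n. ennreal ((1 / Suc n) powr p)) \<longlonglongrightarrow> ennreal 0"
        by (intro tendsto_ennrealI) simp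
      then show "(\<lambda>n. ennreal ((1 / Suc n) powr p)) \<longlonglongrightarrow> 0" by simp
    qed (use J in auto)
  qed simp
  then have "\<Gamma> z = \<Gamma> (\<lambda>y. min M (u y))" using \<Gamma>_AE[OF z(1) mu] by simp
  then show ?thesis using gz by simp
qed

text \<open>Removes the truncation: \<open>min n u\<close> has energy at most that of
  \<open>u\<close>, converges to \<open>u\<close> by dominated convergence, and carries no energy on
  the ball for any \<open>n\<close>.\<close>

lemma \<Gamma>_vanish_nonneg:
  assumes s: "0 < s" "compact (cball x (2 * s))" and u: "u \<in> \<F>" and nonneg: "\<And>y. 0 \<le> u y"
    and zero: "AE y in m. y \<in> ball x (2 * s) \<longrightarrow> u y = 0"
  shows "gN (ball x s) u = 0"
proof -
  define w where "w n y = min (real n) (u y)" for n y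
  have wF: "w n \<in> \<F>" "eN (w n) \<le> eN u" for n
  proof -
    have *: "\<bar>min (real n) s - min (real n) t\<bar> \<le> \<bar>s - t\<bar>" for s t by linarith
    show "w n \<in> \<F>" "eN (w n) \<le> eN u"
      unfolding w_def by (rule F_lipschitz[OF u *]; simp)+
  qed
  have uL: "u \<in> Lp_space m p" using u F_Lp by auto
  have wb: "energy_norm m p \<E> (w n) \<le> energy_norm m p \<E> u" for n
  proof -
    have "Lp_norm m p (w n) \<le> Lp_norm m p u"
      by (rule Lp_space_mono[OF uL]) (use F_measurable[OF wF(1)] nonneg p_pos in \<open>auto simp: w_def\<close>)
    then show ?thesis using wF(2)[of n] by (simp add: energy_norm_def)
  qed
  obtain z where z: "z \<in> \<F>"
    "\<And>A a. A \<in> sets borel \<Longrightarrow> \<forall>\<^sub>F n in sequentially. gN A (w n) \<le> a \<Longrightarrow> gN A z \<le> a"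
    "\<And>D f. D \<in> sets borel \<Longrightarrow> f \<in> borel_measurable borel \<Longrightarrow>
        (\<lambda>n. Jp D (\<lambda>x. w n x - f x)) \<longlonglongrightarrow> 0 \<Longrightarrow> AE x in m. x \<in> D \<longrightarrow> z x = f x"
    by (rule weak_limit[of w, OF wF(1) wb]) blast
  have gw: "gN (ball x s) (w n) = 0" for n
    unfolding w_def using \<Gamma>_vanish_bounded[OF s u nonneg zero, of "real n"] by simp
  have "gN (ball x s) z \<le> 0" by (rule z(2)) (use gw in auto)
  then have gz: "gN (ball x s) z = 0" by (simp add: order_antisym)
  note [measurable] = F_measurable[OF u]
  have "AE y in m. y \<in> UNIV \<longrightarrow> z y = u y"
  proof (rule z(3))
    have "(\<lambda>n. \<integral>\<^sup>+y. ennreal (\<bar>w n y - u y\<bar> powr p) \<partial>m) \<longlonglongrightarrow> (\<integral>\<^sup>+y. ennreal 0 \<partial>m)"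
    proof (rule nn_integral_dominated_convergence[where w="\<lambda>y. ennreal (\<bar>u y\<bar> powr p)"])
      show "(\<integral>\<^sup>+y. ennreal (\<bar>u y\<bar> powr p) \<partial>m) < \<infinity>"
        using nn_integral_Lp_norm[OF p_pos uL] by simp
      show "AE y in m. ennreal (\<bar>w n y - u y\<bar> powr p) \<le> ennreal (\<bar>u y\<bar> powr p)" for n
        using nonneg p_pos by (auto simp: w_def intro!: AE_I2 ennreal_leI powr_mono2)
      show "AE y in m. (\<lambda>n. ennreal (\<bar>w n y - u y\<bar> powr p)) \<longlonglongrightarrow> ennreal 0"
      proof (rule AE_I2)
        fix y
        obtain N where N: "u y \<le> real N" using real_arch_simple by blast
        have "\<forall>\<^sub>F n in sequentially. ennreal (\<bar>w n y - u y\<bar> powr p) = ennreal 0"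
          using eventually_ge_at_top[of N] by eventually_elim (use N in \<open>auto simp: w_def\<close>)
        then show "(\<lambda>n. ennreal (\<bar>w n y - u y\<bar> powr p)) \<longlonglongrightarrow> ennreal 0"
          by (rule tendsto_eventually)
      qed
    qed (auto simp: w_def)
    then show "(\<lambda>n. Jp UNIV (\<lambda>y. w n y - u y)) \<longlonglongrightarrow> 0"
      by (simp add: Jp_def)
  qed auto
  then have "\<Gamma> z = \<Gamma> u" using \<Gamma>_AE[OF z(1) u] by simp
  then show ?thesis using gz by simp
qed

text \<open>Positive and negative parts reduce the value 0 to the nonnegative case. Subtracting a
  multiple of a cutoff that is 1 on the larger ball reduces the value \<open>c\<close> to 0; that
  cutoff is the reason for the compact ball of radius \<open>4 * s\<close>.\<close>

lemma \<Gamma>_const_ball: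
  assumes s: "0 < s" "compact (cball x (4 * s))" and u: "u \<in> \<F>"
    and const: "AE y in m. y \<in> ball x (2 * s) \<longrightarrow> u y = c"
  shows "gN (ball x s) u = 0"
proof -
  have zero: "gN (ball x s) v = 0" if v: "v \<in> \<F>" and "AE y in m. y \<in> ball x (2 * s) \<longrightarrow> v y = 0" for v
  proof -
    have c: "compact (cball x (2 * s))"
      by (rule compact_cball_mono[OF s(2)]) (use s in simp)
    have mv: "(\<lambda>y. - v y) \<in> \<F>" using F_scale[OF v, of "-1"] by simp
    have 1: "gN (ball x s) (\<lambda>y. max 0 (v y)) = 0"
      by (rule \<Gamma>_vanish_nonneg[OF s(1) c F_pos(1)[OF v]]) (use that in \<open>auto elim!: eventually_mono\<close>)
    have 2: "gN (ball x s) (\<lambda>y. max 0 (- v y)) = 0"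
      by (rule \<Gamma>_vanish_nonneg[OF s(1) c F_pos(1)[OF mv]]) (use that in \<open>auto elim!: eventually_mono\<close>)
    have eq: "v = (\<lambda>y. max 0 (v y) - max 0 (- v y))" by (auto simp: max_def)
    have "gN (ball x s) (\<lambda>y. max 0 (v y) - max 0 (- v y)) \<le> 0"
      using seminorm_on_diff[OF F_subspace \<Gamma>_seminorm[of "ball x s"] F_pos(1)[OF v] F_pos(1)[OF mv]] 1 2 by simp
    then show ?thesis using eq by (simp add: order_antisym)
  qed
  obtain \<phi> where \<phi>: "\<phi> \<in> \<F> \<inter> Cc" "\<And>y. dist x y \<le> 2 * s \<Longrightarrow> \<phi> y = 1"
    by (rule cutoff_exists[of "2 * s" x]) (use s in auto)
  have \<phi>F: "\<phi> \<in> \<F>" using \<phi> by simp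
  have c\<phi>: "(\<lambda>y. c * \<phi> y) \<in> \<F>" using F_scale[OF \<phi>F] .
  have d: "(\<lambda>y. u y - c * \<phi> y) \<in> \<F>" using F_diff[OF u c\<phi>] .
  have "gN (ball x s) (\<lambda>y. u y - c * \<phi> y) = 0"
    by (rule zero[OF d]) (use const \<phi>(2) in \<open>auto elim!: eventually_mono\<close>)
  moreover have "measure (\<Gamma> \<phi>) (ball x s) = 0"
    by (rule \<Gamma>_const_Cc[OF \<phi>(1), of "ball x s" 1]) (use \<phi>(2) s in auto)
  then have "gN (ball x s) (\<lambda>y. c * \<phi> y) = 0"
    using seminorm_onD(3)[OF \<Gamma>_seminorm[of "ball x s"] \<phi>F, of c] by simp
  moreover have "gN (ball x s) u \<le> gN (ball x s) (\<lambda>y. c * \<phi> y) + gN (ball x s) (\<lambda>y. u y - c * \<phi> y)"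
    by (rule seminorm_on_triangle[OF F_subspace \<Gamma>_seminorm u c\<phi>]) simp
  ultimately show ?thesis by (simp add: order_antisym)
qed

text \<open>By Lindelof, countably many small balls to which the previous case applies already cover
  \<open>W\<close>.\<close>

lemma \<Gamma>_const_AE:
  assumes u: "u \<in> \<F>" and W: "open W" and const: "AE y in m. y \<in> W \<longrightarrow> u y = c"
    and B: "B \<in> sets borel" "B \<subseteq> W"
  shows "emeasure (\<Gamma> u) B = 0"
proof -
  define \<B> where "\<B> = {ball x s |x s. 0 < s \<and> compact (cball x (4 * s)) \<and> ball x (2 * s) \<subseteq> W}"
  have cover: "\<Union>\<B> = W"
  proof (intro equalityI subsetI)
    fix x assume "x \<in> W"
    then obtain e where e: "0 < e" "ball x e \<subseteq> W" using W open_contains_ball by blast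
    obtain t where t: "0 < t" "compact (cball x t)" by (rule compact_cball_ex)
    define s where "s = min e t / 4"
    have "compact (cball x (4 * s))"
      by (rule compact_cball_mono[OF t(2)]) (simp add: s_def)
    moreover have "ball x (2 * s) \<subseteq> W" using e t by (intro order.trans[OF _ e(2)]) (auto simp: s_def)
    moreover have "0 < s" using e t by (simp add: s_def)
    ultimately have "ball x s \<in> \<B>" unfolding \<B>_def by blast
    moreover have "x \<in> ball x s" using e t by (auto simp: s_def)
    ultimately show "x \<in> \<Union>\<B>" by blast
  next
    fix y assume "y \<in> \<Union>\<B>"
    then obtain x s where "y \<in> ball x s" "0 < s" "ball x (2 * s) \<subseteq> W" unfolding \<B>_def by blast
    moreover from this have "y \<in> ball x (2 * s)" by simp
    ultimately show "y \<in> W" by blast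
  qed
  obtain \<B>' where \<B>': "\<B>' \<subseteq> \<B>" "countable \<B>'" "\<Union>\<B>' = \<Union>\<B>"
    by (rule Lindelof[of \<B>]) (auto simp: \<B>_def)
  have null: "b \<in> null_sets (\<Gamma> u)" if "b \<in> \<B>'" for b
  proof -
    have "b \<in> \<B>" using that \<B>' by blast
    then obtain x s where b: "b = ball x s" "0 < s" "compact (cball x (4 * s))" "ball x (2 * s) \<subseteq> W"
      unfolding \<B>_def by blast
    have "gN (ball x s) u = 0"
      by (rule \<Gamma>_const_ball[OF b(2,3) u, of c]) (use const b(4) in \<open>auto elim!: eventually_mono\<close>)
    then show ?thesis
      using emeasure_\<Gamma>[OF u] \<Gamma>_borel[OF u] b(1) by (auto intro!: null_setsI)
  qed
  have "\<Union>\<B>' \<in> null_sets (\<Gamma> u)"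
    using null_sets_UN'[OF \<B>'(2), of "\<lambda>b. b" "\<Gamma> u"] null by simp
  then have "B \<in> null_sets (\<Gamma> u)"
    using null_sets_subset[of "\<Union>\<B>'" "\<Gamma> u" B] B \<B>'(3) cover \<Gamma>_borel[OF u] by simp
  then show ?thesis by auto
qed

lemma \<Gamma>_local_le:
  assumes u: "u \<in> \<F>" and v: "v \<in> \<F>" and W: "open W" and const: "AE y in m. y \<in> W \<longrightarrow> u y - v y = c"
    and B: "B \<in> sets borel" "B \<subseteq> W"
  shows "measure (\<Gamma> u) B \<le> measure (\<Gamma> v) B"
proof -
  have d: "(\<lambda>y. u y - v y) \<in> \<F>" using F_diff[OF u v] .
  have "emeasure (\<Gamma> (\<lambda>y. u y - v y)) B = 0" by (rule \<Gamma>_const_AE[OF d W const B])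
  then have "gN B (\<lambda>y. u y - v y) = 0" by (simp add: measure_def)
  then have "gN B u \<le> gN B v"
    using seminorm_on_triangle[OF F_subspace \<Gamma>_seminorm[OF B(1)] u v] by simp
  then show ?thesis
    using powr_less_mono2[of "1 / p" "measure (\<Gamma> v) B" "measure (\<Gamma> u) B"] p_pos by (meson divide_pos_pos measure_nonneg not_le zero_less_one)
qed

text \<open>Strong locality for all of \<open>\<F>\<close>, with agreement only almost everywhere:
  the difference has no energy on \<open>B\<close>, and the triangle inequality for the seminorm is
  used in both directions.\<close>

lemma \<Gamma>_local:
  assumes u: "u \<in> \<F>" and v: "v \<in> \<F>" and W: "open W" and const: "AE y in m. y \<in> W \<longrightarrow> u y - v y = c"
    and B: "B \<in> sets borel" "B \<subseteq> W"
  shows "measure (\<Gamma> u) B = measure (\<Gamma> v) B"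
proof (rule antisym)
  show "measure (\<Gamma> u) B \<le> measure (\<Gamma> v) B" by (rule \<Gamma>_local_le[OF assms])
  have "AE y in m. y \<in> W \<longrightarrow> v y - u y = - c"
    using const by eventually_elim auto
  then show "measure (\<Gamma> v) B \<le> measure (\<Gamma> u) B" by (rule \<Gamma>_local_le[OF v u W _ B])
qed

end

section \<open>Nets, scale functions and doubling\<close>

text \<open>A maximal separated set for a position-dependent radius. Separating by the minimum of
  two radii makes maximality yield covering by the radius of the net point: a point far from all net
  points in this sense could be added.\<close>

lemma separated_net_exists:
  fixes X :: "'a::metric_space set"
  assumes pos: "\<And>x. x \<in> X \<Longrightarrow> 0 < \<rho> x"
  obtains S where "S \<subseteq> X" "\<And>x y. x \<in> S \<Longrightarrow> y \<in> S \<Longrightarrow> x \<noteq> y \<Longrightarrow> min (\<rho> x) (\<rho> y) \<le> dist x y"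
    "\<And>y. y \<in> X \<Longrightarrow> \<exists>x\<in>S. dist x y < \<rho> x"
proof -
  define \<A> where "\<A> = {S. S \<subseteq> X \<and> (\<forall>x\<in>S. \<forall>y\<in>S. x \<noteq> y \<longrightarrow> min (\<rho> x) (\<rho> y) \<le> dist x y)}"
  have "\<exists>S\<in>\<A>. \<forall>T\<in>\<A>. S \<subseteq> T \<longrightarrow> T = S"
  proof (rule subset_Zorn')
    fix C assume C: "subset.chain \<A> C"
    then have sub: "C \<subseteq> \<A>" and tot: "\<And>S T. S \<in> C \<Longrightarrow> T \<in> C \<Longrightarrow> S \<subseteq> T \<or> T \<subseteq> S"
      by (auto simp: subset_chain_def)
    show "\<Union>C \<in> \<A>"
      unfolding \<A>_def
    proof (intro CollectI conjI ballI impI)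
      show "\<Union>C \<subseteq> X" using sub by (auto simp: \<A>_def)
      fix x y assume "x \<in> \<Union>C" "y \<in> \<Union>C" "x \<noteq> y"
      then obtain S T where ST: "S \<in> C" "T \<in> C" "x \<in> S" "y \<in> T" by blast
      then obtain R where "R \<in> C" "x \<in> R" "y \<in> R" using tot[OF ST(1,2)] by blast
      then show "min (\<rho> x) (\<rho> y) \<le> dist x y" using sub \<open>x \<noteq> y\<close> unfolding \<A>_def by blast
    qed
  qed
  then obtain S where S: "S \<in> \<A>" and max: "\<And>T. T \<in> \<A> \<Longrightarrow> S \<subseteq> T \<Longrightarrow> T = S" by blast
  show thesis
  proof (rule that[of S])
    show "S \<subseteq> X" using S by (auto simp: \<A>_def)
    show sep: "min (\<rho> x) (\<rho> y) \<le> dist x y" if "x \<in> S" "y \<in> S" "x \<noteq> y" for x y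
      using S that unfolding \<A>_def by blast
    show "\<exists>x\<in>S. dist x y < \<rho> x" if y: "y \<in> X" for y
    proof (rule ccontr)
      assume no: "\<not> ?thesis"
      then have far: "\<rho> x \<le> dist x y" if "x \<in> S" for x using that by force
      have "y \<notin> S" using far[of y] pos[OF y] by auto
      have "insert y S \<in> \<A>"
        using S y far sep unfolding \<A>_def by (auto simp: dist_commute min_le_iff_disj)
      then have "insert y S = S" by (rule max) auto
      then show False using \<open>y \<notin> S\<close> by blast
    qed
  qed
qed

lemma scale_function_mono:
  assumes "scale_function \<Psi>" "0 < r" "r \<le> R"
  shows "\<Psi> r \<le> \<Psi> R"
proof (cases "r = R")
  case False
  then have "\<Psi> r < \<Psi> R"
    using assms strict_mono_onD[of "{0<..}" \<Psi> r R] by (simp add: scale_function_def)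
  then show ?thesis by simp
qed simp

lemma scale_function_pos:
  assumes "scale_function \<Psi>" "0 < r"
  shows "0 < \<Psi> r"
proof -
  have "\<Psi> ` {0<..} = {0<..}" using assms(1) by (simp add: scale_function_def bij_betw_def)
  then have "\<Psi> r \<in> {0<..}" using assms(2) by (metis greaterThan_iff imageI)
  then show ?thesis by simp
qed

definition scale_comparable :: "(real \<Rightarrow> real) \<Rightarrow> real \<Rightarrow> real \<Rightarrow> bool" where
  "scale_comparable \<Psi> lam C \<longleftrightarrow> 1 \<le> C \<and> (\<forall>r R. 0 < r \<and> 0 < R \<and> R \<le> lam * r \<longrightarrow> \<Psi> R \<le> C * \<Psi> r)"

lemma scale_comparableD:
  assumes "scale_comparable \<Psi> lam C"
  shows "1 \<le> C" and "0 < r \<Longrightarrow> 0 < R \<Longrightarrow> R \<le> lam * r \<Longrightarrow> \<Psi> R \<le> C * \<Psi> r"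
  using assms unfolding scale_comparable_def by blast+

lemma scale_comparable_exists:
  assumes \<Psi>: "scale_function \<Psi>" and lam: "1 \<le> lam"
  obtains C where "scale_comparable \<Psi> lam C"
proof -
  obtain C \<beta>1 \<beta>2 where C: "1 \<le> C" "0 < \<beta>1" "0 < \<beta>2"
    and bound: "\<forall>r R. 0 < r \<and> r \<le> R \<longrightarrow>
           inverse C * (R / r) powr \<beta>1 \<le> \<Psi> R / \<Psi> r \<and> \<Psi> R / \<Psi> r \<le> C * (R / r) powr \<beta>2"
    using \<Psi> unfolding scale_function_def by (elim conjE exE) (rule that)
  have one: "1 \<le> C * lam powr \<beta>2"
    using C lam ge_one_powr_ge_zero[of lam \<beta>2] mult_mono[of 1 C 1 "lam powr \<beta>2"] by simp
  have "scale_comparable \<Psi> lam (C * lam powr \<beta>2)"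
    unfolding scale_comparable_def
  proof (intro conjI allI impI one; (elim conjE)?)
    fix r R :: real assume rR: "0 < r" "0 < R" "R \<le> lam * r"
    have pr: "0 < \<Psi> r" by (rule scale_function_pos[OF \<Psi> rR(1)])
    show "\<Psi> R \<le> C * lam powr \<beta>2 * \<Psi> r"
    proof (cases "R \<le> r")
      case True
      then have "\<Psi> R \<le> 1 * \<Psi> r" using scale_function_mono[OF \<Psi> rR(2)] by simp
      also have "\<dots> \<le> C * lam powr \<beta>2 * \<Psi> r" using one pr by (intro mult_right_mono) auto
      finally show ?thesis .
    next
      case False
      then have "\<Psi> R / \<Psi> r \<le> C * (R / r) powr \<beta>2" using bound rR(1) by simp
      also have "\<dots> \<le> C * lam powr \<beta>2"
        using C rR by (intro mult_left_mono powr_mono2) (auto simp: divide_simps)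
      finally show ?thesis using pr by (simp add: divide_simps)
    qed
  qed
  then show thesis by (rule that)
qed

lemma scale_function_small:
  assumes \<Psi>: "scale_function \<Psi>" and "0 < e"
  obtains d where "0 < d" "\<And>r. 0 < r \<Longrightarrow> r \<le> d \<Longrightarrow> \<Psi> r \<le> e"
proof -
  have "e \<in> \<Psi> ` {0<..}" using assms by (auto simp: scale_function_def bij_betw_def)
  then obtain d where "0 < d" "\<Psi> d = e" by auto
  then show thesis using that scale_function_mono[OF \<Psi>] by blast
qed

lemma emeasure_sum_exists:
  assumes "sets M = sets N"
  obtains K where "sets K = sets N" "\<And>E. E \<in> sets N \<Longrightarrow> emeasure K E = emeasure M E + emeasure N E"
proof -
  define K where "K = measure_of (space N) (sets N) (\<lambda>E. emeasure M E + emeasure N E)"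
  have "emeasure K E = emeasure M E + emeasure N E" if "E \<in> sets N" for E
    unfolding K_def
  proof (rule emeasure_measure_of_sigma)
    show "sigma_algebra (space N) (sets N)" by (rule sets.sigma_algebra_axioms)
    show "positive (sets N) (\<lambda>E. emeasure M E + emeasure N E)" by (simp add: positive_def)
    show "countably_additive (sets N) (\<lambda>E. emeasure M E + emeasure N E)"
    proof (rule countably_additiveI)
      fix A :: "nat \<Rightarrow> 'a set" assume A: "range A \<subseteq> sets N" "disjoint_family A"
      show "(\<Sum>i. emeasure M (A i) + emeasure N (A i)) = emeasure M (\<Union> (range A)) + emeasure N (\<Union> (range A))"
        using A assms by (simp add: suminf_add[symmetric] suminf_emeasure)
    qed
  qed (fact that)
  moreover have "sets K = sets N" by (simp add: K_def)
  ultimately show thesis using that by blast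
qed

section \<open>The energy measure of a function known only on an open set\<close>

context p_energy_space
begin

lemma relatively_compact_in_Un:
  "relatively_compact_in U A \<Longrightarrow> relatively_compact_in U B \<Longrightarrow> relatively_compact_in U (A \<union> B)"
  by (simp add: relatively_compact_in_def compact_Un)

lemma local_extension:
  assumes "u \<in> F_loc m \<F> U" "open A" "relatively_compact_in U A"
  shows "local_extension m \<F> u A \<in> \<F>" "AE x in m. x \<in> A \<longrightarrow> u x = local_extension m \<F> u A x"
proof -
  have "\<exists>v. v \<in> \<F> \<and> (AE x in m. x \<in> A \<longrightarrow> u x = v x)"
    using assms by (auto simp: F_loc_def)
  from someI_ex[OF this] show "local_extension m \<F> u A \<in> \<F>" "AE x in m. x \<in> A \<longrightarrow> u x = local_extension m \<F> u A x"
    by (auto simp: local_extension_def)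
qed

text \<open>\<open>measure_of\<close> has the intended values only once countable additivity is
  known. The admissible sets are directed under union, and strong locality makes the values increase
  along them whatever extensions were chosen, so supremum and series commute.\<close>

lemma emeasure_\<Gamma>_loc:
  assumes u: "u \<in> F_loc m \<F> U" and U: "open U" and E: "E \<in> sets borel" "E \<subseteq> U"
  shows "emeasure (\<Gamma>_loc m \<F> \<Gamma> U u) E =
    (SUP A \<in> {A. open A \<and> relatively_compact_in U A}. emeasure (\<Gamma> (local_extension m \<F> u A)) (E \<inter> A))"
proof -
  let ?I = "{A. open A \<and> relatively_compact_in U A}"
  let ?v = "local_extension m \<F> u"
  have setsU: "X \<in> sets borel" if "X \<in> sets (restrict_space borel U)" for X
    using that U by (simp add: sets_restrict_space_iff borel_open)
  have mono: "emeasure (\<Gamma> (?v A)) (X \<inter> A) \<le> emeasure (\<Gamma> (?v B)) (X \<inter> B)"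
    if A: "A \<in> ?I" and B: "B \<in> ?I" and AB: "A \<subseteq> B" and X: "X \<in> sets borel" for A B X
  proof -
    note vA = local_extension[OF u, of A] and vB = local_extension[OF u, of B]
    have XA: "X \<inter> A \<in> sets borel" and XB: "X \<inter> B \<in> sets borel" using X A B by (auto simp: borel_open)
    have "AE x in m. x \<in> A \<longrightarrow> ?v A x - ?v B x = 0"
      using vA(2) vB(2) A B AB by (auto elim!: eventually_elim2)
    then have "measure (\<Gamma> (?v A)) (X \<inter> A) = measure (\<Gamma> (?v B)) (X \<inter> A)"
      using vA vB A B XA by (intro \<Gamma>_local[of _ _ A]) auto
    then have "emeasure (\<Gamma> (?v A)) (X \<inter> A) = emeasure (\<Gamma> (?v B)) (X \<inter> A)"
      using vA vB A B by (simp add: emeasure_\<Gamma>)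
    also have "\<dots> \<le> emeasure (\<Gamma> (?v B)) (X \<inter> B)"
      using AB XB vB B by (intro emeasure_mono) (auto simp: \<Gamma>_borel)
    finally show ?thesis .
  qed
  show ?thesis
    unfolding \<Gamma>_loc_def
  proof (rule emeasure_measure_of_sigma)
    have "space (restrict_space borel U) = U" by (simp add: space_restrict_space)
    then show "sigma_algebra U (sets (restrict_space borel U))"
      using sets.sigma_algebra_axioms[of "restrict_space borel U"] by simp
    show "E \<in> sets (restrict_space borel U)"
      using E U by (simp add: sets_restrict_space_iff borel_open)
    have "{} \<in> ?I" by (simp add: relatively_compact_in_def)
    then have "?I \<noteq> {}" by blast
    then show "positive (sets (restrict_space borel U)) (\<lambda>E. SUP A\<in>?I. emeasure (\<Gamma> (?v A)) (E \<inter> A))"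
      by (simp add: positive_def del: Collect_empty_eq)
    show "countably_additive (sets (restrict_space borel U)) (\<lambda>E. SUP A\<in>?I. emeasure (\<Gamma> (?v A)) (E \<inter> A))"
    proof (rule countably_additiveI)
      fix X :: "nat \<Rightarrow> 'a set"
      assume X: "range X \<subseteq> sets (restrict_space borel U)" "disjoint_family X"
      have Xb: "X i \<in> sets borel" for i using X(1) setsU by blast
      have "(\<Sum>i. SUP A\<in>?I. emeasure (\<Gamma> (?v A)) (X i \<inter> A)) = (SUP A\<in>?I. \<Sum>i. emeasure (\<Gamma> (?v A)) (X i \<inter> A))"
      proof (rule ennreal_suminf_SUP_eq_directed)
        fix N A B assume AB: "A \<in> ?I" "B \<in> ?I"
        then have "A \<union> B \<in> ?I" by (auto intro: relatively_compact_in_Un)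
        then show "\<exists>k\<in>?I. \<forall>n\<in>N. emeasure (\<Gamma> (?v A)) (X n \<inter> A) \<le> emeasure (\<Gamma> (?v k)) (X n \<inter> k) \<and>
            emeasure (\<Gamma> (?v B)) (X n \<inter> B) \<le> emeasure (\<Gamma> (?v k)) (X n \<inter> k)"
          using AB Xb by (intro bexI[of _ "A \<union> B"] ballI conjI mono) auto
      qed
      also have "\<dots> = (SUP A\<in>?I. emeasure (\<Gamma> (?v A)) (\<Union> (range X) \<inter> A))"
      proof (rule SUP_cong[OF refl])
        fix A assume A: "A \<in> ?I"
        then have "sets (\<Gamma> (?v A)) = sets borel" using local_extension[OF u, of A] \<Gamma>_borel by auto
        moreover have "disjoint_family (\<lambda>i. X i \<inter> A)"
          using X(2) unfolding disjoint_family_on_def by blast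
        ultimately have "(\<Sum>i. emeasure (\<Gamma> (?v A)) (X i \<inter> A)) = emeasure (\<Gamma> (?v A)) (\<Union>i. X i \<inter> A)"
          using Xb A by (intro suminf_emeasure) (auto simp: borel_open)
        then show "(\<Sum>i. emeasure (\<Gamma> (?v A)) (X i \<inter> A)) = emeasure (\<Gamma> (?v A)) (\<Union> (range X) \<inter> A)"
          by simp
      qed
      finally show "(\<Sum>i. SUP A\<in>?I. emeasure (\<Gamma> (?v A)) (X i \<inter> A))
        = (SUP A\<in>?I. emeasure (\<Gamma> (?v A)) (\<Union> (range X) \<inter> A))" .
    qed
  qed
qed

lemma \<Gamma>_le_\<Gamma>_loc:
  assumes u: "u \<in> F_loc m \<F> U" and U: "open U" and A: "open A" "relatively_compact_in U A"
    and v: "v \<in> \<F>" "AE x in m. x \<in> A \<longrightarrow> u x = v x" and E: "E \<in> sets borel" "E \<subseteq> A"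
  shows "emeasure (\<Gamma> v) E \<le> emeasure (\<Gamma>_loc m \<F> \<Gamma> U u) E"
proof -
  let ?w = "local_extension m \<F> u A"
  note w = local_extension[OF u A]
  have "AE x in m. x \<in> A \<longrightarrow> v x - ?w x = 0" using v(2) w(2) by eventually_elim auto
  from \<Gamma>_local[OF v(1) w(1) A(1) this E] have "emeasure (\<Gamma> v) E = emeasure (\<Gamma> ?w) (E \<inter> A)"
    using E(2) by (simp add: emeasure_\<Gamma>[OF v(1)] emeasure_\<Gamma>[OF w(1)] inf.absorb1)
  also have "\<dots> \<le> (SUP A \<in> {A. open A \<and> relatively_compact_in U A}. emeasure (\<Gamma> (local_extension m \<F> u A)) (E \<inter> A))"
    by (rule SUP_upper) (use A in simp)
  also have "\<dots> = emeasure (\<Gamma>_loc m \<F> \<Gamma> U u) E"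
    using emeasure_\<Gamma>_loc[OF u U E(1)] E(2) A(2) closure_subset[of A]
    by (auto simp: relatively_compact_in_def)
  finally show ?thesis .
qed

end

section \<open>Consequences of volume doubling: packing and properness\<close>

locale doubling_energy_space = p_energy_space +
  assumes doubling: "volume_doubling m"
begin

abbreviation mb :: "'a \<Rightarrow> real \<Rightarrow> real" where
  "mb x r \<equiv> measure m (ball x r)"

text \<open>Some small compact ball has finite measure, and doubling carries finiteness to all
  radii.\<close>

lemma ball_finite: "emeasure m (ball x r) < \<infinity>"
proof -
  obtain c where c: "\<And>x r. 0 < r \<Longrightarrow> emeasure m (ball x (2 * r)) \<le> ennreal c * emeasure m (ball x r)"
    using doubling by (auto simp: volume_doubling_def)
  obtain s where s: "0 < s" "compact (cball x s)" by (rule compact_cball_ex)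
  have fin: "emeasure m (ball x (2 ^ n * s)) < \<infinity>" for n
  proof (induction n)
    case 0
    have "emeasure m (ball x s) \<le> emeasure m (cball x s)" by (intro emeasure_mono) auto
    also have "\<dots> < \<infinity>" using radon s(2) by (auto simp: radon_measure_def)
    finally show ?case by simp
  next
    case (Suc n)
    have "emeasure m (ball x (2 * (2 ^ n * s))) \<le> ennreal c * emeasure m (ball x (2 ^ n * s))"
      using s by (intro c) auto
    also have "\<dots> < \<infinity>" using Suc by (simp add: ennreal_mult_less_top)
    finally show ?case by (simp add: mult.assoc)
  qed
  obtain n where n: "r / s \<le> 2 ^ n"
    using real_arch_pow[of 2 "r / s"] by (auto intro: less_imp_le)
  then have "r \<le> 2 ^ n * s" using s(1) by (simp add: field_simps)
  then have "emeasure m (ball x r) \<le> emeasure m (ball x (2 ^ n * s))"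
    by (intro emeasure_mono subset_ball) auto
  then show ?thesis using fin[of n] by simp
qed

lemma emeasure_ball: "emeasure m (ball x r) = ennreal (mb x r)"
  using ball_finite[of x r] by (intro emeasure_eq_ennreal_measure) auto

lemma mb_pos: "0 < r \<Longrightarrow> 0 < mb x r"
  using full_support[of "ball x r"] ball_finite[of x r]
  by (auto simp: measure_def enn2real_positive_iff)

lemma measure_subset_ball:
  assumes "A \<in> sets borel" "A \<subseteq> ball x r"
  shows "measure m A \<le> mb x r" and "emeasure m A = ennreal (measure m A)"
proof -
  have le: "emeasure m A \<le> emeasure m (ball x r)" using assms by (intro emeasure_mono) auto
  then show "emeasure m A = ennreal (measure m A)"
    using ball_finite[of x r] by (intro emeasure_eq_ennreal_measure) auto
  with le show "measure m A \<le> mb x r" by (simp add: emeasure_ball)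
qed

lemma mb_mono: "ball x r \<subseteq> ball y s \<Longrightarrow> mb x r \<le> mb y s"
  by (rule measure_subset_ball) auto

definition volume_comparable :: "real \<Rightarrow> real \<Rightarrow> bool" where
  "volume_comparable lam C \<longleftrightarrow> 1 \<le> C \<and>
    (\<forall>x y r R. 0 < r \<and> dist x y \<le> lam * r \<and> R \<le> lam * r \<longrightarrow> mb x R \<le> C * mb y r)"

lemma volume_comparableD:
  assumes "volume_comparable lam C"
  shows "1 \<le> C" and "0 < r \<Longrightarrow> dist x y \<le> lam * r \<Longrightarrow> R \<le> lam * r \<Longrightarrow> mb x R \<le> C * mb y r"
  using assms unfolding volume_comparable_def by blast+

lemma volume_comparable_exists:
  obtains C where "volume_comparable lam C"
proof -
  obtain c where c: "1 \<le> c" "\<And>x r. 0 < r \<Longrightarrow> emeasure m (ball x (2 * r)) \<le> ennreal c * emeasure m (ball x r)"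
    using doubling by (auto simp: volume_doubling_def)
  have step: "mb x (2 * r) \<le> c * mb x r" if "0 < r" for x r
    using c(2)[OF that, of x] c(1) by (simp add: emeasure_ball ennreal_mult[symmetric])
  have pow: "mb x (2 ^ n * r) \<le> c ^ n * mb x r" if r: "0 < r" for x r n
  proof (induction n)
    case (Suc n)
    have "mb x (2 * (2 ^ n * r)) \<le> c * mb x (2 ^ n * r)" by (rule step) (use r in auto)
    also have "\<dots> \<le> c * (c ^ n * mb x r)" using c Suc by (intro mult_left_mono) auto
    finally show ?case by (simp add: mult.assoc)
  qed simp
  obtain n where n: "2 * lam < 2 ^ n" using real_arch_pow[of 2 "2 * lam"] by auto
  have "1 \<le> c ^ n" using c by simp
  then have "volume_comparable lam (c ^ n)"
    unfolding volume_comparable_def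
  proof (intro conjI allI impI; (elim conjE)?)
    fix x y :: 'a and r R :: real assume *: "0 < r" "dist x y \<le> lam * r" "R \<le> lam * r"
    have "lam * r + lam * r \<le> 2 ^ n * r" using n *(1) mult_right_mono[of "2 * lam" "2 ^ n" r] by simp
    then have "ball x R \<subseteq> ball y (2 ^ n * r)"
    proof -
      assume le: "lam * r + lam * r \<le> 2 ^ n * r"
      show ?thesis
      proof
        fix z assume "z \<in> ball x R"
        then show "z \<in> ball y (2 ^ n * r)"
          using dist_triangle[of y z x] *(2,3) le by (simp add: dist_commute[of x y])
      qed
    qed
    then have "mb x R \<le> mb y (2 ^ n * r)" by (rule mb_mono)
    also have "\<dots> \<le> c ^ n * mb y r" by (rule pow) fact
    finally show "mb x R \<le> c ^ n * mb y r" .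
  qed
  then show thesis by (rule that)
qed

text \<open>\<open>space m\<close> is the whole space; mentioning it ties the statement to the type
  of points, which does not occur in the type of \<open>packing_bound\<close>.\<close>

definition packing_bound :: "real \<Rightarrow> nat \<Rightarrow> bool" where
  "packing_bound lam N \<longleftrightarrow> (\<forall>z\<in>space m. \<forall>r S. 0 < r \<and> S \<subseteq> ball z (lam * r) \<and>
    pairwise (\<lambda>x y. r \<le> dist x y) S \<longrightarrow> finite S \<and> card S \<le> N)"

lemma packing_boundD:
  fixes S :: "'a set"
  assumes "packing_bound lam N" "0 < r" "S \<subseteq> ball z (lam * r)" "pairwise (\<lambda>x y. r \<le> dist x y) S"
  shows "finite S" "card S \<le> N"
  using assms(1)[unfolded packing_bound_def, rule_format, of z r S] assms(2-) by simp_all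

text \<open>Balls of half the separation are disjoint, lie in one ball of comparable radius, and
  each carries at least the fraction \<open>1 / C\<close> of its measure.\<close>

lemma packing_bound_exists:
  assumes "0 < lam"
  obtains N where "packing_bound lam N"
proof -
  obtain C where CC: "volume_comparable (2 * (lam + 1)) C" by (rule volume_comparable_exists)
  note C = volume_comparableD[OF CC]
  have fin: "card T \<le> nat \<lceil>C\<rceil>" if r: "0 < r" and T: "T \<subseteq> ball z (lam * r)" "finite T"
    and sep: "pairwise (\<lambda>x y. r \<le> dist x y) T" for z r and T :: "'a set"
  proof -
    let ?M = "mb z ((lam + 1) * r)"
    have M: "0 < ?M" using r assms by (intro mb_pos) auto
    have low: "?M / C \<le> mb x (r / 2)" if "x \<in> T" for x
    proof -
      have "dist z x < lam * r" using T that by auto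
      moreover have "r \<le> (lam + 1) * r" using r assms by (simp add: algebra_simps)
      moreover have "2 * (lam + 1) * (r / 2) = (lam + 1) * r" by simp
      ultimately have "?M \<le> C * mb x (r / 2)" using r by (intro C(2)) (auto simp: distrib_right)
      then show ?thesis using C(1) by (simp add: field_simps)
    qed
    have disj: "disjoint_family_on (\<lambda>x. ball x (r / 2)) T"
      unfolding disjoint_family_on_def
    proof (intro ballI impI)
      fix x y assume xy: "x \<in> T" "y \<in> T" "x \<noteq> y"
      show "ball x (r / 2) \<inter> ball y (r / 2) = {}"
      proof (rule equals0I)
        fix w assume "w \<in> ball x (r / 2) \<inter> ball y (r / 2)"
        then have "dist x y < r" using dist_triangle[of x y w] by (simp add: dist_commute)
        then show False using sep xy by (auto dest: pairwiseD)
      qed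
    qed
    have sub: "(\<Union>x\<in>T. ball x (r / 2)) \<subseteq> ball z ((lam + 1) * r)"
    proof
      fix w assume "w \<in> (\<Union>x\<in>T. ball x (r / 2))"
      then obtain x where x: "x \<in> T" "dist x w < r / 2" by auto
      then have "dist z x < lam * r" using T by auto
      then show "w \<in> ball z ((lam + 1) * r)"
        using dist_triangle[of z w x] x(2) r by (simp add: algebra_simps)
    qed
    have "card T * (?M / C) = (\<Sum>x\<in>T. ?M / C)" by simp
    also have "\<dots> \<le> (\<Sum>x\<in>T. mb x (r / 2))" by (intro sum_mono low)
    also have "\<dots> = measure m (\<Union>x\<in>T. ball x (r / 2))"
      using disj ball_finite T(2) by (intro measure_finite_Union[symmetric]) (auto simp: less_top[symmetric] image_subset_iff)
    also have "\<dots> \<le> ?M" by (rule measure_subset_ball(1)[OF _ sub]) (auto intro!: borel_open)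
    finally have "card T \<le> C" using M C(1) by (simp add: field_simps)
    then show ?thesis by linarith
  qed
  show thesis
  proof (rule that[of "nat \<lceil>C\<rceil>"], unfold packing_bound_def, intro allI ballI impI, elim conjE)
    fix z :: 'a and r :: real and S
    assume *: "0 < r" "S \<subseteq> ball z (lam * r)" and sep: "pairwise (\<lambda>x y. r \<le> dist x y) S"
    have "finite S"
    proof (rule ccontr)
      assume "infinite S"
      then obtain T where T: "finite T" "card T = Suc (nat \<lceil>C\<rceil>)" "T \<subseteq> S"
        using infinite_arbitrarily_large by blast
      have "card T \<le> nat \<lceil>C\<rceil>"
        by (rule fin[OF *(1), of _ z]) (use T * sep in \<open>auto intro: pairwise_subset\<close>)
      then show False using T by simp
    qed
    moreover from this have "card S \<le> nat \<lceil>C\<rceil>"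
      by (intro fin[OF *(1,2)] sep)
    ultimately show "finite S \<and> card S \<le> nat \<lceil>C\<rceil>" by blast
  qed
qed

text \<open>Packing gives total boundedness, and the metric is complete. Thus a ball with a
  concentric larger ball inside \<open>U\<close> is relatively compact in \<open>U\<close>, as local
  extensions require.\<close>

lemma compact_cball_all: "compact (cball (x::'a) R)"
  unfolding compact_eq_totally_bounded
proof (intro conjI allI impI)
  show "complete (cball x R)" by (simp add: complete_eq_closed)
next
  fix e :: real assume e: "0 < e"
  obtain S where S: "S \<subseteq> cball x R" "\<And>y z. y \<in> S \<Longrightarrow> z \<in> S \<Longrightarrow> y \<noteq> z \<Longrightarrow> min e e \<le> dist y z"
    "\<And>y. y \<in> cball x R \<Longrightarrow> \<exists>z\<in>S. dist z y < e"
    by (rule separated_net_exists[of "cball x R" "\<lambda>_. e"]) (use e in auto)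
  define lam where "lam = \<bar>R\<bar> / e + 1"
  have lam: "0 < lam" unfolding lam_def using e by (intro add_nonneg_pos) auto
  obtain N where N: "packing_bound lam N" by (rule packing_bound_exists[OF lam])
  have "lam * e = \<bar>R\<bar> + e" using e by (simp add: lam_def field_simps)
  then have "cball x R \<subseteq> ball x (lam * e)" using e by auto
  then have "finite S" using packing_boundD(1)[OF N e, of S x] S(1,2) by (auto simp: pairwise_def)
  then show "\<exists>k. finite k \<and> cball x R \<subseteq> (\<Union>y\<in>k. ball y e)"
    using S(3) by (intro exI[of _ S]) (meson UN_I mem_ball subsetI)
qed

end

section \<open>Chains in uniform domains\<close>

text \<open>The \<open>h\<close>-balls about the centres reachable from \<open>z0\<close> and those
  about the other centres form two open sets covering \<open>P\<close>. They are disjoint because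
  intersecting balls have centres closer than \<open>2 * h\<close>, so connectedness leaves no
  unreachable centre.\<close>

lemma connected_net_chain:
  fixes P :: "'a::metric_space set"
  assumes P: "connected P" and S: "S \<subseteq> P" and cover: "P \<subseteq> (\<Union>z\<in>S. ball z h)"
    and z: "z0 \<in> S" "z1 \<in> S" and h: "0 < h"
  shows "(z0, z1) \<in> {(z, z'). z \<in> S \<and> z' \<in> S \<and> dist z z' < 2 * h}\<^sup>*"
proof -
  define r where "r = {(z, z'). z \<in> S \<and> z' \<in> S \<and> dist z z' < 2 * h}"
  define T where "T = {z\<in>S. (z0, z) \<in> r\<^sup>*}"
  define G where "G X = (\<Union>z\<in>X. ball z h)" for X :: "'a set"
  have z0: "z0 \<in> T" using z by (simp add: T_def)
  have "G T \<inter> G (S - T) = {}"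
  proof (rule equals0I)
    fix w assume "w \<in> G T \<inter> G (S - T)"
    then obtain z z' where zz: "z \<in> T" "z' \<in> S" "z' \<notin> T" "dist z w < h" "dist z' w < h"
      by (auto simp: G_def)
    have "dist z z' < 2 * h" using dist_triangle[of z z' w] zz by (simp add: dist_commute)
    then have "(z, z') \<in> r" using zz by (auto simp: r_def T_def)
    then have "z' \<in> T" using zz(1,2) by (auto simp: T_def intro: rtrancl_into_rtrancl)
    then show False using zz by simp
  qed
  moreover have "P \<subseteq> G T \<union> G (S - T)"
    using cover by (force simp: G_def)
  moreover have "open (G X)" for X by (auto simp: G_def)
  ultimately have disj: "G T \<inter> P = {} \<or> G (S - T) \<inter> P = {}"
    using P by (intro connectedD) auto
  have sub: "X \<subseteq> G X" for X using h by (auto simp: G_def)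
  have "z0 \<in> G T \<inter> P" using sub[of T] z0 S z by blast
  with disj have "G (S - T) \<inter> P = {}" by blast
  then have "S - T = {}" using sub[of "S - T"] S by blast
  then show ?thesis using z by (auto simp: T_def r_def)
qed

text \<open>A path in a finite relation can be shortened to at most \<open>card r\<close> steps, so
  the bound does not depend on the path.\<close>

lemma rtrancl_oscillation_bound:
  fixes g :: "'b \<Rightarrow> real" and D :: real
  assumes "finite r" and step: "\<And>z z'. (z, z') \<in> r \<Longrightarrow> \<bar>g z - g z'\<bar> \<le> D" and "(z0, z1) \<in> r\<^sup>*" and "0 \<le> D"
  shows "\<bar>g z0 - g z1\<bar> \<le> card r * D"
proof -
  obtain n where n: "n \<le> card r" "(z0, z1) \<in> r ^^ n"
    using assms(3) rtrancl_finite_eq_relpow[OF assms(1)] by auto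
  have "\<bar>g z0 - g z1\<bar> \<le> n * D" using n(2)
  proof (induction n arbitrary: z1)
    case (Suc n)
    then obtain z where "(z0, z) \<in> r ^^ n" "(z, z1) \<in> r" by auto
    then have "\<bar>g z0 - g z\<bar> \<le> n * D" "\<bar>g z - g z1\<bar> \<le> D" using Suc.IH step by auto
    then show ?case by (simp add: algebra_simps)
  qed simp
  also have "\<dots> \<le> card r * D" using n assms by (intro mult_right_mono) auto
  finally show ?thesis .
qed

section \<open>Local means and the control measure\<close>

context doubling_energy_space
begin

lemma Jp_const:
  assumes "G \<in> sets borel"
  shows "Jp G (\<lambda>x. c) = ennreal (\<bar>c\<bar> powr p) * emeasure m G"
  unfolding Jp_def using assms by (simp add: nn_integral_cmult_indicator)

text \<open>The constant function \<open>a - b\<close> is integrated over a set on which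
  \<open>f\<close> is close to both constants.\<close>

lemma oscillation_compare:
  assumes f: "f \<in> borel_measurable borel" and G: "G \<in> sets borel" "G \<subseteq> B1" "G \<subseteq> B2" "emeasure m G = ennreal (measure m G)"
    and T: "Jp B1 (\<lambda>x. f x - a) \<le> ennreal T1" "Jp B2 (\<lambda>x. f x - b) \<le> ennreal T2" "0 \<le> T1" "0 \<le> T2"
  shows "\<bar>a - b\<bar> powr p * measure m G \<le> 2 powr p * (T1 + T2)"
proof -
  have "ennreal (\<bar>a - b\<bar> powr p * measure m G) = Jp G (\<lambda>x. a - b)"
    using G by (simp add: Jp_const ennreal_mult)
  also have "\<dots> \<le> ennreal (2 powr p) * (Jp G (\<lambda>x. a - f x) + Jp G (\<lambda>x. f x - b))"
    by (rule Jp_diff_trans) (use f G in auto)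
  also have "\<dots> \<le> ennreal (2 powr p) * (ennreal T1 + ennreal T2)"
  proof (intro mult_left_mono add_mono)
    show "Jp G (\<lambda>x. a - f x) \<le> ennreal T1"
      using order.trans[OF Jp_mono_set[OF G(2), of "\<lambda>x. f x - a"] T(1)] by (simp add: Jp_diff_commute)
    show "Jp G (\<lambda>x. f x - b) \<le> ennreal T2"
      using order.trans[OF Jp_mono_set[OF G(3)] T(2)] .
  qed simp
  also have "\<dots> = ennreal (2 powr p * (T1 + T2))"
    using T by (simp add: ennreal_mult ennreal_plus)
  finally show ?thesis using T by (simp add: ennreal_le_iff)
qed

text \<open>All estimates below see the function \<open>f\<close> only through the finite measure returned here.\<close>

lemma control_measure_exists:
  assumes U: "open U" and f: "f \<in> F_on m p \<F> \<Gamma> U"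
    and PI: "\<And>x r u. 0 < r \<Longrightarrow> u \<in> \<F> \<Longrightarrow>
      Jp (ball x r) (\<lambda>y. u y - mean_on m (ball x r) u) \<le> ennreal (C * \<Psi> r) * emeasure (\<Gamma> u) (ball x (A * r))"
    and A: "1 \<le> A" and C: "0 \<le> C" and \<Psi>: "\<And>r. 0 < r \<Longrightarrow> 0 \<le> \<Psi> r"
  obtains \<nu> g where "finite_measure \<nu>" "sets \<nu> = sets borel" "g \<in> borel_measurable borel" "\<forall>x\<in>U. g x = f x"
    "\<forall>y s. 0 < s \<and> ball y (2 * A * s) \<subseteq> U \<longrightarrow>
      (\<exists>a. Jp (ball y s) (\<lambda>x. g x - a) \<le> ennreal (C * \<Psi> s * measure \<nu> (ball y (2 * A * s))))"
    "\<forall>E\<in>sets borel. E \<subseteq> U \<longrightarrow> Jp E g \<le> ennreal (measure \<nu> E)"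
proof -
  let ?M = "\<Gamma>_loc m \<F> \<Gamma> U f"
  have fl: "f \<in> F_loc m \<F> U" and fin: "(\<integral>\<^sup>+x\<in>U. ennreal (\<bar>f x\<bar> powr p) \<partial>m) + emeasure ?M U < \<infinity>"
    using f by (auto simp: F_on_def)
  have fm: "f \<in> borel_measurable (restrict_space borel U)" using fl by (simp add: F_loc_def)
  define g where "g x = (if x \<in> U then f x else 0)" for x
  have g [measurable]: "g \<in> borel_measurable borel"
    unfolding g_def using fm U by (subst measurable_If_restrict_space_iff) (auto simp: borel_open)
  have setsM: "sets ?M = sets (restrict_space borel U)"
    unfolding \<Gamma>_loc_def
    using sets.sigma_sets_eq[of "restrict_space borel U"] sets.space_closed[of "restrict_space borel U"]
    by (simp add: space_restrict_space)
  have spM: "space ?M = U"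
    using sets_eq_imp_space_eq[OF setsM] by (simp add: space_restrict_space)
  \<comment> \<open>The energy measure of \<open>f\<close>, pushed forward to the whole space.
    Together with the density \<open>\<bar>f\<bar> powr p\<close> on \<open>U\<close> it forms
    \<open>\<nu>\<close>, and membership in \<open>F_on\<close> makes the sum finite.\<close>
  define \<nu>1 where "\<nu>1 = distr ?M borel (\<lambda>x. x)"
  have id: "(\<lambda>x. x) \<in> measurable ?M borel"
    using measurable_restrict_space1[of "\<lambda>x. x" borel borel U] setsM
    by (simp cong: measurable_cong_sets)
  have \<nu>1: "emeasure \<nu>1 E = emeasure ?M (E \<inter> U)" if "E \<in> sets borel" for E
    using that id by (simp add: \<nu>1_def emeasure_distr spM)
  define \<nu>2 where "\<nu>2 = density m (\<lambda>x. ennreal (\<bar>g x\<bar> powr p) * indicator U x)"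
  have [measurable]: "U \<in> sets borel" using U by (rule borel_open)
  have \<nu>2: "emeasure \<nu>2 E = Jp (E \<inter> U) g" if [measurable]: "E \<in> sets borel" for E
  proof -
    have "emeasure \<nu>2 E = (\<integral>\<^sup>+x. ennreal (\<bar>g x\<bar> powr p) * indicator U x * indicator E x \<partial>m)"
      unfolding \<nu>2_def by (rule emeasure_density) auto
    also have "\<dots> = Jp (E \<inter> U) g"
      unfolding Jp_def by (intro nn_integral_cong) (auto simp: indicator_def)
    finally show ?thesis .
  qed
  obtain \<nu> where \<nu>: "sets \<nu> = sets \<nu>2" "\<And>E. E \<in> sets \<nu>2 \<Longrightarrow> emeasure \<nu> E = emeasure \<nu>1 E + emeasure \<nu>2 E"
    by (rule emeasure_sum_exists[of \<nu>1 \<nu>2]) (auto simp: \<nu>1_def \<nu>2_def)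
  have s\<nu>: "sets \<nu> = sets borel" using \<nu>(1) by (simp add: \<nu>2_def)
  have sp\<nu>: "space \<nu> = UNIV" using sets_eq_imp_space_eq[OF s\<nu>] by simp
  have \<nu>E: "emeasure \<nu> E = emeasure ?M (E \<inter> U) + Jp (E \<inter> U) g" if "E \<in> sets borel" for E
    using \<nu>(2)[of E] that \<nu>1 \<nu>2 \<nu>(1) s\<nu> by simp
  have "Jp U g = (\<integral>\<^sup>+x\<in>U. ennreal (\<bar>f x\<bar> powr p) \<partial>m)"
    unfolding Jp_def by (intro nn_integral_cong) (auto simp: g_def indicator_def)
  then have "emeasure \<nu> UNIV < \<infinity>" using \<nu>E[of UNIV] fin by (simp add: add.commute)
  then have fm\<nu>: "finite_measure \<nu>" using sp\<nu> by (intro finite_measureI) auto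
  interpret \<nu>: finite_measure \<nu> by fact
  show thesis
  proof (rule that[OF fm\<nu> s\<nu> g]; intro ballI allI impI; (elim conjE)?)
    show "g x = f x" if "x \<in> U" for x using that by (simp add: g_def)
    show "Jp E g \<le> ennreal (measure \<nu> E)" if "E \<in> sets borel" "E \<subseteq> U" for E
      using \<nu>E[OF that(1)] that(2) by (simp add: \<nu>.emeasure_eq_measure[symmetric] inf.absorb1)
    show "\<exists>a. Jp (ball y s) (\<lambda>x. g x - a) \<le> ennreal (C * \<Psi> s * measure \<nu> (ball y (2 * A * s)))"
      if s: "0 < s" and sub: "ball y (2 * A * s) \<subseteq> U" for y s
    proof -
      \<comment> \<open>The radius lies strictly between \<open>A * s\<close>, up to which the
        Poincare inequality needs a local extension of \<open>f\<close>, and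
        \<open>2 * A * s\<close>, up to which inclusion in \<open>U\<close> is given; the gap makes
        \<open>B\<close> relatively compact in \<open>U\<close>.\<close>
      define B where "B = ball y (3 / 2 * A * s)"
      have As: "s \<le> A * s" "0 < A * s" using mult_right_mono[OF A, of s] s by auto
      have cl: "closure B \<subseteq> cball y (3 / 2 * A * s)" unfolding B_def by (intro closure_minimal) auto
      moreover have "cball y (3 / 2 * A * s) \<subseteq> ball y (2 * A * s)" using As by auto
      ultimately have "closure B \<subseteq> U" using sub by blast
      moreover have "compact (closure B)"
        using compact_cball_all[of y "3 / 2 * A * s"] cl by (metis closed_closure compact_Int_closed inf.absorb_iff2)
      ultimately have rc: "relatively_compact_in U B" by (simp add: relatively_compact_in_def)
      have oB: "open B" by (simp add: B_def)
      obtain v where v: "v \<in> \<F>" "AE x in m. x \<in> B \<longrightarrow> f x = v x"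
        using fl oB rc unfolding F_loc_def by blast
      have sB: "ball y s \<subseteq> B" and AsB: "ball y (A * s) \<subseteq> B" using As by (auto simp: B_def)
      have BU: "B \<subseteq> U" using \<open>closure B \<subseteq> U\<close> closure_subset by blast
      let ?a = "mean_on m (ball y s) v"
      have "Jp (ball y s) (\<lambda>x. g x - ?a) = Jp (ball y s) (\<lambda>x. v x - ?a)"
        unfolding Jp_def
      proof (rule nn_integral_cong_AE)
        show "AE x in m. ennreal (\<bar>g x - ?a\<bar> powr p) * indicator (ball y s) x = ennreal (\<bar>v x - ?a\<bar> powr p) * indicator (ball y s) x"
          using v(2)
        proof eventually_elim
          fix x assume x: "x \<in> B \<longrightarrow> f x = v x"
          show "ennreal (\<bar>g x - ?a\<bar> powr p) * indicator (ball y s) x = ennreal (\<bar>v x - ?a\<bar> powr p) * indicator (ball y s) x"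
          proof (cases "x \<in> ball y s")
            case True
            then have "g x = v x" using x sB BU by (auto simp: g_def)
            then show ?thesis by simp
          qed simp
        qed
      qed
      also have "\<dots> \<le> ennreal (C * \<Psi> s) * emeasure (\<Gamma> v) (ball y (A * s))" by (rule PI[OF s v(1)])
      also have "\<dots> \<le> ennreal (C * \<Psi> s) * emeasure \<nu> (ball y (2 * A * s))"
      proof (rule mult_left_mono)
        have "emeasure (\<Gamma> v) (ball y (A * s)) \<le> emeasure ?M (ball y (A * s))"
          by (rule \<Gamma>_le_\<Gamma>_loc[OF fl U oB rc v _ AsB]) simp
        also have "\<dots> \<le> emeasure \<nu> (ball y (A * s))"
        proof -
          have "ball y (A * s) \<inter> U = ball y (A * s)" using AsB BU by blast
          then show ?thesis using \<nu>E[of "ball y (A * s)"] by simp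
        qed
        also have "\<dots> \<le> emeasure \<nu> (ball y (2 * A * s))"
          using As by (intro emeasure_mono) (auto simp: s\<nu>)
        finally show "emeasure (\<Gamma> v) (ball y (A * s)) \<le> emeasure \<nu> (ball y (2 * A * s))" .
      qed simp
      also have "\<dots> = ennreal (C * \<Psi> s * measure \<nu> (ball y (2 * A * s)))"
        using C \<Psi>[OF s] by (simp add: \<nu>.emeasure_eq_measure ennreal_mult)
      finally show ?thesis by blast
    qed
  qed
qed

end

text \<open>The energy of \<open>f\<close> enters through \<open>\<nu>\<close> alone.
  \<open>Lam\<close> is the dilation in the Poincare bound, \<open>w1\<close> and \<open>w2\<close>
  bound the size of \<open>U\<close> from below and so limit the radii at which deep points are
  found, and \<open>Rcap\<close> limits the radii at which cutoffs of controlled energy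
  exist.\<close>

locale uniform_extension = doubling_energy_space +
  fixes \<Psi> :: "real \<Rightarrow> real" and U :: "'a set" and f :: "'a \<Rightarrow> real" and \<nu> :: "'a measure"
    and CP Lam Au w1 w2 Ccap A1 Rcap
  assumes scale: "scale_function \<Psi>"
    and openU: "open U" and U_ne_UNIV: "U \<noteq> UNIV"
    and f_measurable [measurable]: "f \<in> borel_measurable borel"
    and \<nu>_finite: "finite_measure \<nu>" and sets_\<nu>: "sets \<nu> = sets borel"
    and CP: "0 \<le> CP" and Lam: "1 \<le> Lam"
    and poincare: "\<And>y s. 0 < s \<Longrightarrow> ball y (Lam * s) \<subseteq> U \<Longrightarrow>
      \<exists>a. Jp (ball y s) (\<lambda>x. f x - a) \<le> ennreal (CP * \<Psi> s * measure \<nu> (ball y (Lam * s)))"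
    and Jp_f: "\<And>E. E \<in> sets borel \<Longrightarrow> E \<subseteq> U \<Longrightarrow> Jp E f \<le> ennreal (measure \<nu> E)"
    and Au: "1 \<le> Au"
    and uniform: "\<And>x y. x \<in> U \<Longrightarrow> y \<in> U \<Longrightarrow> \<exists>\<gamma>.
        path \<gamma> \<and> path_image \<gamma> \<subseteq> U \<and> pathstart \<gamma> = x \<and> pathfinish \<gamma> = y \<and>
        diameter (path_image \<gamma>) \<le> Au * dist x y \<and>
        (\<forall>z \<in> path_image \<gamma>. infdist z (- U) \<ge> inverse Au * min (dist x z) (dist y z))"
    and w12: "w1 \<in> U" "w2 \<in> U" "w1 \<noteq> w2"
    and Ccap: "0 < Ccap" and A1: "1 < A1" and Rcap: "0 < Rcap"
    and capacity: "\<And>x R. 0 < R \<Longrightarrow> R \<le> Rcap \<Longrightarrow> \<exists>u\<in>\<F>. (AE y in m. y \<in> ball x R \<longrightarrow> u y = 1) \<and>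
        (AE y in m. y \<notin> ball x (A1 * R) \<longrightarrow> u y = 0) \<and> \<E> u \<le> Ccap * mb x R / \<Psi> R"
begin

sublocale \<nu>: finite_measure \<nu> by (rule \<nu>_finite)

abbreviation \<delta> :: "'a \<Rightarrow> real" where "\<delta> z \<equiv> infdist z (- U)"

lemma \<delta>_le: "w \<notin> U \<Longrightarrow> \<delta> z \<le> dist z w"
  by (rule infdist_le) simp

lemma \<delta>_lipschitz: "\<delta> z \<le> \<delta> w + dist z w"
  using infdist_triangle[of z "- U" w] by simp

lemma ball_\<delta>_subset: "r \<le> \<delta> z \<Longrightarrow> ball z r \<subseteq> U"
  using \<delta>_le[of _ z] by force

lemma \<Psi>_mono: "0 < r \<Longrightarrow> r \<le> R \<Longrightarrow> \<Psi> r \<le> \<Psi> R"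
  using scale_function_mono[OF scale] .

lemma \<Psi>_pos: "0 < r \<Longrightarrow> 0 < \<Psi> r"
  using scale_function_pos[OF scale] .

text \<open>Start at a point \<open>u\<close> of \<open>U\<close> almost nearest to
  \<open>x\<close>. One of \<open>w1\<close>, \<open>w2\<close> is at distance at least
  \<open>2 * \<rho>\<close> from \<open>u\<close>, so a uniform curve to it has a point at distance
  exactly \<open>\<rho>\<close> from \<open>u\<close> and at least \<open>\<rho>\<close> from the
  other end; the curve condition gives its depth.\<close>

lemma corkscrew:
  assumes \<rho>: "0 < \<rho>" "\<rho> \<le> dist w1 w2 / 4"
  obtains y where "y \<in> U" "dist x y \<le> infdist x U + 2 * \<rho>" "\<rho> / Au \<le> \<delta> y"
proof -
  have "U \<noteq> {}" using w12 by auto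
  then obtain u where u: "u \<in> U" "dist x u < infdist x U + \<rho>"
    using \<rho>(1) cInf_lessD[of "dist x ` U" "infdist x U + \<rho>"] by (auto simp: infdist_def)
  obtain u' where u': "u' \<in> U" "2 * \<rho> \<le> dist u u'"
  proof (cases "2 * \<rho> \<le> dist u w1")
    case True
    then show ?thesis using that w12 by blast
  next
    case False
    then have "2 * \<rho> \<le> dist u w2"
      using dist_triangle[of w1 w2 u] \<rho> by (simp add: dist_commute)
    then show ?thesis using that w12 by blast
  qed
  obtain \<gamma> where \<gamma>: "path \<gamma>" "path_image \<gamma> \<subseteq> U" "pathstart \<gamma> = u" "pathfinish \<gamma> = u'"
    "\<forall>z \<in> path_image \<gamma>. \<delta> z \<ge> inverse Au * min (dist u z) (dist u' z)"
    using uniform[OF u(1) u'(1)] by blast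
  have "continuous_on {0..1} (\<lambda>t. dist u (\<gamma> t))"
    using \<gamma>(1) by (auto simp: path_def intro!: continuous_intros)
  moreover have "dist u (\<gamma> 0) \<le> \<rho>" "\<rho> \<le> dist u (\<gamma> 1)"
    using \<gamma>(3,4) u'(2) \<rho> by (auto simp: pathstart_def pathfinish_def)
  ultimately obtain t where t: "0 \<le> t" "t \<le> 1" "dist u (\<gamma> t) = \<rho>"
    using IVT'[of "\<lambda>t. dist u (\<gamma> t)" 0 \<rho> 1] by auto
  define y where "y = \<gamma> t"
  have yP: "y \<in> path_image \<gamma>" using t by (auto simp: y_def path_image_def)
  have "\<rho> \<le> dist u' y" using dist_triangle[of u u' y] u'(2) t(3) by (simp add: y_def dist_commute)
  then have "min (dist u y) (dist u' y) = \<rho>" using t(3) by (simp add: y_def)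
  then have "\<rho> / Au \<le> \<delta> y" using \<gamma>(5) yP by (auto simp: field_simps)
  moreover have "dist x y \<le> infdist x U + 2 * \<rho>"
    using dist_triangle[of x y u] u(2) t(3) by (simp add: y_def)
  ultimately show thesis using that yP \<gamma>(2) by blast
qed

text \<open>Within \<open>d / 2\<close> of an endpoint the depth is inherited because
  \<open>\<delta>\<close> is 1-Lipschitz; elsewhere the uniform condition yields
  \<open>d / (2 * Au)\<close>.\<close>

lemma uniform_curve_deep:
  assumes y: "y \<in> U" "y' \<in> U" "d \<le> \<delta> y" "d \<le> \<delta> y'" and d: "0 < d"
  obtains P where "connected P" "y \<in> P" "y' \<in> P" "P \<subseteq> U" "\<And>z. z \<in> P \<Longrightarrow> dist y z \<le> Au * dist y y'"
    "\<And>z. z \<in> P \<Longrightarrow> d / (2 * Au) \<le> \<delta> z"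
proof -
  obtain \<gamma> where \<gamma>: "path \<gamma>" "path_image \<gamma> \<subseteq> U" "pathstart \<gamma> = y" "pathfinish \<gamma> = y'"
    "diameter (path_image \<gamma>) \<le> Au * dist y y'"
    "\<forall>z \<in> path_image \<gamma>. \<delta> z \<ge> inverse Au * min (dist y z) (dist y' z)"
    using uniform[OF y(1,2)] by blast
  have P: "y \<in> path_image \<gamma>" "y' \<in> path_image \<gamma>" using \<gamma>(3,4) by auto
  show thesis
  proof (rule that[of "path_image \<gamma>"])
    show "dist y z \<le> Au * dist y y'" if "z \<in> path_image \<gamma>" for z
      using diameter_bounded_bound[OF bounded_path_image[OF \<gamma>(1)] P(1) that] \<gamma>(5) by simp
    have dA: "d / (2 * Au) \<le> d / 2" using d Au by (intro divide_left_mono) auto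
    show "d / (2 * Au) \<le> \<delta> z" if z: "z \<in> path_image \<gamma>" for z
    proof (cases "dist y z \<le> d / 2 \<or> dist y' z \<le> d / 2")
      case True
      then have "d / 2 \<le> \<delta> z"
        using \<delta>_lipschitz[of y z] \<delta>_lipschitz[of y' z] y(3,4) by auto
      then show ?thesis using dA by simp
    next
      case False
      then have "inverse Au * (d / 2) \<le> inverse Au * min (dist y z) (dist y' z)"
        using Au by (intro mult_left_mono) auto
      then show ?thesis using \<gamma>(6) z by (force simp: field_simps)
    qed
  qed (use \<gamma> P in \<open>auto intro: connected_path_image\<close>)
qed

text \<open>The constant is left free: the Poincare inequality is applied to local extensions of
  \<open>f\<close>, and any constant with this bound can be compared with others.\<close>

definition osc :: "'a \<Rightarrow> real \<Rightarrow> real \<Rightarrow> bool" where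
  "osc y t a \<longleftrightarrow> Jp (ball y t) (\<lambda>x. f x - a) \<le> ennreal (CP * \<Psi> t * measure \<nu> (ball y (Lam * t)))"

lemma osc_exists: "0 < t \<Longrightarrow> ball y (Lam * t) \<subseteq> U \<Longrightarrow> \<exists>a. osc y t a"
  unfolding osc_def by (rule poincare)

lemma osc_le:
  assumes "osc y t a" "0 < t" "t \<le> \<rho>" "R \<in> sets borel" "ball y (Lam * t) \<subseteq> R"
  shows "Jp (ball y t) (\<lambda>x. f x - a) \<le> ennreal (CP * \<Psi> \<rho> * measure \<nu> R)"
proof -
  have "measure \<nu> (ball y (Lam * t)) \<le> measure \<nu> R"
    using assms by (intro \<nu>.finite_measure_mono) (auto simp: sets_\<nu>)
  then have "CP * \<Psi> t * measure \<nu> (ball y (Lam * t)) \<le> CP * \<Psi> \<rho> * measure \<nu> R"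
    using assms CP \<Psi>_mono[of t \<rho>] \<Psi>_pos[of t] \<Psi>_pos[of \<rho>] by (intro mult_mono mult_left_mono) auto
  then show ?thesis using assms(1) unfolding osc_def by (meson ennreal_leI order.trans)
qed

text \<open>The home of chains at scale \<open>\<rho>\<close>. The lower bound on the depth limits
  which scales can meet at a given point.\<close>

definition deep_region :: "real \<Rightarrow> real \<Rightarrow> 'a \<Rightarrow> real \<Rightarrow> 'a set" where
  "deep_region K \<kappa> y \<rho> = {z. dist y z < K * \<rho> \<and> \<kappa> * \<rho> < \<delta> z}"

lemma deep_region_borel [measurable]: "deep_region K \<kappa> y \<rho> \<in> sets borel"
proof -
  have "deep_region K \<kappa> y \<rho> = ball y (K * \<rho>) \<inter> {z. \<kappa> * \<rho> < \<delta> z}"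
    by (auto simp: deep_region_def)
  moreover have "open {z. \<kappa> * \<rho> < \<delta> z}"
    by (intro open_Collect_less continuous_intros)
  ultimately show ?thesis by (auto intro: borel_open)
qed

text \<open>One constant for all points, scales and radii. \<open>R\<close> is free so that a region
  centred at another point can be used.\<close>

definition chain_const :: "real \<Rightarrow> real \<Rightarrow> real \<Rightarrow> real \<Rightarrow> bool" where
  "chain_const \<sigma> \<kappa> K C \<longleftrightarrow> 0 \<le> C \<and>
     (\<forall>y y' \<rho> t t' a a' R. 0 < \<rho> \<and> \<kappa> * \<rho> \<le> \<delta> y \<and> \<kappa> * \<rho> \<le> \<delta> y' \<and> dist y y' \<le> K * \<rho> \<and>
        \<sigma> * \<rho> \<le> t \<and> Lam * t \<le> \<kappa> * \<rho> / 2 \<and> \<sigma> * \<rho> \<le> t' \<and> Lam * t' \<le> \<kappa> * \<rho> / 2 \<and>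
        osc y t a \<and> osc y' t' a' \<and> R \<in> sets borel \<and> deep_region (Au * K + 1) (\<kappa> / (4 * Au)) y \<rho> \<subseteq> R \<longrightarrow>
        \<bar>a - a'\<bar> powr p * mb y \<rho> \<le> C * \<Psi> \<rho> * measure \<nu> R)"

text \<open>The mean values on two deep balls are compared along a net of boundedly many balls
  centred on a uniform curve.\<close>

lemma chain_const_exists:
  assumes \<sigma>: "0 < \<sigma>" and \<kappa>: "0 < \<kappa>" "\<kappa> \<le> 1" and K: "1 \<le> K"
  obtains C where "chain_const \<sigma> \<kappa> K C"
proof -
  define \<kappa>1 where "\<kappa>1 = \<kappa> / (2 * Au)"
  \<comment> \<open>The mesh of the net is \<open>\<eta> * \<rho>\<close>. The first bound puts mesh
    balls inside the two given balls; the second lets balls of three meshes, dilated by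
    \<open>Lam\<close>, use up at most half of the depth of the curve.\<close>
  define \<eta> where "\<eta> = min \<sigma> (\<kappa>1 / (6 * Lam))"
  have Au0: "0 < Au" and Lam0: "0 < Lam" using Au Lam by auto
  have \<kappa>1: "0 < \<kappa>1" "\<kappa>1 \<le> \<kappa> / 2" using \<kappa> Au by (auto simp: \<kappa>1_def field_simps)
  have \<eta>: "0 < \<eta>" "\<eta> \<le> \<sigma>" using \<sigma> \<kappa>1 Lam by (auto simp: \<eta>_def)
  have "\<eta> \<le> \<kappa>1 / (6 * Lam)" by (simp add: \<eta>_def)
  then have \<eta>L: "3 * Lam * \<eta> \<le> \<kappa>1 / 2" using Lam by (simp add: field_simps)
  define lam where "lam = (Au * K + 1) / \<eta>"
  have AK: "1 \<le> Au * K" using Au K mult_mono[of 1 Au 1 K] by simp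
  have lam: "0 < lam" "lam * \<eta> = Au * K + 1" using \<eta> AK by (auto simp: lam_def)
  obtain N where N: "packing_bound lam N" by (rule packing_bound_exists[OF lam(1)])
  obtain Cv where "volume_comparable lam Cv" by (rule volume_comparable_exists)
  note Cv = volume_comparableD[OF this]
  \<comment> \<open>A chain has at most \<open>N * N\<close> links, as many as there are pairs of
    net points, plus one link at each end.\<close>
  define C where "C = (real (N * N) + 2) powr p * (2 powr p * (2 * CP) * Cv)"
  have "chain_const \<sigma> \<kappa> K C"
    unfolding chain_const_def
  proof (intro conjI allI impI; (elim conjE)?)
    show "0 \<le> C" using CP Cv(1) by (simp add: C_def)
  next
    fix y y' \<rho> t t' a a' R
    assume \<rho>: "0 < \<rho>" and d: "\<kappa> * \<rho> \<le> \<delta> y" "\<kappa> * \<rho> \<le> \<delta> y'" and yy: "dist y y' \<le> K * \<rho>"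
      and t: "\<sigma> * \<rho> \<le> t" "Lam * t \<le> \<kappa> * \<rho> / 2" "\<sigma> * \<rho> \<le> t'" "Lam * t' \<le> \<kappa> * \<rho> / 2"
      and a: "osc y t a" "osc y' t' a'" and R: "R \<in> sets borel" "deep_region (Au * K + 1) (\<kappa> / (4 * Au)) y \<rho> \<subseteq> R"
    define h where "h = \<eta> * \<rho>"
    have "\<eta> * \<rho> \<le> \<sigma> * \<rho>" using \<eta> \<rho> by (intro mult_right_mono) auto
    then have h: "0 < h" "h \<le> t" "h \<le> t'" using \<eta> \<rho> t(1,3) unfolding h_def by (simp, linarith+)
    have Lh: "Lam * (3 * h) \<le> \<kappa>1 * \<rho> / 2" using mult_right_mono[OF \<eta>L, of \<rho>] \<rho> by (simp add: h_def mult_ac)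
    have \<kappa>\<rho>: "0 < \<kappa> * \<rho>" "\<kappa> * \<rho> \<le> \<rho>" using \<kappa> \<rho> by (auto simp: mult_le_cancel_right2)
    have inU: "y \<in> U" "y' \<in> U"
      using d \<kappa>\<rho> \<delta>_le[of y y] \<delta>_le[of y' y'] by (cases "y \<in> U", auto, cases "y' \<in> U", auto)
    obtain P where P: "connected P" "y \<in> P" "y' \<in> P" "P \<subseteq> U" "\<And>z. z \<in> P \<Longrightarrow> dist y z \<le> Au * dist y y'"
      "\<And>z. z \<in> P \<Longrightarrow> \<kappa> * \<rho> / (2 * Au) \<le> \<delta> z"
      using uniform_curve_deep[OF inU d \<kappa>\<rho>(1)] by metis
    have P\<delta>: "\<kappa>1 * \<rho> \<le> \<delta> z" if "z \<in> P" for z using P(6)[OF that] by (simp add: \<kappa>1_def)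
    have Pd: "dist y z \<le> Au * K * \<rho>" if "z \<in> P" for z
    proof -
      have "Au * dist y y' \<le> Au * (K * \<rho>)" by (rule mult_left_mono[OF yy]) (use Au in simp)
      then show ?thesis using P(5)[OF that] unfolding mult.assoc by linarith
    qed
    have \<kappa>1\<rho>: "\<kappa>1 * \<rho> \<le> \<kappa> * \<rho> / 2" "0 < \<kappa>1 * \<rho>" using mult_right_mono[OF \<kappa>1(2), of \<rho>] \<rho> \<kappa>1 by auto
    have sub: "ball z r \<subseteq> R" if z: "z \<in> P" "\<kappa>1 * \<rho> / 2 + r \<le> \<delta> z" "r \<le> \<rho>" for z r
    proof
      fix w assume w: "w \<in> ball z r"
      have "dist y w < (Au * K + 1) * \<rho>"
        using dist_triangle[of y w z] Pd[OF z(1)] w z(3) by (simp add: algebra_simps)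
      moreover have "\<kappa>1 * \<rho> / 2 < \<delta> w"
        using \<delta>_lipschitz[of z w] z(2) w by simp
      ultimately have "w \<in> deep_region (Au * K + 1) (\<kappa> / (4 * Au)) y \<rho>"
        by (simp add: deep_region_def \<kappa>1_def)
      then show "w \<in> R" using R by blast
    qed
    have Lam_le: "s \<le> Lam * s" if "0 \<le> s" for s using mult_right_mono[OF Lam that] by simp
    have tL: "t \<le> Lam * t" "t' \<le> Lam * t'" by (rule Lam_le, use h in linarith)+
    define T0 where "T0 = CP * \<Psi> \<rho> * measure \<nu> R"
    have T0: "0 \<le> T0" using CP \<Psi>_pos[OF \<rho>] by (simp add: T0_def)
    have ya: "Jp (ball y t) (\<lambda>x. f x - a) \<le> ennreal T0" unfolding T0_def
      by (rule osc_le[OF a(1) _ _ R(1) sub[OF P(2)]]; use t h d \<kappa>\<rho> \<kappa>1\<rho> tL in linarith)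
    have ya': "Jp (ball y' t') (\<lambda>x. f x - a') \<le> ennreal T0" unfolding T0_def
      by (rule osc_le[OF a(2) _ _ R(1) sub[OF P(3)]]; use t h d \<kappa>\<rho> \<kappa>1\<rho> tL in linarith)
    have "\<exists>b. osc z (3 * h) b" if "z \<in> P" for z
      by (rule osc_exists) (use h Lh P\<delta>[OF that] \<kappa>1\<rho> in \<open>auto intro!: ball_\<delta>_subset\<close>)
    then obtain b where b: "\<And>z. z \<in> P \<Longrightarrow> osc z (3 * h) (b z)" by metis
    have "3 * h \<le> Lam * (3 * h)" by (rule Lam_le) (use h in simp)
    then have h3: "3 * h \<le> \<rho>" using Lh h \<kappa>1\<rho> \<kappa>\<rho> by linarith
    have zb: "Jp (ball z (3 * h)) (\<lambda>x. f x - b z) \<le> ennreal T0" if z: "z \<in> P" for z unfolding T0_def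
      by (rule osc_le[OF b[OF z] _ h3 R(1) sub[OF z]]; use h Lh P\<delta>[OF z] \<kappa>1\<rho> \<kappa>\<rho> in linarith)
    obtain S where S: "S \<subseteq> P" "\<And>x y. x \<in> S \<Longrightarrow> y \<in> S \<Longrightarrow> x \<noteq> y \<Longrightarrow> min h h \<le> dist x y"
      "\<And>y. y \<in> P \<Longrightarrow> \<exists>x\<in>S. dist x y < h"
      by (rule separated_net_exists[of P "\<lambda>_. h"]) (use h in auto)
    have "lam * h = (Au * K + 1) * \<rho>" using lam(2) by (simp add: h_def mult.assoc[symmetric])
    then have lamh: "lam * h = Au * K * \<rho> + \<rho>" by (simp only: distrib_right mult_1)
    have AK\<rho>: "0 \<le> Au * K * \<rho>" using AK \<rho> by simp
    have "S \<subseteq> ball y (lam * h)"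
    proof
      fix z assume "z \<in> S"
      then have "dist y z \<le> Au * K * \<rho>" using Pd S(1) by blast
      then show "z \<in> ball y (lam * h)" using \<rho> lamh unfolding mem_ball by linarith
    qed
    then have Sfin: "finite S" "card S \<le> N"
      using packing_boundD[OF N h(1), of S y] S(2) by (auto simp: pairwise_def)
    define Q where "Q = 2 powr p * (2 * T0) * Cv / mb y \<rho>"
    have mbp: "0 < mb y \<rho>" by (rule mb_pos[OF \<rho>])
    have Q0: "0 \<le> Q" using T0 Cv(1) mbp by (simp add: Q_def)
    define D where "D = Q powr (1 / p)"
    have D0: "0 \<le> D" by (simp add: D_def)
    have DQ: "D powr p = Q" using Q0 p_pos by (simp add: D_def powr_powr)
    \<comment> \<open>Balls of controlled oscillation that share a mesh ball have constants at most
      \<open>D\<close> apart. \<open>D powr p\<close> contains the volume of the ball of radius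
      \<open>\<rho>\<close>, to which the volume of the mesh ball is comparable.\<close>
    have compare: "\<bar>c - c'\<bar> \<le> D"
      if "ball z h \<subseteq> B1" "ball z h \<subseteq> B2" "Jp B1 (\<lambda>x. f x - c) \<le> ennreal T0" "Jp B2 (\<lambda>x. f x - c') \<le> ennreal T0" "z \<in> P"
      for z c c' B1 B2
    proof -
      have le: "\<bar>c - c'\<bar> powr p * mb z h \<le> 2 powr p * (T0 + T0)"
        by (rule oscillation_compare[OF f_measurable _ that(1,2) emeasure_ball that(3,4) T0 T0]) simp
      have "\<rho> \<le> lam * h" using AK\<rho> lamh by linarith
      moreover have "dist y z \<le> lam * h" using Pd[OF that(5)] \<rho> lamh by linarith
      ultimately have "mb y \<rho> \<le> Cv * mb z h" using Cv(2)[OF h(1)] by blast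
      then have "\<bar>c - c'\<bar> powr p * mb y \<rho> \<le> \<bar>c - c'\<bar> powr p * (Cv * mb z h)"
        by (intro mult_left_mono) auto
      also have "\<dots> = Cv * (\<bar>c - c'\<bar> powr p * mb z h)" by simp
      also have "\<dots> \<le> Cv * (2 powr p * (T0 + T0))" using le Cv(1) by (intro mult_left_mono) auto
      finally have "\<bar>c - c'\<bar> powr p \<le> Q" using mbp by (simp add: Q_def field_simps)
      then have "\<bar>c - c'\<bar> powr p \<le> D powr p" using DQ by simp
      then show ?thesis using powr_less_mono2[OF p_pos D0, of "\<bar>c - c'\<bar>"] by force
    qed
    obtain z0 where z0: "z0 \<in> S" "dist z0 y < h" using S(3)[OF P(2)] by blast
    obtain z1 where z1: "z1 \<in> S" "dist z1 y' < h" using S(3)[OF P(3)] by blast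
    \<comment> \<open>The reason for radius \<open>3 * h\<close>: centres closer than two meshes
      still leave room for a whole mesh ball.\<close>
    have near: "ball w h \<subseteq> ball z (3 * h)" if "dist z w < 2 * h" for z w
    proof
      fix v assume "v \<in> ball w h"
      then show "v \<in> ball z (3 * h)" using dist_triangle[of z v w] that by simp
    qed
    have self: "ball w h \<subseteq> ball w (3 * h)" for w by (rule subset_ball) (use h in simp)
    have yt: "ball y h \<subseteq> ball y t" "ball y' h \<subseteq> ball y' t'" by (rule subset_ball, fact)+
    have n0: "ball y h \<subseteq> ball z0 (3 * h)" "ball y' h \<subseteq> ball z1 (3 * h)"
      by (rule near, use z0 z1 h in linarith)+
    define rel where "rel = {(z, z'). z \<in> S \<and> z' \<in> S \<and> dist z z' < 2 * h}"
    have relS: "rel \<subseteq> S \<times> S" by (auto simp: rel_def)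
    then have relf: "finite rel" "card rel \<le> N * N"
      using Sfin finite_subset[OF relS] card_mono[OF _ relS] mult_le_mono[OF Sfin(2) Sfin(2)]
      by (auto simp: card_cartesian_product)
    have "\<bar>b z0 - b z1\<bar> \<le> card rel * D"
    proof (rule rtrancl_oscillation_bound[OF relf(1) _ _ D0])
      show "(z0, z1) \<in> rel\<^sup>*" unfolding rel_def
        by (rule connected_net_chain[OF P(1) S(1) _ z0(1) z1(1) h(1)]) (use S(3) in force)
      fix z z' assume "(z, z') \<in> rel"
      then have z: "z \<in> S" "z' \<in> S" "dist z z' < 2 * h" by (auto simp: rel_def)
      show "\<bar>b z - b z'\<bar> \<le> D"
        by (rule compare[of z' "ball z (3 * h)" "ball z' (3 * h)"]) (use z zb S(1) near[OF z(3)] self in blast)+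
    qed
    also have "\<dots> \<le> real (N * N) * D" using relf D0 by (intro mult_right_mono of_nat_mono) auto
    finally have 1: "\<bar>b z0 - b z1\<bar> \<le> real (N * N) * D" .
    have 2: "\<bar>a - b z0\<bar> \<le> D"
      by (rule compare[of y "ball y t" "ball z0 (3 * h)"]) (use ya zb z0 S(1) yt n0 P(2) in blast)+
    have 3: "\<bar>a' - b z1\<bar> \<le> D"
      by (rule compare[of y' "ball y' t'" "ball z1 (3 * h)"]) (use ya' zb z1 S(1) yt n0 P(3) in blast)+
    have "\<bar>a - a'\<bar> \<le> (real (N * N) + 2) * D" using 1 2 3 by (simp add: algebra_simps)
    then have "\<bar>a - a'\<bar> powr p \<le> ((real (N * N) + 2) * D) powr p" using p_pos by (intro powr_mono2) auto
    also have "\<dots> = (real (N * N) + 2) powr p * Q" using DQ by (simp add: powr_mult)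
    finally have "\<bar>a - a'\<bar> powr p * mb y \<rho> \<le> (real (N * N) + 2) powr p * Q * mb y \<rho>"
      using mbp by (intro mult_right_mono) auto
    also have "\<dots> = C * \<Psi> \<rho> * measure \<nu> R"
      using mbp by (simp add: Q_def C_def T0_def)
    finally show "\<bar>a - a'\<bar> powr p * mb y \<rho> \<le> C * \<Psi> \<rho> * measure \<nu> R" .
  qed
  then show thesis by (rule that)
qed

text \<open>Compares \<open>a\<close> with the constant 0, for which the integral of
  \<open>\<bar>f\<bar> powr p\<close> replaces the Poincare bound. It serves the coefficients next
  to a vanishing one and the p-norm of the approximants.\<close>

lemma mean_bound:
  assumes vc: "volume_comparable lam Cv" and lam: "1 \<le> lam * \<sigma>" and \<sigma>: "0 < \<sigma>"
    and \<rho>: "0 < \<rho>" and t: "\<sigma> * \<rho> \<le> t" "t \<le> \<rho>" and a: "osc y t a" and sub: "ball y (Lam * t) \<subseteq> U \<inter> R"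
    and R: "R \<in> sets borel"
  shows "\<bar>a\<bar> powr p * mb y \<rho> \<le> 2 powr p * Cv * (CP * \<Psi> \<rho> + 1) * measure \<nu> R"
proof -
  note Cv = volume_comparableD[OF vc]
  have "0 < \<sigma> * \<rho>" using \<sigma> \<rho> by simp
  then have t0: "0 < t" using t by linarith
  have s: "ball y t \<subseteq> ball y (Lam * t)" using mult_right_mono[OF Lam, of t] t0 by (intro subset_ball) auto
  have 1: "Jp (ball y t) (\<lambda>x. f x - a) \<le> ennreal (CP * \<Psi> \<rho> * measure \<nu> R)"
    by (rule osc_le[OF a t0 t(2) R]) (use sub in auto)
  have "Jp (ball y t) f \<le> ennreal (measure \<nu> (ball y t))" by (rule Jp_f) (use s sub in auto)
  also have "\<dots> \<le> ennreal (measure \<nu> R)"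
    using s sub R by (intro ennreal_leI \<nu>.finite_measure_mono) (auto simp: sets_\<nu>)
  finally have 2: "Jp (ball y t) (\<lambda>x. f x - 0) \<le> ennreal (measure \<nu> R)" by simp
  have "\<bar>a - 0\<bar> powr p * mb y t \<le> 2 powr p * (CP * \<Psi> \<rho> * measure \<nu> R + measure \<nu> R)"
    by (rule oscillation_compare[OF f_measurable _ _ _ emeasure_ball 1 2]) (use CP \<Psi>_pos[OF \<rho>] in auto)
  then have le: "\<bar>a\<bar> powr p * mb y t \<le> 2 powr p * (CP * \<Psi> \<rho> + 1) * measure \<nu> R"
    by (simp add: algebra_simps)
  have "\<rho> \<le> lam * t"
  proof -
    have "0 < lam" using lam \<sigma> by (smt (verit) mult_nonneg_nonneg mult_nonpos_nonneg)
    have "1 * \<rho> \<le> lam * \<sigma> * \<rho>" using lam \<rho> by (intro mult_right_mono) auto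
    also have "\<dots> \<le> lam * t" using t(1) \<open>0 < lam\<close> by (simp add: mult.assoc)
    finally show ?thesis by simp
  qed
  then have "mb y \<rho> \<le> Cv * mb y t" using Cv(2)[OF t0, of y y \<rho>] \<rho> by simp
  then have "\<bar>a\<bar> powr p * mb y \<rho> \<le> \<bar>a\<bar> powr p * (Cv * mb y t)" by (intro mult_left_mono) auto
  also have "\<dots> = Cv * (\<bar>a\<bar> powr p * mb y t)" by simp
  also have "\<dots> \<le> Cv * (2 powr p * (CP * \<Psi> \<rho> + 1) * measure \<nu> R)"
    using le Cv(1) by (intro mult_left_mono) auto
  finally show ?thesis by (simp add: mult_ac)
qed

end

section \<open>Partitions of unity\<close>

text \<open>In index order each summand is the increase of the running maximum; adding an element of
  largest index leaves the earlier summands unchanged.\<close>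

lemma sum_positive_increments_Max:
  fixes g :: "'b \<Rightarrow> real" and idx :: "'b \<Rightarrow> nat"
  assumes "finite I" "inj_on idx I"
  shows "(\<Sum>i\<in>I. max 0 (g i - Max (insert 0 (g ` {j\<in>I. idx j < idx i})))) = Max (insert 0 (g ` I))"
  using assms
proof (induction I rule: finite_ranking_induct[where f=idx])
  case (insert b A)
  show ?case
  proof (cases "b \<in> A")
    case True
    then show ?thesis using insert by (simp add: insert_absorb)
  next
    case False
    have lt: "idx a < idx b" if "a \<in> A" for a
    proof -
      have "idx a \<noteq> idx b" using insert.prems that False by (auto simp: inj_on_def)
      then show ?thesis using insert.hyps(2)[OF that] by simp
    qed
    have A: "{j \<in> insert b A. idx j < idx i} = {j \<in> A. idx j < idx i}" if "i \<in> A" for i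
      using lt[OF that] by auto
    have B: "{j \<in> insert b A. idx j < idx b} = A"
      using lt by auto
    have "(\<Sum>i\<in>insert b A. max 0 (g i - Max (insert 0 (g ` {j\<in>insert b A. idx j < idx i}))))
        = max 0 (g b - Max (insert 0 (g ` A))) + (\<Sum>i\<in>A. max 0 (g i - Max (insert 0 (g ` {j\<in>A. idx j < idx i}))))"
      by (subst sum.insert[OF insert.hyps(1) False]) (simp only: B A cong: sum.cong)
    also have "\<dots> = max 0 (g b - Max (insert 0 (g ` A))) + Max (insert 0 (g ` A))"
      using insert by (simp add: inj_on_def)
    also have "\<dots> = max (g b) (Max (insert 0 (g ` A)))" by (simp add: max_def)
    also have "\<dots> = Max (insert (g b) (insert 0 (g ` A)))"
      using insert.hyps(1) by (intro Max_insert[symmetric]) auto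
    also have "insert (g b) (insert 0 (g ` A)) = insert 0 (g ` insert b A)" by auto
    finally show ?thesis .
  qed
qed simp

context uniform_extension
begin

text \<open>The Lipschitz constant is small enough for radii of adjacent centres to differ by a
  factor of at most 2. The upper bound makes cutoffs available, the lower one makes nets locally
  finite.\<close>

definition radius_fun :: "('a \<Rightarrow> real) \<Rightarrow> real \<Rightarrow> bool" where
  "radius_fun \<rho> r \<longleftrightarrow> 0 < r \<and> (\<forall>x. r \<le> \<rho> x \<and> \<rho> x \<le> Rcap) \<and> (\<forall>x y. \<rho> x \<le> \<rho> y + dist x y / (4 * A1))"

definition net :: "('a \<Rightarrow> real) \<Rightarrow> 'a set \<Rightarrow> bool" where
  "net \<rho> S \<longleftrightarrow> (\<forall>x\<in>S. \<forall>y\<in>S. x \<noteq> y \<longrightarrow> min (\<rho> x) (\<rho> y) \<le> dist x y) \<and> (\<forall>y. \<exists>x\<in>S. dist x y < \<rho> x)"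

text \<open>A cutoff at \<open>i\<close> vanishes off the ball of radius
  \<open>A1 * \<rho> i\<close>, so cutoffs at non-adjacent centres are never both nonzero.\<close>

definition adjacent :: "('a \<Rightarrow> real) \<Rightarrow> 'a \<Rightarrow> 'a \<Rightarrow> bool" where
  "adjacent \<rho> i k \<longleftrightarrow> dist i k < A1 * (\<rho> i + \<rho> k)"

definition nbr :: "('a \<Rightarrow> real) \<Rightarrow> 'a set \<Rightarrow> 'a \<Rightarrow> 'a set" where
  "nbr \<rho> S k = {i\<in>S. adjacent \<rho> i k}"

text \<open>The order of the energy of a cutoff for the ball of radius
  \<open>\<rho> k\<close>.\<close>

definition weight :: "('a \<Rightarrow> real) \<Rightarrow> 'a \<Rightarrow> real" where
  "weight \<rho> k = mb k (\<rho> k) / \<Psi> (\<rho> k)"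

lemma radius_funD:
  assumes "radius_fun \<rho> r"
  shows "0 < r" "r \<le> \<rho> x" "\<rho> x \<le> Rcap" "0 < \<rho> x" "\<rho> x \<le> \<rho> y + dist x y / (4 * A1)"
proof -
  show "0 < r" "r \<le> \<rho> x" "\<rho> x \<le> Rcap" "\<rho> x \<le> \<rho> y + dist x y / (4 * A1)"
    using assms unfolding radius_fun_def by blast+
  then show "0 < \<rho> x" by linarith
qed

lemma netD:
  assumes "net \<rho> S"
  shows "x \<in> S \<Longrightarrow> y \<in> S \<Longrightarrow> x \<noteq> y \<Longrightarrow> min (\<rho> x) (\<rho> y) \<le> dist x y" "\<exists>x\<in>S. dist x y < \<rho> x"
  using assms unfolding net_def by blast+

lemma net_exists:
  assumes "radius_fun \<rho> r"
  obtains S where "net \<rho> S"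
proof -
  obtain S where "S \<subseteq> UNIV" "\<And>x y. x \<in> S \<Longrightarrow> y \<in> S \<Longrightarrow> x \<noteq> y \<Longrightarrow> min (\<rho> x) (\<rho> y) \<le> dist x y"
    "\<And>y. y \<in> UNIV \<Longrightarrow> \<exists>x\<in>S. dist x y < \<rho> x"
    using separated_net_exists[of UNIV \<rho>] radius_funD(4)[OF assms] by metis
  then have "net \<rho> S" unfolding net_def by simp
  then show thesis by (rule that)
qed

lemma adjacent_sym: "adjacent \<rho> i k \<longleftrightarrow> adjacent \<rho> k i"
  by (simp add: adjacent_def dist_commute add.commute)

lemma adjacent_radius:
  assumes "radius_fun \<rho> r" "adjacent \<rho> i k"
  shows "\<rho> i \<le> 2 * \<rho> k"
proof -
  have "dist i k / (4 * A1) \<le> (\<rho> i + \<rho> k) / 4"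
    using assms(2) A1 by (simp add: adjacent_def field_simps)
  then have "\<rho> i \<le> \<rho> k + (\<rho> i + \<rho> k) / 4" using radius_funD(5)[OF assms(1), of i k] by linarith
  then show ?thesis using radius_funD(4)[OF assms(1), of k] radius_funD(4)[OF assms(1), of i] by (simp add: field_simps)
qed

lemma adjacent_dist:
  assumes "radius_fun \<rho> r" "adjacent \<rho> i k"
  shows "dist i k < 3 * A1 * \<rho> k"
proof -
  have "A1 * (\<rho> i + \<rho> k) \<le> A1 * (3 * \<rho> k)"
    using adjacent_radius[OF assms] A1 by (intro mult_left_mono) auto
  then show ?thesis using assms(2) by (simp add: adjacent_def)
qed

definition nbr_bound :: "nat \<Rightarrow> bool" where
  "nbr_bound N \<longleftrightarrow> (\<forall>\<rho> r S k. radius_fun \<rho> r \<and> net \<rho> S \<longrightarrow> finite (nbr \<rho> S k) \<and> card (nbr \<rho> S k) \<le> N)"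

text \<open>Neighbours of \<open>k\<close> lie within \<open>3 * A1 * \<rho> k\<close> and, having
  radii at least \<open>\<rho> k / 2\<close>, are separated by that amount; the packing bound is
  free of \<open>\<rho>\<close> and \<open>S\<close>.\<close>

lemma nbr_bound_exists:
  obtains N where "nbr_bound N"
proof -
  obtain N where N: "packing_bound (6 * A1) N" by (rule packing_bound_exists[of "6 * A1"]) (use A1 in auto)
  have "nbr_bound N"
    unfolding nbr_bound_def
  proof (intro allI impI; elim conjE)
    fix \<rho> r S k assume \<rho>: "radius_fun \<rho> r" and S: "net \<rho> S"
    have pos: "0 < \<rho> k / 2" using radius_funD(4)[OF \<rho>, of k] by simp
    have "nbr \<rho> S k \<subseteq> ball k (6 * A1 * (\<rho> k / 2))"
    proof
      fix x assume "x \<in> nbr \<rho> S k"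
      then have "dist x k < 3 * A1 * \<rho> k" using adjacent_dist[OF \<rho>] by (simp add: nbr_def)
      then show "x \<in> ball k (6 * A1 * (\<rho> k / 2))" by (simp add: dist_commute mult.assoc)
    qed
    moreover have "pairwise (\<lambda>x y. \<rho> k / 2 \<le> dist x y) (nbr \<rho> S k)"
      unfolding pairwise_def
    proof (intro ballI impI)
      fix x y assume xy: "x \<in> nbr \<rho> S k" "y \<in> nbr \<rho> S k" "x \<noteq> y"
      then have "min (\<rho> x) (\<rho> y) \<le> dist x y" by (intro netD(1)[OF S]) (auto simp: nbr_def)
      moreover have "\<rho> k \<le> 2 * \<rho> x" "\<rho> k \<le> 2 * \<rho> y"
        using xy adjacent_radius[OF \<rho>] adjacent_sym by (auto simp: nbr_def)
      ultimately show "\<rho> k / 2 \<le> dist x y" by linarith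
    qed
    ultimately show "finite (nbr \<rho> S k) \<and> card (nbr \<rho> S k) \<le> N"
      using packing_boundD[OF N pos] by blast
  qed
  then show thesis by (rule that)
qed

lemma nbr_boundD:
  assumes "nbr_bound N" "radius_fun \<rho> r" "net \<rho> S"
  shows "finite (nbr \<rho> S k)" "card (nbr \<rho> S k) \<le> N"
  using assms unfolding nbr_bound_def by blast+

definition weight_comparable :: "real \<Rightarrow> bool" where
  "weight_comparable C \<longleftrightarrow> 1 \<le> C \<and> (\<forall>\<rho> r i k. radius_fun \<rho> r \<and> adjacent \<rho> i k \<longrightarrow>
     weight \<rho> i \<le> C * weight \<rho> k \<and> mb i (\<rho> i) \<le> C * mb k (\<rho> k))"

lemma weight_comparableD:
  assumes "weight_comparable C"
  shows "1 \<le> C" "radius_fun \<rho> r \<Longrightarrow> adjacent \<rho> i k \<Longrightarrow> weight \<rho> i \<le> C * weight \<rho> k"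
    "radius_fun \<rho> r \<Longrightarrow> adjacent \<rho> i k \<Longrightarrow> mb i (\<rho> i) \<le> C * mb k (\<rho> k)"
  using assms unfolding weight_comparable_def by blast+

lemma weight_nonneg: "radius_fun \<rho> r \<Longrightarrow> 0 \<le> weight \<rho> k"
  using \<Psi>_pos radius_funD(4) by (simp add: weight_def order_less_imp_le)

lemma weight_comparable_exists:
  obtains C where "weight_comparable C"
proof -
  obtain Cv where "volume_comparable (3 * A1) Cv" by (rule volume_comparable_exists)
  note Cv = volume_comparableD[OF this]
  obtain Cs where "scale_comparable \<Psi> 2 Cs" by (rule scale_comparable_exists[OF scale, of 2]) simp
  note Cs = scale_comparableD[OF this]
  have CC: "1 \<le> Cv * Cs" "Cv \<le> Cv * Cs" using Cv(1) Cs(1) mult_mono[of 1 Cv 1 Cs] mult_left_mono[of 1 Cs Cv] by auto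
  have "weight_comparable (Cv * Cs)"
    unfolding weight_comparable_def
  proof (intro conjI CC allI impI; elim conjE)
    fix \<rho> r i k assume \<rho>: "radius_fun \<rho> r" and ik: "adjacent \<rho> i k"
    have pos: "0 < \<rho> i" "0 < \<rho> k" using radius_funD(4)[OF \<rho>] by auto
    have rad: "\<rho> i \<le> 2 * \<rho> k" "\<rho> k \<le> 2 * \<rho> i"
      using adjacent_radius[OF \<rho>] ik adjacent_sym by auto
    have "2 * \<rho> k \<le> 3 * A1 * \<rho> k" using A1 pos by (intro mult_right_mono) auto
    then have 1: "mb i (\<rho> i) \<le> Cv * mb k (\<rho> k)"
      using adjacent_dist[OF \<rho> ik] rad by (intro Cv(2)[OF pos(2)]) auto
    have "0 \<le> mb k (\<rho> k)" by simp
    then show "mb i (\<rho> i) \<le> Cv * Cs * mb k (\<rho> k)"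
      using 1 mult_right_mono[OF CC(2), of "mb k (\<rho> k)"] by linarith
    have 2: "\<Psi> (\<rho> k) \<le> Cs * \<Psi> (\<rho> i)" using Cs(2)[of "\<rho> i" "\<rho> k"] rad pos by simp
    have P: "0 < \<Psi> (\<rho> i)" "0 < \<Psi> (\<rho> k)" using \<Psi>_pos pos by auto
    have "mb i (\<rho> i) * \<Psi> (\<rho> k) \<le> (Cv * mb k (\<rho> k)) * (Cs * \<Psi> (\<rho> i))"
      using 1 2 P Cv(1) by (intro mult_mono) auto
    then show "weight \<rho> i \<le> Cv * Cs * weight \<rho> k"
      using P by (simp add: weight_def field_simps)
  qed
  then show thesis by (rule that)
qed

text \<open>The function from the capacity bound is truncated to the unit interval and changed on a
  null set, which saturation of \<open>\<F>\<close> permits. Its values then hold at every point, as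
  the later pointwise sums require.\<close>

lemma ball_cutoff:
  assumes R: "0 < R" "R \<le> Rcap"
  obtains \<phi> where "\<phi> \<in> \<F>" "\<And>x. 0 \<le> \<phi> x" "\<And>x. \<phi> x \<le> 1" "\<And>x. dist k x < R \<Longrightarrow> \<phi> x = 1"
    "\<And>x. A1 * R \<le> dist k x \<Longrightarrow> \<phi> x = 0" "eN \<phi> \<le> (Ccap * mb k R / \<Psi> R) powr (1 / p)"
proof -
  obtain u where u: "u \<in> \<F>" "AE y in m. y \<in> ball k R \<longrightarrow> u y = 1" "AE y in m. y \<notin> ball k (A1 * R) \<longrightarrow> u y = 0"
    "\<E> u \<le> Ccap * mb k R / \<Psi> R"
    using capacity[OF R, of k] by blast
  define v where "v x = max 0 (min 1 (u x))" for x
  have v: "v \<in> \<F>" "eN v \<le> eN u"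
    unfolding v_def by (rule F_lipschitz[OF u(1), of "\<lambda>t. max 0 (min 1 t)"]; auto)+
  define \<phi> where "\<phi> x = (if dist k x < R then 1 else if A1 * R \<le> dist k x then 0 else v x)" for x
  have [measurable]: "v \<in> borel_measurable borel" using F_measurable[OF v(1)] .
  have m: "\<phi> \<in> borel_measurable borel" unfolding \<phi>_def by measurable
  have AR: "R < A1 * R" using A1 R by simp
  have ae: "AE x in m. v x = \<phi> x"
    using u(2,3)
  proof eventually_elim
    fix x assume "x \<in> ball k R \<longrightarrow> u x = 1" "x \<notin> ball k (A1 * R) \<longrightarrow> u x = 0"
    then show "v x = \<phi> x" by (auto simp: v_def \<phi>_def)
  qed
  note c = F_cong[OF v(1) m ae]
  show thesis
  proof (rule that[OF c(1)])
    have "eN \<phi> \<le> eN u" using c(2) v(2) by simp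
    also have "\<dots> \<le> (Ccap * mb k R / \<Psi> R) powr (1 / p)"
      using u(4) E_nonneg[OF u(1)] p_pos by (intro powr_mono2) auto
    finally show "eN \<phi> \<le> (Ccap * mb k R / \<Psi> R) powr (1 / p)" .
  qed (use AR in \<open>auto simp: \<phi>_def v_def\<close>)
qed

lemma net_countable:
  assumes \<rho>: "radius_fun \<rho> r" and S: "net \<rho> S"
  shows "finite (S \<inter> ball x L)" "countable S"
proof -
  note r = radius_funD(1)[OF \<rho>]
  show fin: "finite (S \<inter> ball x L)" for x L
  proof -
    define lam where "lam = \<bar>L\<bar> / r + 1"
    have lam: "0 < lam" unfolding lam_def using r by (intro add_nonneg_pos) auto
    obtain N where N: "packing_bound lam N" by (rule packing_bound_exists[OF lam])
    have "lam * r = \<bar>L\<bar> + r" using r by (simp add: lam_def field_simps)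
    then have "S \<inter> ball x L \<subseteq> ball x (lam * r)" using r by auto
    moreover have "pairwise (\<lambda>x y. r \<le> dist x y) (S \<inter> ball x L)"
      unfolding pairwise_def
    proof (intro ballI impI)
      fix y z assume yz: "y \<in> S \<inter> ball x L" "z \<in> S \<inter> ball x L" "y \<noteq> z"
      then have "min (\<rho> y) (\<rho> z) \<le> dist y z" by (intro netD(1)[OF S]) auto
      then show "r \<le> dist y z" using radius_funD(2)[OF \<rho>, of y] radius_funD(2)[OF \<rho>, of z] by linarith
    qed
    ultimately show ?thesis by (rule packing_boundD(1)[OF N r])
  qed
  have "S = (\<Union>n. S \<inter> ball x (real n))"
  proof -
    have "\<exists>n. dist x y < real n" for y using reals_Archimedean2 by blast
    then show ?thesis by auto
  qed
  moreover have "countable (\<Union>n. S \<inter> ball x (real n))"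
    by (intro countable_UN) (auto intro: countable_finite fin)
  ultimately show "countable S" by simp
qed

text \<open>\<open>S\<close> may be infinite, so the total is stated ball by ball over the finite
  neighbour sets.\<close>

definition partition_of_unity :: "('a \<Rightarrow> real) \<Rightarrow> 'a set \<Rightarrow> ('a \<Rightarrow> 'a \<Rightarrow> real) \<Rightarrow> real \<Rightarrow> bool" where
  "partition_of_unity \<rho> S \<psi> C \<longleftrightarrow> (\<forall>i\<in>S. \<psi> i \<in> \<F>) \<and> (\<forall>i\<in>S. \<forall>x. 0 \<le> \<psi> i x) \<and>
     (\<forall>k\<in>S. \<forall>x. dist k x < \<rho> k \<longrightarrow> (\<Sum>i\<in>nbr \<rho> S k. \<psi> i x) = 1) \<and>
     (\<forall>k\<in>S. \<forall>x. dist k x < \<rho> k \<longrightarrow> (\<forall>i\<in>S. i \<notin> nbr \<rho> S k \<longrightarrow> \<psi> i x = 0)) \<and>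
     (\<forall>k\<in>S. \<forall>i\<in>nbr \<rho> S k. eN (\<psi> i) \<le> C * weight \<rho> k powr (1 / p))"

lemma partition_of_unityD:
  assumes "partition_of_unity \<rho> S \<psi> C"
  shows "i \<in> S \<Longrightarrow> \<psi> i \<in> \<F>" "i \<in> S \<Longrightarrow> 0 \<le> \<psi> i x"
    "k \<in> S \<Longrightarrow> dist k x < \<rho> k \<Longrightarrow> (\<Sum>i\<in>nbr \<rho> S k. \<psi> i x) = 1"
    "k \<in> S \<Longrightarrow> dist k x < \<rho> k \<Longrightarrow> i \<in> S \<Longrightarrow> i \<notin> nbr \<rho> S k \<Longrightarrow> \<psi> i x = 0"
    "k \<in> S \<Longrightarrow> i \<in> nbr \<rho> S k \<Longrightarrow> eN (\<psi> i) \<le> C * weight \<rho> k powr (1 / p)"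
  using assms unfolding partition_of_unity_def by blast+

text \<open>Without a Leibniz rule the cutoffs cannot be normalised by division.  Instead, the increments of the
  running maxima of an enumeration of the cutoffs are used: they telescope to the total maximum, which is 1.\<close>

lemma partition_of_unity_exists:
  obtains C where "0 \<le> C" "\<forall>\<rho> r S. radius_fun \<rho> r \<and> net \<rho> S \<longrightarrow> (\<exists>\<psi>. partition_of_unity \<rho> S \<psi> C)"
proof -
  obtain N where N: "nbr_bound N" by (rule nbr_bound_exists)
  obtain Cw where Cwc: "weight_comparable Cw" by (rule weight_comparable_exists)
  note Cw = weight_comparableD[OF Cwc]
  \<comment> \<open>\<open>real N + 1\<close> counts a cutoff and its earlier neighbours; weights
    are transported twice, from \<open>j\<close> to \<open>i\<close> and from \<open>i\<close> to
    \<open>k\<close>.\<close>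
  define C where "C = (real N + 1) * (Ccap * (Cw * Cw)) powr (1 / p)"
  have C0: "0 \<le> C" by (simp add: C_def)
  have "\<exists>\<psi>. partition_of_unity \<rho> S \<psi> C" if \<rho>: "radius_fun \<rho> r" and S: "net \<rho> S" for \<rho> r S
  proof -
    note \<rho>D = radius_funD[OF \<rho>]
    note nb = nbr_boundD[OF N \<rho> S]
    have "\<exists>\<phi>. \<phi> \<in> \<F> \<and> (\<forall>x. 0 \<le> \<phi> x) \<and> (\<forall>x. \<phi> x \<le> 1) \<and> (\<forall>x. dist k x < \<rho> k \<longrightarrow> \<phi> x = 1) \<and>
       (\<forall>x. A1 * \<rho> k \<le> dist k x \<longrightarrow> \<phi> x = 0) \<and> eN \<phi> \<le> (Ccap * weight \<rho> k) powr (1 / p)" for k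
      by (rule ball_cutoff[OF \<rho>D(4)[of k] \<rho>D(3)[of k], of k], rule exI) (auto simp: weight_def)
    then obtain \<phi> where \<phi>: "\<And>k. \<phi> k \<in> \<F>" "\<And>k x. 0 \<le> \<phi> k x" "\<And>k x. \<phi> k x \<le> 1" "\<And>k x. dist k x < \<rho> k \<Longrightarrow> \<phi> k x = 1"
      "\<And>k x. A1 * \<rho> k \<le> dist k x \<Longrightarrow> \<phi> k x = 0" "\<And>k. eN (\<phi> k) \<le> (Ccap * weight \<rho> k) powr (1 / p)"
      by metis
    define idx where "idx = to_nat_on S"
    have idx: "inj_on idx S" unfolding idx_def by (rule inj_on_to_nat_on[OF net_countable(2)[OF \<rho> S]])
    \<comment> \<open>Only earlier neighbours enter the running maximum, which keeps it finite and
      of bounded energy; the other earlier cutoffs vanish wherever \<open>\<phi> i\<close> does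
      not.\<close>
    define Pr where "Pr i = {j\<in>nbr \<rho> S i. idx j < idx i}" for i
    define M where "M i x = Max (insert 0 ((\<lambda>j. \<phi> j x) ` Pr i))" for i x
    have Prf: "finite (Pr i)" for i using nb(1)[of i] by (simp add: Pr_def)
    have MF: "M i \<in> \<F>" and ME: "eN (M i) \<le> (\<Sum>j\<in>Pr i. eN (\<phi> j))" for i
      using F_Max[of "Pr i" \<phi>] Prf \<phi>(1) unfolding M_def by auto
    have M0: "0 \<le> M i x" for i x unfolding M_def using Prf by (intro Max_ge) auto
    define \<psi> where "\<psi> i x = max 0 (\<phi> i x - M i x)" for i x
    have d: "(\<lambda>x. \<phi> i x - M i x) \<in> \<F>" for i using F_diff[OF \<phi>(1) MF] .
    have \<psi>F: "\<psi> i \<in> \<F>" for i unfolding \<psi>_def using F_pos(1)[OF d] .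
    have \<psi>0: "\<psi> i x = 0" if "\<phi> i x = 0" for i x using that M0[of i x] by (simp add: \<psi>_def)
    have meet: "adjacent \<rho> i j" if "\<phi> i x \<noteq> 0" "\<phi> j x \<noteq> 0" for i j x
    proof -
      have "dist i x < A1 * \<rho> i" "dist j x < A1 * \<rho> j" using that \<phi>(5) by (meson not_le)+
      then show ?thesis using dist_triangle2[of i j x] by (simp add: adjacent_def distrib_left)
    qed
    have \<psi>E: "eN (\<psi> i) \<le> C * weight \<rho> k powr (1 / p)" if k: "k \<in> S" and i: "i \<in> nbr \<rho> S k" for i k
    proof -
      have ik: "adjacent \<rho> i k" using i by (simp add: nbr_def)
      define B where "B = (Ccap * (Cw * Cw * weight \<rho> k)) powr (1 / p)"
      have wi: "weight \<rho> i \<le> Cw * weight \<rho> k" by (rule Cw(2)[OF \<rho> ik])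
      have le: "eN (\<phi> j) \<le> B" if j: "weight \<rho> j \<le> Cw * weight \<rho> i" for j
      proof -
        have "weight \<rho> j \<le> Cw * (Cw * weight \<rho> k)"
          using j mult_left_mono[OF wi, of Cw] Cw(1) by linarith
        then have "Ccap * weight \<rho> j \<le> Ccap * (Cw * Cw * weight \<rho> k)" using Ccap by simp
        then have "(Ccap * weight \<rho> j) powr (1 / p) \<le> B"
          unfolding B_def using p_pos Ccap weight_nonneg[OF \<rho>, of j] by (intro powr_mono2) auto
        then show ?thesis using \<phi>(6)[of j] by linarith
      qed
      have "eN (\<psi> i) \<le> eN (\<lambda>x. \<phi> i x - M i x)" unfolding \<psi>_def using F_pos(2)[OF d] .
      also have "\<dots> \<le> eN (\<phi> i) + eN (M i)" by (rule seminorm_on_diff[OF F_subspace E_seminorm \<phi>(1) MF])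
      also have "\<dots> \<le> B + (\<Sum>j\<in>Pr i. B)"
      proof (rule add_mono)
        have "1 * weight \<rho> i \<le> Cw * weight \<rho> i" using Cw(1) weight_nonneg[OF \<rho>] by (intro mult_right_mono) auto
        then show "eN (\<phi> i) \<le> B" by (intro le) simp
        have "eN (\<phi> j) \<le> B" if "j \<in> Pr i" for j
          by (rule le, rule Cw(2)[OF \<rho>]) (use that in \<open>simp add: Pr_def nbr_def\<close>)
        then show "eN (M i) \<le> (\<Sum>j\<in>Pr i. B)" using ME[of i] sum_mono[of "Pr i" "\<lambda>j. eN (\<phi> j)" "\<lambda>_. B"] by simp
      qed
      also have "\<dots> = (real (card (Pr i)) + 1) * B" by (simp add: algebra_simps)
      also have "\<dots> \<le> (real N + 1) * B"
      proof (intro mult_right_mono add_mono)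
        have "card (Pr i) \<le> card (nbr \<rho> S i)" using nb(1)[of i] by (intro card_mono) (auto simp: Pr_def)
        then show "real (card (Pr i)) \<le> real N" using nb(2)[of i] by linarith
      qed (auto simp: B_def)
      also have "B = (Ccap * (Cw * Cw)) powr (1 / p) * weight \<rho> k powr (1 / p)"
        unfolding B_def using powr_mult[of "Ccap * (Cw * Cw)" "weight \<rho> k"] by (simp add: mult.assoc)
      finally show ?thesis by (simp add: C_def mult.assoc)
    qed
    have outside: "\<psi> i x = 0" if "k \<in> S" "dist k x < \<rho> k" "i \<in> S" "i \<notin> nbr \<rho> S k" for k i x
    proof (rule \<psi>0, rule ccontr)
      assume "\<phi> i x \<noteq> 0"
      moreover have "\<phi> k x \<noteq> 0" using \<phi>(4)[OF that(2)] by simp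
      ultimately have "adjacent \<rho> i k" by (rule meet)
      then show False using that by (simp add: nbr_def)
    qed
    have total: "(\<Sum>i\<in>nbr \<rho> S k. \<psi> i x) = 1" if k: "k \<in> S" and x: "dist k x < \<rho> k" for k x
    proof -
      \<comment> \<open>At a fixed \<open>x\<close> only finitely many cutoffs are nonzero, and
        these are pairwise adjacent; hence on \<open>I\<close> the restricted maxima equal those
        over all earlier members of \<open>I\<close>, and the increments telescope.\<close>
      define I where "I = {i\<in>nbr \<rho> S k. \<phi> i x \<noteq> 0}"
      have If: "finite I" using nb(1)[of k] by (simp add: I_def)
      have IS: "I \<subseteq> S" by (auto simp: I_def nbr_def)
      have \<phi>k: "\<phi> k x = 1" using \<phi>(4)[OF x] .
      have kI: "k \<in> I" using k \<phi>k meet[of k x k] by (simp add: I_def nbr_def)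
      have "(\<Sum>i\<in>nbr \<rho> S k. \<psi> i x) = (\<Sum>i\<in>I. \<psi> i x)"
        by (rule sum.mono_neutral_right) (use nb(1)[of k] \<psi>0 in \<open>auto simp: I_def\<close>)
      also have "\<dots> = (\<Sum>i\<in>I. max 0 (\<phi> i x - Max (insert 0 ((\<lambda>i. \<phi> i x) ` {j\<in>I. idx j < idx i}))))"
      proof (rule sum.cong[OF refl])
        fix i assume i: "i \<in> I"
        have "insert 0 ((\<lambda>j. \<phi> j x) ` Pr i) = insert 0 ((\<lambda>i. \<phi> i x) ` {j\<in>I. idx j < idx i})"
        proof (intro equalityI subsetI)
          fix t assume "t \<in> insert 0 ((\<lambda>j. \<phi> j x) ` Pr i)"
          then consider "t = 0" | j where "j \<in> Pr i" "t = \<phi> j x" "t \<noteq> 0" by blast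
          then show "t \<in> insert 0 ((\<lambda>i. \<phi> i x) ` {j\<in>I. idx j < idx i})"
          proof cases
            case 2
            then have "j \<in> I" using meet[of j x k] \<phi>k by (auto simp: I_def nbr_def Pr_def)
            then show ?thesis using 2 by (auto simp: Pr_def)
          qed simp
        next
          fix t assume "t \<in> insert 0 ((\<lambda>i. \<phi> i x) ` {j\<in>I. idx j < idx i})"
          then consider "t = 0" | j where "j \<in> I" "idx j < idx i" "t = \<phi> j x" by blast
          then show "t \<in> insert 0 ((\<lambda>j. \<phi> j x) ` Pr i)"
          proof cases
            case 2
            then have "j \<in> Pr i" using meet[of j x i] i by (auto simp: I_def nbr_def Pr_def)
            then show ?thesis using 2 by blast
          qed simp
        qed
        then show "\<psi> i x = max 0 (\<phi> i x - Max (insert 0 ((\<lambda>i. \<phi> i x) ` {j\<in>I. idx j < idx i})))"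
          by (simp only: \<psi>_def M_def)
      qed
      also have "\<dots> = Max (insert 0 ((\<lambda>i. \<phi> i x) ` I))"
        by (rule sum_positive_increments_Max[OF If inj_on_subset[OF idx IS]])
      also have "\<dots> = 1"
        by (rule Max_eqI) (use If kI \<phi>k \<phi>(3) in \<open>force+\<close>)
      finally show ?thesis .
    qed
    have "partition_of_unity \<rho> S \<psi> C"
      unfolding partition_of_unity_def
      using \<psi>F outside total \<psi>E by (intro conjI ballI allI impI) (auto simp: \<psi>_def)
    then show ?thesis by (intro exI[of _ \<psi>])
  qed
  then show thesis using that[OF C0] by blast
qed

end

section \<open>Discrete approximations\<close>

text \<open>Integrate the counting function of the family: it is at most \<open>n\<close>, and 0 off
  \<open>G\<close>.\<close>

lemma (in finite_measure) sum_measure_overlap_le: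
  assumes T: "finite T" and B: "\<And>k. k \<in> T \<Longrightarrow> B k \<in> sets M" "\<And>k. k \<in> T \<Longrightarrow> B k \<subseteq> G" and G: "G \<in> sets M"
    and card: "\<And>z. card {k\<in>T. z \<in> B k} \<le> n"
  shows "(\<Sum>k\<in>T. measure M (B k)) \<le> real n * measure M G"
proof -
  have "(\<Sum>k\<in>T. measure M (B k)) = (\<Sum>k\<in>T. (LINT z|M. indicator (B k) z))"
    using B sets.sets_into_space by (intro sum.cong) (auto simp: Int_absorb2)
  also have "\<dots> = (LINT z|M. (\<Sum>k\<in>T. indicator (B k) z))"
    using B by (intro Bochner_Integration.integral_sum[symmetric]) (auto simp: emeasure_eq_measure)
  also have "\<dots> \<le> (LINT z|M. real n * indicator G z)"
  proof (rule integral_mono)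
    show "integrable M (\<lambda>z. \<Sum>k\<in>T. indicator (B k) z :: real)"
      using B by (intro Bochner_Integration.integrable_sum) (auto simp: emeasure_eq_measure)
    show "integrable M (\<lambda>z. real n * indicator G z)"
      using G by (auto simp: emeasure_eq_measure)
    fix z
    have "(\<Sum>k\<in>T. indicator (B k) z :: real) = (\<Sum>k\<in>T. if z \<in> B k then 1 else 0)"
      by (simp add: indicator_def of_bool_def)
    also have "\<dots> = (\<Sum>k\<in>{k\<in>T. z \<in> B k}. 1)" by (rule sum.inter_filter[OF T, symmetric])
    also have "\<dots> = real (card {k\<in>T. z \<in> B k})" by simp
    also have "\<dots> \<le> real n * indicator G z"
    proof (cases "z \<in> G")
      case False
      then have "{k\<in>T. z \<in> B k} = {}" using B by blast
      then have "card {k\<in>T. z \<in> B k} = 0" by (simp only: card.empty)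
      then show ?thesis by simp
    qed (use card in simp)
    finally show "(\<Sum>k\<in>T. indicator (B k) z :: real) \<le> real n * indicator G z" .
  qed
  also have "\<dots> = real n * measure M G"
    using G sets.sets_into_space by (simp add: Int_absorb2)
  finally show ?thesis .
qed

text \<open>The largest deviation dominates the convex combination and is itself a summand on the
  right. The weights disappear, so no partition function has to be integrated later.\<close>

lemma convex_combination_powr_le:
  fixes a :: "'b \<Rightarrow> real"
  assumes I: "finite I" and \<psi>: "\<And>i. i \<in> I \<Longrightarrow> 0 \<le> \<psi> i" "(\<Sum>i\<in>I. \<psi> i) = 1" and p: "0 \<le> p"
  shows "\<bar>(\<Sum>i\<in>I. a i * \<psi> i) - c\<bar> powr p \<le> (\<Sum>i\<in>I. \<bar>a i - c\<bar> powr p)"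
proof -
  have ne: "I \<noteq> {}" using \<psi>(2) by auto
  define M where "M = Max ((\<lambda>i. \<bar>a i - c\<bar>) ` I)"
  obtain j where j: "j \<in> I" "M = \<bar>a j - c\<bar>"
    using Max_in[of "(\<lambda>i. \<bar>a i - c\<bar>) ` I"] I ne unfolding M_def by blast
  have "(\<Sum>i\<in>I. a i * \<psi> i) - c = (\<Sum>i\<in>I. a i * \<psi> i) - c * (\<Sum>i\<in>I. \<psi> i)" using \<psi>(2) by simp
  also have "\<dots> = (\<Sum>i\<in>I. (a i - c) * \<psi> i)"
    by (simp add: sum_distrib_left left_diff_distrib sum_subtractf)
  finally have "\<bar>(\<Sum>i\<in>I. a i * \<psi> i) - c\<bar> \<le> (\<Sum>i\<in>I. \<bar>(a i - c) * \<psi> i\<bar>)"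
    by (simp only: sum_abs)
  also have "\<dots> \<le> (\<Sum>i\<in>I. M * \<psi> i)"
    using I \<psi>(1) by (intro sum_mono) (auto simp: abs_mult M_def intro!: mult_right_mono)
  also have "\<dots> = M" using \<psi>(2) by (simp add: sum_distrib_left[symmetric])
  finally have "\<bar>(\<Sum>i\<in>I. a i * \<psi> i) - c\<bar> powr p \<le> \<bar>a j - c\<bar> powr p"
    using p j by (intro powr_mono2) auto
  also have "\<dots> \<le> (\<Sum>i\<in>I. \<bar>a i - c\<bar> powr p)"
    using j(1) I by (intro member_le_sum) auto
  finally show ?thesis .
qed

section \<open>Energy and p-integrals of discrete sums\<close>

context uniform_extension
begin

lemma self_nbr: "radius_fun \<rho> r \<Longrightarrow> k \<in> S \<Longrightarrow> k \<in> nbr \<rho> S k"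
  using radius_funD(4)[of \<rho> r k] A1 by (simp add: nbr_def adjacent_def)

lemma discrete_sum_local:
  assumes \<rho>: "radius_fun \<rho> r" and S: "net \<rho> S" and pou: "partition_of_unity \<rho> S \<psi> C" and nbN: "nbr_bound N"
    and S': "finite S'" "S' \<subseteq> S" and a: "\<And>i. i \<notin> S' \<Longrightarrow> a i = 0"
    and k: "k \<in> S" "dist k x < \<rho> k"
  shows "(\<Sum>i\<in>S'. a i * \<psi> i x) = (\<Sum>i\<in>nbr \<rho> S k. a i * \<psi> i x)"
proof -
  have fin: "finite (nbr \<rho> S k)" by (rule nbr_boundD(1)[OF nbN \<rho> S])
  have "(\<Sum>i\<in>S'. a i * \<psi> i x) = (\<Sum>i\<in>S' \<inter> nbr \<rho> S k. a i * \<psi> i x)"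
    by (rule sum.mono_neutral_right) (use S' partition_of_unityD(4)[OF pou k] in auto)
  also have "\<dots> = (\<Sum>i\<in>nbr \<rho> S k. a i * \<psi> i x)"
    by (rule sum.mono_neutral_left) (use fin a in auto)
  finally show ?thesis .
qed

text \<open>On the ball the partition adds up to 1, so the sum is the constant \<open>a k\<close>
  plus the sum of \<open>(a i - a k) * \<psi> i\<close> over the neighbours. Locality discards the
  constant, and subadditivity bounds the rest.\<close>

lemma discrete_energy_ball:
  assumes \<rho>: "radius_fun \<rho> r" and S: "net \<rho> S" and pou: "partition_of_unity \<rho> S \<psi> C" and nbN: "nbr_bound N"
    and S': "finite S'" "S' \<subseteq> S" and a: "\<And>i. i \<notin> S' \<Longrightarrow> a i = 0" and C: "0 \<le> C"
    and k: "k \<in> S" and b: "\<And>i. i \<in> nbr \<rho> S k \<Longrightarrow> \<bar>a i - a k\<bar> powr p * weight \<rho> k \<le> b"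
  shows "measure (\<Gamma> (\<lambda>x. \<Sum>i\<in>S'. a i * \<psi> i x)) (ball k (\<rho> k)) \<le> (real N * C) powr p * b"
proof -
  let ?B = "ball k (\<rho> k)"
  let ?n = "nbr \<rho> S k"
  define u where "u x = (\<Sum>i\<in>S'. a i * \<psi> i x)" for x
  define g where "g x = (\<Sum>i\<in>?n. (a i - a k) * \<psi> i x)" for x
  have fin: "finite ?n" and card: "card ?n \<le> N" by (rule nbr_boundD[OF nbN \<rho> S])+
  have nS: "?n \<subseteq> S" by (auto simp: nbr_def)
  note P = partition_of_unityD[OF pou]
  have uF: "u \<in> \<F>" unfolding u_def by (rule function_subspace_sum[OF F_subspace S'(1)]) (use P(1) S'(2) in auto)
  have gF: "g \<in> \<F>" unfolding g_def by (rule function_subspace_sum[OF F_subspace fin]) (use P(1) nS in auto)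
  have "u x - g x = a k" if "x \<in> ?B" for x
  proof -
    have x: "dist k x < \<rho> k" using that by simp
    have "u x = (\<Sum>i\<in>?n. a i * \<psi> i x)"
      unfolding u_def by (rule discrete_sum_local[OF \<rho> S pou nbN S' a k x])
    then have "u x - g x = (\<Sum>i\<in>?n. a k * \<psi> i x)"
      by (simp add: g_def sum_subtractf[symmetric] left_diff_distrib)
    also have "\<dots> = a k" using P(3)[OF k x] by (simp add: sum_distrib_left[symmetric])
    finally show ?thesis .
  qed
  then have "measure (\<Gamma> u) ?B = measure (\<Gamma> g) ?B"
    by (intro \<Gamma>_local[OF uF gF, of ?B "a k"]) auto
  moreover have "gN ?B g \<le> real N * C * b powr (1 / p)"
  proof -
    have w0: "0 \<le> weight \<rho> k" by (rule weight_nonneg[OF \<rho>])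
    have "gN ?B g \<le> eN g" by (rule gN_le_eN[OF gF]) simp
    also have "\<dots> \<le> (\<Sum>i\<in>?n. \<bar>a i - a k\<bar> * eN (\<psi> i))"
      unfolding g_def by (rule seminorm_on_sum[OF F_subspace E_seminorm fin]) (use P(1) nS in auto)
    also have "\<dots> \<le> (\<Sum>i\<in>?n. C * b powr (1 / p))"
    proof (rule sum_mono)
      fix i assume i: "i \<in> ?n"
      have "\<bar>a i - a k\<bar> * eN (\<psi> i) \<le> \<bar>a i - a k\<bar> * (C * weight \<rho> k powr (1 / p))"
        by (intro mult_left_mono P(5)[OF k i]) auto
      also have "\<dots> = C * (\<bar>a i - a k\<bar> powr p * weight \<rho> k) powr (1 / p)"
        using p_pos w0 by (simp add: powr_mult powr_powr)
      also have "\<dots> \<le> C * b powr (1 / p)"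
        using b[OF i] C w0 p_pos by (intro mult_left_mono powr_mono2) auto
      finally show "\<bar>a i - a k\<bar> * eN (\<psi> i) \<le> C * b powr (1 / p)" .
    qed
    also have "\<dots> = real (card ?n) * (C * b powr (1 / p))" by simp
    also have "\<dots> \<le> real N * (C * b powr (1 / p))" using card C by (intro mult_right_mono) auto
    finally show ?thesis by (simp add: mult.assoc)
  qed
  ultimately have "measure (\<Gamma> u) ?B \<le> (real N * C * b powr (1 / p)) powr p"
    using powr_mono2[of p "gN ?B g" "real N * C * b powr (1 / p)"] p_pos by (simp add: powr_powr)
  moreover have "0 \<le> b"
  proof -
    have "0 \<le> \<bar>a k - a k\<bar> powr p * weight \<rho> k" by simp
    also have "\<dots> \<le> b" by (rule b[OF self_nbr[OF \<rho> k]])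
    finally show ?thesis .
  qed
  ultimately have "measure (\<Gamma> u) ?B \<le> (real N * C) powr p * b" using p_pos by (simp add: powr_mult powr_powr)
  then show ?thesis unfolding u_def[abs_def] .
qed

text \<open>\<open>G\<close> is covered by net balls. Those centred outside \<open>T\<close> see
  only zero coefficients and, being countably many, are jointly null for the energy measure;
  finitely many balls meeting \<open>G\<close> remain.\<close>

lemma discrete_energy:
  assumes \<rho>: "radius_fun \<rho> r" and S: "net \<rho> S" and pou: "partition_of_unity \<rho> S \<psi> C" and nbN: "nbr_bound N"
    and S': "finite S'" "S' \<subseteq> S" and a: "\<And>i. i \<notin> S' \<Longrightarrow> a i = 0" and C: "0 \<le> C"
    and b: "\<And>k i. k \<in> S \<Longrightarrow> i \<in> nbr \<rho> S k \<Longrightarrow> \<bar>a i - a k\<bar> powr p * weight \<rho> k \<le> b k"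
    and T: "finite T" "T \<subseteq> S" "\<And>k. k \<in> S \<Longrightarrow> nbr \<rho> S k \<inter> S' \<noteq> {} \<Longrightarrow> k \<in> T"
    and G: "G \<in> sets borel"
  shows "measure (\<Gamma> (\<lambda>x. \<Sum>i\<in>S'. a i * \<psi> i x)) G
    \<le> (real N * C) powr p * (\<Sum>k\<in>{k\<in>T. ball k (\<rho> k) \<inter> G \<noteq> {}}. b k)"
proof -
  define u where "u x = (\<Sum>i\<in>S'. a i * \<psi> i x)" for x
  have uF: "u \<in> \<F>" unfolding u_def
    by (rule function_subspace_sum[OF F_subspace S'(1)]) (use partition_of_unityD(1)[OF pou] S'(2) in auto)
  interpret gu: finite_measure "\<Gamma> u" by (rule \<Gamma>_finite[OF uF])
  have setsu: "sets (\<Gamma> u) = sets borel" by (rule \<Gamma>_borel[OF uF])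
  let ?T = "{k\<in>T. ball k (\<rho> k) \<inter> G \<noteq> {}}"
  define Z where "Z = (\<Union>k\<in>S - T. ball k (\<rho> k))"
  have null: "ball k (\<rho> k) \<in> null_sets (\<Gamma> u)" if k: "k \<in> S - T" for k
  proof -
    have no: "nbr \<rho> S k \<inter> S' = {}" using T(3) k by blast
    have "measure (\<Gamma> (\<lambda>x. \<Sum>i\<in>S'. a i * \<psi> i x)) (ball k (\<rho> k)) \<le> (real N * C) powr p * 0"
    proof (rule discrete_energy_ball[OF \<rho> S pou nbN S' a C])
      show "k \<in> S" using k by simp
      fix i assume "i \<in> nbr \<rho> S k"
      then have "i \<notin> S'" "k \<notin> S'" using no self_nbr[OF \<rho>, of k S] k by auto
      then show "\<bar>a i - a k\<bar> powr p * weight \<rho> k \<le> 0" using a by simp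
    qed
    then have "measure (\<Gamma> u) (ball k (\<rho> k)) = 0" unfolding u_def by (simp add: order_antisym)
    then have "emeasure (\<Gamma> u) (ball k (\<rho> k)) = 0" by (simp add: gu.emeasure_eq_measure)
    then show ?thesis by (rule null_setsI) (simp add: setsu)
  qed
  have Z: "Z \<in> null_sets (\<Gamma> u)"
    unfolding Z_def by (rule null_sets_UN'[OF _ null]) (use net_countable(2)[OF \<rho> S] in auto)
  have "G \<subseteq> Z \<union> (\<Union>k\<in>?T. ball k (\<rho> k))"
  proof
    fix x assume x: "x \<in> G"
    obtain k where k: "k \<in> S" "dist k x < \<rho> k" using netD(2)[OF S] by blast
    show "x \<in> Z \<union> (\<Union>k\<in>?T. ball k (\<rho> k))"
    proof (cases "k \<in> T")
      case True
      moreover have "x \<in> ball k (\<rho> k)" using k by simp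
      ultimately show ?thesis using x by blast
    next
      case False
      then show ?thesis using k by (auto simp: Z_def)
    qed
  qed
  moreover have UN: "(\<Union>k\<in>?T. ball k (\<rho> k)) \<in> sets (\<Gamma> u)" using setsu by (auto intro: borel_open)
  ultimately have "measure (\<Gamma> u) G \<le> measure (\<Gamma> u) (Z \<union> (\<Union>k\<in>?T. ball k (\<rho> k)))"
    using Z G setsu by (intro gu.finite_measure_mono) auto
  also have "\<dots> = measure (\<Gamma> u) (\<Union>k\<in>?T. ball k (\<rho> k))"
    using measure_Un_null_set[OF UN Z] by (simp add: Un_commute)
  also have "\<dots> \<le> (\<Sum>k\<in>?T. measure (\<Gamma> u) (ball k (\<rho> k)))"
    by (rule gu.finite_measure_subadditive_finite) (simp_all add: T(1) setsu image_subset_iff)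
  also have "\<dots> \<le> (\<Sum>k\<in>?T. (real N * C) powr p * b k)"
  proof (rule sum_mono)
    fix k assume "k \<in> ?T"
    then have k: "k \<in> S" using T(2) by blast
    show "measure (\<Gamma> u) (ball k (\<rho> k)) \<le> (real N * C) powr p * b k"
      unfolding u_def[abs_def]
    proof (rule discrete_energy_ball[OF \<rho> S pou nbN S' _ C k])
      show "a i = 0" if "i \<notin> S'" for i using a[OF that] .
      show "\<bar>a i - a k\<bar> powr p * weight \<rho> k \<le> b k" if "i \<in> nbr \<rho> S k" for i using b[OF k that] .
    qed
  qed
  finally show ?thesis unfolding u_def[abs_def] sum_distrib_left .
qed

lemma Jp_finite_UN_le:
  assumes "finite T" "\<And>k. k \<in> T \<Longrightarrow> B k \<in> sets borel" "g \<in> borel_measurable borel" "D \<subseteq> (\<Union>k\<in>T. B k)"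
  shows "Jp D g \<le> (\<Sum>k\<in>T. Jp (B k) g)"
proof -
  have "Jp D g \<le> (\<integral>\<^sup>+x. (\<Sum>k\<in>T. ennreal (\<bar>g x\<bar> powr p) * indicator (B k) x) \<partial>m)"
    unfolding Jp_def
  proof (intro nn_integral_mono)
    fix x
    show "ennreal (\<bar>g x\<bar> powr p) * indicator D x \<le> (\<Sum>k\<in>T. ennreal (\<bar>g x\<bar> powr p) * indicator (B k) x)"
    proof (cases "x \<in> D")
      case True
      then obtain k where k: "k \<in> T" "x \<in> B k" using assms(4) by blast
      then have "ennreal (\<bar>g x\<bar> powr p) * indicator D x = ennreal (\<bar>g x\<bar> powr p) * indicator (B k) x"
        using True by simp
      also have "\<dots> \<le> (\<Sum>k\<in>T. ennreal (\<bar>g x\<bar> powr p) * indicator (B k) x)"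
        using k assms(1) by (intro member_le_sum) auto
      finally show ?thesis .
    qed simp
  qed
  also have "\<dots> = (\<Sum>k\<in>T. Jp (B k) g)"
    unfolding Jp_def using assms by (intro nn_integral_sum) auto
  finally show ?thesis .
qed

text \<open>On each net ball the sum is a convex combination of the neighbouring coefficients, so
  its deviation from \<open>h\<close> is bounded by theirs.\<close>

lemma discrete_Jp:
  assumes \<rho>: "radius_fun \<rho> r" and S: "net \<rho> S" and pou: "partition_of_unity \<rho> S \<psi> C" and nbN: "nbr_bound N"
    and S': "finite S'" "S' \<subseteq> S" and a: "\<And>i. i \<notin> S' \<Longrightarrow> a i = 0"
    and T: "finite T" "T \<subseteq> S" and h: "h \<in> borel_measurable borel" and D: "D \<subseteq> (\<Union>k\<in>T. ball k (\<rho> k))"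
  shows "Jp D (\<lambda>x. (\<Sum>i\<in>S'. a i * \<psi> i x) - h x) \<le> (\<Sum>k\<in>T. \<Sum>i\<in>nbr \<rho> S k. Jp (ball k (\<rho> k)) (\<lambda>x. a i - h x))"
proof -
  define u where "u x = (\<Sum>i\<in>S'. a i * \<psi> i x)" for x
  have uF: "u \<in> \<F>" unfolding u_def
    by (rule function_subspace_sum[OF F_subspace S'(1)]) (use partition_of_unityD(1)[OF pou] S'(2) in auto)
  note [measurable] = F_measurable[OF uF] h
  note P = partition_of_unityD[OF pou]
  have "Jp D (\<lambda>x. u x - h x) \<le> (\<Sum>k\<in>T. Jp (ball k (\<rho> k)) (\<lambda>x. u x - h x))"
    by (rule Jp_finite_UN_le[OF T(1) _ _ D]) auto
  also have "\<dots> \<le> (\<Sum>k\<in>T. \<Sum>i\<in>nbr \<rho> S k. Jp (ball k (\<rho> k)) (\<lambda>x. a i - h x))"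
  proof (rule sum_mono)
    fix k assume "k \<in> T"
    then have k: "k \<in> S" using T by blast
    have fin: "finite (nbr \<rho> S k)" by (rule nbr_boundD(1)[OF nbN \<rho> S])
    have [measurable]: "ball k (\<rho> k) \<in> sets borel" by simp
    have "Jp (ball k (\<rho> k)) (\<lambda>x. u x - h x)
        \<le> (\<integral>\<^sup>+x. (\<Sum>i\<in>nbr \<rho> S k. ennreal (\<bar>a i - h x\<bar> powr p) * indicator (ball k (\<rho> k)) x) \<partial>m)"
      unfolding Jp_def
    proof (intro nn_integral_mono)
      fix x
      show "ennreal (\<bar>u x - h x\<bar> powr p) * indicator (ball k (\<rho> k)) x
         \<le> (\<Sum>i\<in>nbr \<rho> S k. ennreal (\<bar>a i - h x\<bar> powr p) * indicator (ball k (\<rho> k)) x)"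
      proof (cases "x \<in> ball k (\<rho> k)")
        case True
        then have x: "dist k x < \<rho> k" by simp
        have eq: "u x = (\<Sum>i\<in>nbr \<rho> S k. a i * \<psi> i x)"
          unfolding u_def by (rule discrete_sum_local[OF \<rho> S pou nbN S' a k x])
        have "\<bar>u x - h x\<bar> powr p \<le> (\<Sum>i\<in>nbr \<rho> S k. \<bar>a i - h x\<bar> powr p)"
          unfolding eq
          by (rule convex_combination_powr_le[OF fin _ P(3)[OF k x]]) (use P(2) p_pos in \<open>auto simp: nbr_def\<close>)
        then show ?thesis using True by (auto simp: sum_ennreal intro!: ennreal_leI)
      qed simp
    qed
    also have "\<dots> = (\<Sum>i\<in>nbr \<rho> S k. Jp (ball k (\<rho> k)) (\<lambda>x. a i - h x))"
      unfolding Jp_def by (rule nn_integral_sum) measurable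
    finally show "Jp (ball k (\<rho> k)) (\<lambda>x. u x - h x) \<le> (\<Sum>i\<in>nbr \<rho> S k. Jp (ball k (\<rho> k)) (\<lambda>x. a i - h x))" .
  qed
  finally show ?thesis by (simp add: u_def)
qed

section \<open>Radii, reflected points and geometric constants\<close>

definition Rmax :: real where "Rmax = min (dist w1 w2 / 4) Rcap"

text \<open>The slope is the one demanded by \<open>radius_fun\<close>. Below the cap both deep
  points (\<open>dist w1 w2 / 4\<close>) and cutoffs (\<open>Rcap\<close>) exist.\<close>

definition rad :: "real \<Rightarrow> 'a \<Rightarrow> real" where
  "rad r x = min Rmax (max r (infdist x U / (4 * A1)))"

text \<open>An inactive centre has radius \<open>Rmax\<close>, so its vanishing coefficient produces
  jumps only at scales comparable to \<open>Rmax\<close>.\<close>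

definition active :: "'a \<Rightarrow> bool" where
  "active x \<longleftrightarrow> infdist x U / (4 * A1) < Rmax"

text \<open>Dilated by \<open>Lam\<close>, a reflected ball has radius \<open>1 / (8 * Au)\<close>
  of its scale; at the scale of a neighbour this is at most half of the depth
  \<open>1 / (2 * Au)\<close> guaranteed there.\<close>

definition \<sigma>0 :: real where "\<sigma>0 = 1 / (8 * Au * Lam)"

text \<open>Distance of the reflected points of adjacent centres, in units of one radius:
  \<open>4 * A1 + 2\<close> at \<open>k\<close>, \<open>3 * A1\<close> between the centres, and
  twice \<open>4 * A1 + 2\<close> at a neighbour of up to double radius.\<close>

definition K0 :: real where "K0 = 15 * A1 + 6"

text \<open>\<open>Au * K0 + 1\<close> is the extent of a chain seen from \<open>Y k\<close>; the
  last summand moves the centre to \<open>k\<close>. Correspondingly, \<open>\<kappa>1\<close> is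
  the chain depth for \<open>\<kappa> = 1 / (2 * Au)\<close>.\<close>

definition K1 :: real where "K1 = Au * K0 + 1 + K0"

definition \<kappa>1 :: real where "\<kappa>1 = 1 / (2 * Au) / (4 * Au)"

text \<open>\<open>Y\<close> selects the reflected interior points and \<open>a\<close> the mean values of \<open>f\<close> there.\<close>

definition coefficients :: "real \<Rightarrow> ('a \<Rightarrow> 'a) \<Rightarrow> ('a \<Rightarrow> real) \<Rightarrow> bool" where
  "coefficients r Y a \<longleftrightarrow> (\<forall>x. active x \<longrightarrow> dist x (Y x) \<le> (4 * A1 + 2) * rad r x \<and> rad r x / Au \<le> \<delta> (Y x) \<and>
     osc (Y x) (\<sigma>0 * rad r x) (a x)) \<and> (\<forall>x. \<not> active x \<longrightarrow> a x = 0)"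

lemma coefficientsD:
  assumes "coefficients r Y a"
  shows "active x \<Longrightarrow> dist x (Y x) \<le> (4 * A1 + 2) * rad r x" "active x \<Longrightarrow> rad r x / Au \<le> \<delta> (Y x)"
    "active x \<Longrightarrow> osc (Y x) (\<sigma>0 * rad r x) (a x)" "\<not> active x \<Longrightarrow> a x = 0"
  using assms unfolding coefficients_def by simp_all

lemma Rmax: "0 < Rmax" "Rmax \<le> Rcap" "Rmax \<le> dist w1 w2 / 4"
  using w12 Rcap by (auto simp: Rmax_def)

lemma \<sigma>0: "0 < \<sigma>0" "Lam * \<sigma>0 = 1 / (8 * Au)" "\<sigma>0 \<le> 1 / 8"
proof -
  have "1 \<le> Au * Lam" using Au Lam mult_mono[of 1 Au 1 Lam] by simp
  then show "0 < \<sigma>0" "Lam * \<sigma>0 = 1 / (8 * Au)" "\<sigma>0 \<le> 1 / 8"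
    using Au Lam by (auto simp: \<sigma>0_def field_simps)
qed

lemma rad_radius_fun:
  assumes "0 < r" "r \<le> Rmax"
  shows "radius_fun (rad r) r"
  unfolding radius_fun_def
proof (intro conjI allI)
  show "0 < r" by fact
  fix x y
  show "r \<le> rad r x" "rad r x \<le> Rcap" using assms Rmax by (auto simp: rad_def)
  have "infdist x U / (4 * A1) \<le> infdist y U / (4 * A1) + dist x y / (4 * A1)"
    using infdist_triangle[of x U y] A1 by (simp add: divide_right_mono flip: add_divide_distrib)
  moreover have "0 \<le> dist x y / (4 * A1)" using A1 by simp
  ultimately show "rad r x \<le> rad r y + dist x y / (4 * A1)" unfolding rad_def by linarith
qed

lemma rad_le_Rmax: "rad r x \<le> Rmax"
  by (simp add: rad_def)

lemma rad_not_active: "\<not> active x \<Longrightarrow> rad r x = Rmax"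
  by (auto simp: rad_def active_def)

text \<open>A ball that reaches \<open>U\<close> cannot owe its radius to the distance term, whose
  slope is below 1.\<close>

lemma rad_near:
  assumes "0 < r" "r \<le> Rmax" "infdist x U < rad r x"
  shows "rad r x = r"
proof -
  have "infdist x U / (4 * A1) \<le> infdist x U / 1"
    using A1 infdist_nonneg[of x U] by (intro divide_left_mono) auto
  then have "infdist x U / (4 * A1) \<le> infdist x U" by simp
  then show ?thesis using assms unfolding rad_def by linarith
qed

text \<open>An active centre is within \<open>4 * A1\<close> radii of \<open>U\<close>, so a
  corkscrew point at the scale of its radius lies at comparable distance.\<close>

lemma coefficients_exist:
  assumes r: "0 < r" "r \<le> Rmax"
  obtains Y a where "coefficients r Y a"
proof -
  note \<rho> = radius_funD[OF rad_radius_fun[OF r]]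
  have "\<exists>y a. dist x y \<le> (4 * A1 + 2) * rad r x \<and> rad r x / Au \<le> \<delta> y \<and> osc y (\<sigma>0 * rad r x) a" if x: "active x" for x
  proof -
    let ?\<rho> = "rad r x"
    have pos: "0 < ?\<rho>" by (rule \<rho>(4))
    obtain y where y: "y \<in> U" "dist x y \<le> infdist x U + 2 * ?\<rho>" "?\<rho> / Au \<le> \<delta> y"
      by (rule corkscrew[OF pos, of x]) (use rad_le_Rmax[of r x] Rmax in auto)
    have "infdist x U / (4 * A1) \<le> ?\<rho>" using x by (auto simp: rad_def active_def)
    then have "infdist x U \<le> 4 * A1 * ?\<rho>" using A1 by (simp add: field_simps)
    then have 1: "dist x y \<le> (4 * A1 + 2) * ?\<rho>" using y(2) by (simp add: algebra_simps)
    have "Lam * (\<sigma>0 * ?\<rho>) = ?\<rho> / (8 * Au)" using \<sigma>0(2) by (simp add: mult.assoc[symmetric])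
    also have "\<dots> \<le> ?\<rho> / Au" using Au pos by (intro divide_left_mono) auto
    finally have "ball y (Lam * (\<sigma>0 * ?\<rho>)) \<subseteq> U" using y(3) by (intro ball_\<delta>_subset) simp
    then have "\<exists>a. osc y (\<sigma>0 * ?\<rho>) a" using \<sigma>0(1) pos by (intro osc_exists) auto
    then show ?thesis using 1 y(3) by blast
  qed
  then obtain Y a where Ya: "\<And>x. active x \<Longrightarrow> dist x (Y x) \<le> (4 * A1 + 2) * rad r x \<and> rad r x / Au \<le> \<delta> (Y x) \<and>
      osc (Y x) (\<sigma>0 * rad r x) (a x)"
    by metis
  have "coefficients r Y (\<lambda>x. if active x then a x else 0)"
    using Ya by (simp add: coefficients_def)
  then show thesis by (rule that)
qed

abbreviation region :: "real \<Rightarrow> 'a \<Rightarrow> 'a set" where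
  "region r k \<equiv> deep_region K1 \<kappa>1 k (rad r k)"

end

section \<open>Coefficients from reflected balls\<close>

context uniform_extension
begin

lemma chain_constD:
  assumes "chain_const \<sigma> \<kappa> K C"
  shows "0 \<le> C"
    and "0 < \<rho> \<Longrightarrow> \<kappa> * \<rho> \<le> \<delta> y \<Longrightarrow> \<kappa> * \<rho> \<le> \<delta> y' \<Longrightarrow> dist y y' \<le> K * \<rho> \<Longrightarrow>
        \<sigma> * \<rho> \<le> t \<Longrightarrow> Lam * t \<le> \<kappa> * \<rho> / 2 \<Longrightarrow> \<sigma> * \<rho> \<le> t' \<Longrightarrow> Lam * t' \<le> \<kappa> * \<rho> / 2 \<Longrightarrow>
        osc y t a \<Longrightarrow> osc y' t' a' \<Longrightarrow> R \<in> sets borel \<Longrightarrow> deep_region (Au * K + 1) (\<kappa> / (4 * Au)) y \<rho> \<subseteq> R \<Longrightarrow>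
        \<bar>a - a'\<bar> powr p * mb y \<rho> \<le> C * \<Psi> \<rho> * measure \<nu> R"
  using assms unfolding chain_const_def by blast+

lemma K0_ge_1: "1 \<le> K0" and K1_ge_1: "1 \<le> K1" and \<kappa>1_pos: "0 < \<kappa>1"
  using A1 Au by (auto simp: K0_def K1_def \<kappa>1_def intro!: add_nonneg_nonneg)

text \<open>The reflected ball of \<open>i\<close>, measured at the scale of a neighbour
  \<open>k\<close>. Radii differ by a factor of at most 2, whence \<open>11 * A1 + 4\<close>:
  \<open>3 * A1\<close> between the centres plus twice \<open>4 * A1 + 2\<close>.\<close>

lemma reflected_ball:
  assumes r: "0 < r" "r \<le> Rmax" and co: "coefficients r Y a" and ik: "adjacent (rad r) i k" and i: "active i"
  shows "dist k (Y i) \<le> (11 * A1 + 4) * rad r k"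
    and "rad r k / (2 * Au) \<le> \<delta> (Y i)"
    and "Lam * (\<sigma>0 * rad r i) \<le> rad r k / (4 * Au)"
    and "\<sigma>0 / 2 * rad r k \<le> \<sigma>0 * rad r i"
    and "\<sigma>0 * rad r i \<le> rad r k"
    and "ball (Y i) (Lam * (\<sigma>0 * rad r i)) \<subseteq> U \<inter> region r k"
proof -
  note \<rho> = rad_radius_fun[OF r]
  have pos: "0 < rad r i" "0 < rad r k" using radius_funD(4)[OF \<rho>] by auto
  have rad: "rad r i \<le> 2 * rad r k" "rad r k \<le> 2 * rad r i"
    using adjacent_radius[OF \<rho>] ik adjacent_sym by auto
  have Ai: "A1 * rad r i \<le> 2 * (A1 * rad r k)" using rad A1 by simp
  have Ak: "rad r k \<le> A1 * rad r k" using A1 pos by simp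
  have d1: "dist i k < A1 * rad r i + A1 * rad r k" using ik by (simp add: adjacent_def distrib_left)
  have d2: "dist i (Y i) \<le> 4 * (A1 * rad r i) + 2 * rad r i"
    using coefficientsD(1)[OF co i] by (simp add: algebra_simps)
  have d3: "dist k (Y i) \<le> dist i k + dist i (Y i)" using dist_triangle[of k "Y i" i] by (simp add: dist_commute)
  show 1: "dist k (Y i) \<le> (11 * A1 + 4) * rad r k"
    using d1 d2 d3 Ai rad unfolding distrib_right mult.assoc by linarith
  have "rad r k / (2 * Au) \<le> rad r i / Au" using rad Au by (simp add: field_simps)
  then show 2: "rad r k / (2 * Au) \<le> \<delta> (Y i)" using coefficientsD(2)[OF co i] by linarith
  have "Lam * (\<sigma>0 * rad r i) = rad r i / (8 * Au)" using \<sigma>0(2) by (simp add: mult.assoc[symmetric])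
  also have "\<dots> \<le> rad r k / (4 * Au)" using rad Au by (simp add: field_simps)
  finally show 3: "Lam * (\<sigma>0 * rad r i) \<le> rad r k / (4 * Au)" .
  show "\<sigma>0 / 2 * rad r k \<le> \<sigma>0 * rad r i" using rad \<sigma>0(1) by simp
  have "\<sigma>0 * rad r i \<le> 1 / 8 * rad r i" using \<sigma>0(3) pos by (intro mult_right_mono) auto
  then show "\<sigma>0 * rad r i \<le> rad r k" using rad pos by linarith
  have q: "rad r k / (4 * Au) \<le> rad r k" using Au pos mult_right_mono[of 1 Au "rad r k"] by (simp add: field_simps)
  have half: "rad r k / (2 * Au) = rad r k / (4 * Au) + rad r k / (4 * Au)" by (simp add: field_simps)
  have posq: "0 < rad r k / (4 * Au)" using pos Au by simp
  have "\<kappa>1 * rad r k = (1 / (2 * Au)) * (rad r k / (4 * Au))" by (simp add: \<kappa>1_def)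
  also have "\<dots> < 1 * (rad r k / (4 * Au))" using Au posq by (intro mult_strict_right_mono) auto
  finally have \<kappa>: "\<kappa>1 * rad r k < rad r k / (4 * Au)" by simp
  show "ball (Y i) (Lam * (\<sigma>0 * rad r i)) \<subseteq> U \<inter> region r k"
  proof
    fix z assume "z \<in> ball (Y i) (Lam * (\<sigma>0 * rad r i))"
    then have z: "dist (Y i) z < rad r k / (4 * Au)" using 3 by simp
    have dz: "rad r k / (4 * Au) < \<delta> z" using \<delta>_lipschitz[of "Y i" z] z 2 half by linarith
    then have "z \<in> U" using posq \<delta>_le[of z z] by (cases "z \<in> U") auto
    moreover have "dist k z < K1 * rad r k"
    proof -
      have "dist k z < (11 * A1 + 4) * rad r k + rad r k"
        using dist_triangle[of k z "Y i"] 1 z q by linarith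
      also have "\<dots> \<le> K0 * rad r k"
        using Ak pos A1 by (simp add: K0_def algebra_simps)
      also have "\<dots> \<le> K1 * rad r k"
        using pos Au K0_ge_1 by (intro mult_right_mono) (auto simp: K1_def)
      finally show ?thesis .
    qed
    ultimately show "z \<in> U \<inter> region r k" using dz \<kappa> by (auto simp: deep_region_def)
  qed
qed

text \<open>The first bound feeds the energy of the approximants, the second their p-integral and
  the jumps created by truncation.\<close>

definition coef_const :: "real \<Rightarrow> bool" where
  "coef_const C \<longleftrightarrow> 0 \<le> C \<and> (\<forall>r Y a i k. 0 < r \<and> r \<le> Rmax \<and> coefficients r Y a \<and> adjacent (rad r) i k \<longrightarrow>
     \<bar>a i - a k\<bar> powr p * weight (rad r) k \<le> C * measure \<nu> (region r k) \<and>
     \<bar>a i\<bar> powr p * mb k (rad r k) \<le> C * measure \<nu> (region r k))"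

lemma coef_constD:
  assumes "coef_const C"
  shows "0 \<le> C"
    and "0 < r \<Longrightarrow> r \<le> Rmax \<Longrightarrow> coefficients r Y a \<Longrightarrow> adjacent (rad r) i k \<Longrightarrow>
     \<bar>a i - a k\<bar> powr p * weight (rad r) k \<le> C * measure \<nu> (region r k)"
    and "0 < r \<Longrightarrow> r \<le> Rmax \<Longrightarrow> coefficients r Y a \<Longrightarrow> adjacent (rad r) i k \<Longrightarrow>
     \<bar>a i\<bar> powr p * mb k (rad r k) \<le> C * measure \<nu> (region r k)"
proof -
  show "0 \<le> C" using assms by (simp add: coef_const_def)
  assume *: "0 < r" "r \<le> Rmax" "coefficients r Y a" "adjacent (rad r) i k"
  note ** = assms[unfolded coef_const_def, THEN conjunct2, THEN spec, THEN spec, THEN spec, THEN spec, THEN spec, of r Y a i k]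
  show "\<bar>a i - a k\<bar> powr p * weight (rad r) k \<le> C * measure \<nu> (region r k)"
    "\<bar>a i\<bar> powr p * mb k (rad r k) \<le> C * measure \<nu> (region r k)"
    using ** * by simp_all
qed

lemma coef_const_exists:
  obtains C where "coef_const C"
proof -
  define \<kappa> where "\<kappa> = 1 / (2 * Au)"
  obtain Cch where "chain_const (\<sigma>0 / 2) \<kappa> K0 Cch"
    by (rule chain_const_exists[of "\<sigma>0 / 2" \<kappa> K0]) (use \<sigma>0 Au K0_ge_1 in \<open>auto simp: \<kappa>_def\<close>)
  note Cch0 = chain_constD(1)[OF this] and Cch = chain_constD(2)[OF this]
  obtain Cv where "volume_comparable K0 Cv" by (rule volume_comparable_exists)
  note Cv = volume_comparableD[OF this]
  obtain Cm where Cmc: "volume_comparable (2 / \<sigma>0) Cm" by (rule volume_comparable_exists)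
  note Cm = volume_comparableD[OF Cmc]
  \<comment> \<open>\<open>Ca\<close> bounds jumps between active centres by chains,
    \<open>Cb\<close> the size of a coefficient, and \<open>Cc\<close> jumps involving an inactive
    centre, where \<open>\<Psi>\<close> is bounded below.\<close>
  define Ca where "Ca = Cv * Cch"
  define Cb where "Cb = Cv * (2 powr p * Cm * (CP * \<Psi> Rmax + 1))"
  define Cc where "Cc = Cb / \<Psi> (Rmax / 2)"
  have PR: "0 < \<Psi> Rmax" "0 < \<Psi> (Rmax / 2)" using \<Psi>_pos Rmax by auto
  have C0: "0 \<le> Ca" "0 \<le> Cb" "0 \<le> Cc"
    using Cv(1) Cch0 Cm(1) CP PR by (auto simp: Ca_def Cb_def Cc_def)
  have "coef_const (Ca + Cb + Cc)"
    unfolding coef_const_def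
  proof (intro conjI)
    show "0 \<le> Ca + Cb + Cc" using C0 by simp
    show "\<forall>r Y a i k. 0 < r \<and> r \<le> Rmax \<and> coefficients r Y a \<and> adjacent (rad r) i k \<longrightarrow>
     \<bar>a i - a k\<bar> powr p * weight (rad r) k \<le> (Ca + Cb + Cc) * measure \<nu> (region r k) \<and>
     \<bar>a i\<bar> powr p * mb k (rad r k) \<le> (Ca + Cb + Cc) * measure \<nu> (region r k)"
    proof (intro allI impI; elim conjE)
      fix r Y a i k
      assume r: "0 < r" "r \<le> Rmax" and co: "coefficients r Y a" and ik: "adjacent (rad r) i k"
      let ?\<nu> = "measure \<nu> (region r k)"
      let ?\<rho> = "rad r k"
      note \<rho> = rad_radius_fun[OF r]
      have pos: "0 < ?\<rho>" using radius_funD(4)[OF \<rho>] by auto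
      have Pk: "0 < \<Psi> ?\<rho>" using \<Psi>_pos[OF pos] .
      have kk: "adjacent (rad r) k k" using pos A1 by (simp add: adjacent_def)
      have K0k: "(11 * A1 + 4) * ?\<rho> \<le> K0 * ?\<rho>" using A1 pos by (intro mult_right_mono) (auto simp: K0_def)
      have mean: "\<bar>a j\<bar> powr p * mb k ?\<rho> \<le> Cb * ?\<nu>" if j: "adjacent (rad r) j k" for j
      proof (cases "active j")
        case False
        then show ?thesis using coefficientsD(4)[OF co] C0 by simp
      next
        case True
        note rb = reflected_ball[OF r co j True]
        have "\<bar>a j\<bar> powr p * mb (Y j) ?\<rho> \<le> 2 powr p * Cm * (CP * \<Psi> ?\<rho> + 1) * ?\<nu>"
          by (rule mean_bound[OF Cmc _ _ pos rb(4,5) coefficientsD(3)[OF co True] rb(6)]) (use \<sigma>0(1) in auto)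
        also have "\<dots> \<le> 2 powr p * Cm * (CP * \<Psi> Rmax + 1) * ?\<nu>"
          using \<Psi>_mono[OF pos rad_le_Rmax] CP Cm(1) by (intro mult_right_mono mult_left_mono add_mono) auto
        finally have le: "\<bar>a j\<bar> powr p * mb (Y j) ?\<rho> \<le> 2 powr p * Cm * (CP * \<Psi> Rmax + 1) * ?\<nu>" .
        have "mb k ?\<rho> \<le> Cv * mb (Y j) ?\<rho>"
          using rb(1) K0k K0_ge_1 pos by (intro Cv(2)) (auto intro: order.trans)
        then have "\<bar>a j\<bar> powr p * mb k ?\<rho> \<le> \<bar>a j\<bar> powr p * (Cv * mb (Y j) ?\<rho>)" by (intro mult_left_mono) auto
        also have "\<dots> = Cv * (\<bar>a j\<bar> powr p * mb (Y j) ?\<rho>)" by simp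
        also have "\<dots> \<le> Cv * (2 powr p * Cm * (CP * \<Psi> Rmax + 1) * ?\<nu>)" using le Cv(1) by (intro mult_left_mono) auto
        finally show ?thesis by (simp add: Cb_def mult.assoc)
      qed
      have grow: "c * ?\<nu> \<le> (Ca + Cb + Cc) * ?\<nu>" if "c = Ca \<or> c = Cb \<or> c = Cc" for c
        using that C0 by (intro mult_right_mono) auto
      have "\<bar>a i - a k\<bar> powr p * weight (rad r) k \<le> (Ca + Cb + Cc) * ?\<nu>"
      proof (cases "active i \<and> active k")
        case True
        note ri = reflected_ball[OF r co ik] and rk = reflected_ball[OF r co kk]
        have R: "deep_region (Au * K0 + 1) (\<kappa> / (4 * Au)) (Y k) ?\<rho> \<subseteq> region r k"
        proof
          fix z assume z: "z \<in> deep_region (Au * K0 + 1) (\<kappa> / (4 * Au)) (Y k) ?\<rho>"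
          have "dist k z < (11 * A1 + 4) * ?\<rho> + (Au * K0 + 1) * ?\<rho>"
            using dist_triangle[of k z "Y k"] rk(1) True z by (auto simp: deep_region_def)
          also have "\<dots> \<le> K1 * ?\<rho>" using K0k by (simp add: K1_def algebra_simps)
          finally show "z \<in> region r k" using z by (simp add: deep_region_def \<kappa>1_def \<kappa>_def)
        qed
        have "dist (Y k) (Y i) \<le> dist k (Y k) + dist i k + dist i (Y i)"
          using dist_triangle[of "Y k" "Y i" k] dist_triangle[of k "Y i" i] by (simp add: dist_commute)
        also have "\<dots> \<le> K0 * ?\<rho>"
        proof -
          have Ai: "A1 * rad r i \<le> 2 * (A1 * ?\<rho>)" using adjacent_radius[OF \<rho> ik] A1 by simp
          have d1: "dist i k < A1 * rad r i + A1 * ?\<rho>" using ik by (simp add: adjacent_def distrib_left)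
          have d2: "dist i (Y i) \<le> 4 * (A1 * rad r i) + 2 * rad r i" "dist k (Y k) \<le> 4 * (A1 * ?\<rho>) + 2 * ?\<rho>"
            using coefficientsD(1)[OF co] True by (auto simp: algebra_simps)
          have "K0 * ?\<rho> = 15 * (A1 * ?\<rho>) + 6 * ?\<rho>" by (simp add: K0_def algebra_simps)
          then show ?thesis using Ai d1 d2 adjacent_radius[OF \<rho> ik] by linarith
        qed
        finally have dY: "dist (Y k) (Y i) \<le> K0 * ?\<rho>" .
        have eq1: "\<kappa> * ?\<rho> = ?\<rho> / (2 * Au)" "\<kappa> * ?\<rho> / 2 = ?\<rho> / (4 * Au)" by (auto simp: \<kappa>_def)
        have "\<bar>a k - a i\<bar> powr p * mb (Y k) ?\<rho> \<le> Cch * \<Psi> ?\<rho> * ?\<nu>"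
        proof (rule Cch[OF pos _ _ dY _ _ _ _ _ _ _ R])
          show "\<kappa> * ?\<rho> \<le> \<delta> (Y k)" "\<kappa> * ?\<rho> \<le> \<delta> (Y i)" using rk(2) ri(2) True eq1 by simp_all
          show "Lam * (\<sigma>0 * rad r k) \<le> \<kappa> * ?\<rho> / 2" "Lam * (\<sigma>0 * rad r i) \<le> \<kappa> * ?\<rho> / 2"
            unfolding eq1(2) using rk(3) ri(3) True by blast+
          show "\<sigma>0 / 2 * ?\<rho> \<le> \<sigma>0 * rad r k" "\<sigma>0 / 2 * ?\<rho> \<le> \<sigma>0 * rad r i"
            using rk(4) ri(4) True by blast+
          show "osc (Y k) (\<sigma>0 * rad r k) (a k)" "osc (Y i) (\<sigma>0 * rad r i) (a i)"
            using coefficientsD(3)[OF co] True by blast+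
        qed simp
        then have le: "\<bar>a i - a k\<bar> powr p * mb (Y k) ?\<rho> \<le> Cch * \<Psi> ?\<rho> * ?\<nu>"
          by (simp add: abs_minus_commute)
        have "mb k ?\<rho> \<le> Cv * mb (Y k) ?\<rho>"
          using rk(1) True K0k K0_ge_1 pos by (intro Cv(2)) (auto intro: order.trans)
        then have "\<bar>a i - a k\<bar> powr p * mb k ?\<rho> \<le> \<bar>a i - a k\<bar> powr p * (Cv * mb (Y k) ?\<rho>)"
          by (intro mult_left_mono) auto
        also have "\<dots> = Cv * (\<bar>a i - a k\<bar> powr p * mb (Y k) ?\<rho>)" by simp
        also have "\<dots> \<le> Cv * (Cch * \<Psi> ?\<rho> * ?\<nu>)" using le Cv(1) by (intro mult_left_mono) auto
        finally have "\<bar>a i - a k\<bar> powr p * weight (rad r) k \<le> Ca * ?\<nu>"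
          using Pk by (simp add: weight_def Ca_def field_simps)
        then show ?thesis using grow[of Ca] by simp
      next
        case False
        \<comment> \<open>One of the two centres has radius \<open>Rmax\<close>, so the other has at
          least half of it; passing from volume to \<open>weight\<close> then costs only a fixed
          factor.\<close>
        have half: "Rmax / 2 \<le> ?\<rho>"
          using False rad_not_active[of i r] rad_not_active[of k r] adjacent_radius[OF \<rho> ik] Rmax by auto
        then have P2: "\<Psi> (Rmax / 2) \<le> \<Psi> ?\<rho>" using Rmax by (intro \<Psi>_mono) auto
        have "\<bar>a i - a k\<bar> = \<bar>a i\<bar> \<or> \<bar>a i - a k\<bar> = \<bar>a k\<bar>"
          using False coefficientsD(4)[OF co] by auto
        then have "\<bar>a i - a k\<bar> powr p * mb k ?\<rho> \<le> Cb * ?\<nu>"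
          using mean[OF ik] mean[OF kk] by auto
        then have "\<bar>a i - a k\<bar> powr p * weight (rad r) k \<le> Cb * ?\<nu> / \<Psi> ?\<rho>"
          using Pk by (simp add: weight_def divide_right_mono)
        also have "\<dots> \<le> Cb * ?\<nu> / \<Psi> (Rmax / 2)"
          using P2 PR Pk C0 by (intro divide_left_mono) auto
        also have "\<dots> = Cc * ?\<nu>" by (simp add: Cc_def)
        finally show ?thesis using grow[of Cc] by simp
      qed
      moreover have "\<bar>a i\<bar> powr p * mb k ?\<rho> \<le> (Ca + Cb + Cc) * ?\<nu>"
        using mean[OF ik] grow[of Cb] by simp
      ultimately show "\<bar>a i - a k\<bar> powr p * weight (rad r) k \<le> (Ca + Cb + Cc) * ?\<nu> \<and>
        \<bar>a i\<bar> powr p * mb k ?\<rho> \<le> (Ca + Cb + Cc) * ?\<nu>" by blast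
    qed
  qed
  then show thesis by (rule that)
qed

section \<open>Bounded overlap of the regions and approximation inside \<open>U\<close>\<close>

definition overlap_bound :: "nat \<Rightarrow> bool" where
  "overlap_bound M \<longleftrightarrow> (\<forall>r S T z. 0 < r \<and> r \<le> Rmax \<and> net (rad r) S \<and> T \<subseteq> S \<longrightarrow> card {k\<in>T. z \<in> region r k} \<le> M)"

lemma overlap_boundD:
  "overlap_bound M \<Longrightarrow> 0 < r \<Longrightarrow> r \<le> Rmax \<Longrightarrow> net (rad r) S \<Longrightarrow> T \<subseteq> S \<Longrightarrow> card {k\<in>T. z \<in> region r k} \<le> M"
  unfolding overlap_bound_def by simp

text \<open>A centre \<open>k\<close> in \<open>U\<close> has radius \<open>r\<close>; if \<open>k\<close> is outside \<open>U\<close>, a point of its region has distance to the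
  complement comparable to the radius.  Hence all centres seen by a given point come from two scales.\<close>

lemma overlap_bound_exists:
  obtains M where "overlap_bound M"
proof -
  have K: "0 < K1" "0 < K1 * K1 / \<kappa>1" using K1_ge_1 \<kappa>1_pos by auto
  obtain N1 where N1: "packing_bound K1 N1" by (rule packing_bound_exists[OF K(1)])
  obtain N2 where N2: "packing_bound (K1 * K1 / \<kappa>1) N2" by (rule packing_bound_exists[OF K(2)])
  have "overlap_bound (N1 + N2)"
    unfolding overlap_bound_def
  proof (intro allI impI; elim conjE)
    fix r S T z assume r: "0 < r" "r \<le> Rmax" and S: "net (rad r) S" and T: "T \<subseteq> S"
    define A where "A = {k\<in>T. z \<in> region r k \<and> k \<in> U}"
    define B where "B = {k\<in>T. z \<in> region r k \<and> k \<notin> U}"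
    have A: "card A \<le> N1"
    proof (rule packing_boundD(2)[OF N1 r(1)])
      have rr: "rad r k = r" if "k \<in> A" for k
        using that r by (auto simp: A_def rad_def)
      show "A \<subseteq> ball z (K1 * r)"
      proof
        fix k assume k: "k \<in> A"
        then have "dist k z < K1 * rad r k" by (simp add: A_def deep_region_def)
        then show "k \<in> ball z (K1 * r)" using rr[OF k] by (simp add: dist_commute)
      qed
      show "pairwise (\<lambda>x y. r \<le> dist x y) A"
        unfolding pairwise_def
      proof (intro ballI impI)
        fix x y assume xy: "x \<in> A" "y \<in> A" "x \<noteq> y"
        then have "min (rad r x) (rad r y) \<le> dist x y" using T by (intro netD(1)[OF S]) (auto simp: A_def)
        then show "r \<le> dist x y" using rr xy by simp
      qed
    qed
    have B: "card B \<le> N2"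
    proof (cases "B = {}")
      case False
      have b: "\<delta> z / K1 < rad r k" "dist k z < K1 * rad r k" "\<kappa>1 * rad r k < \<delta> z" if "k \<in> B" for k
      proof -
        show 1: "dist k z < K1 * rad r k" "\<kappa>1 * rad r k < \<delta> z" using that by (auto simp: B_def deep_region_def)
        have "\<delta> z \<le> dist z k" using that by (intro \<delta>_le) (simp add: B_def)
        then have "\<delta> z < K1 * rad r k" using 1 by (simp add: dist_commute)
        then show "\<delta> z / K1 < rad r k" using K(1) by (simp add: field_simps)
      qed
      \<comment> \<open>All radii in \<open>B\<close> exceed \<open>s\<close> and stay below
        \<open>\<delta> z / \<kappa>1\<close>; so \<open>s\<close> is a separation and a fixed
        multiple of it a containing radius.\<close>
      define s where "s = \<delta> z / K1"
      obtain k0 where "k0 \<in> B" using False by blast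
      then have "0 < \<kappa>1 * rad r k0" using \<kappa>1_pos radius_funD(4)[OF rad_radius_fun[OF r]] by simp
      then have s: "0 < s" using b(3)[OF \<open>k0 \<in> B\<close>] K(1) by (simp add: s_def)
      show ?thesis
      proof (rule packing_boundD(2)[OF N2 s])
        show "B \<subseteq> ball z (K1 * K1 / \<kappa>1 * s)"
        proof
          fix k assume k: "k \<in> B"
          have "rad r k < \<delta> z / \<kappa>1" using b(3)[OF k] \<kappa>1_pos by (simp add: field_simps)
          then have "K1 * rad r k < K1 * (\<delta> z / \<kappa>1)" using K(1) by (rule mult_strict_left_mono)
          then have "dist k z < K1 * (\<delta> z / \<kappa>1)" using b(2)[OF k] by linarith
          also have "\<dots> = K1 * K1 / \<kappa>1 * s" using K(1) by (simp add: s_def)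
          finally show "k \<in> ball z (K1 * K1 / \<kappa>1 * s)" by (simp add: dist_commute)
        qed
        show "pairwise (\<lambda>x y. s \<le> dist x y) B"
          unfolding pairwise_def
        proof (intro ballI impI)
          fix x y assume xy: "x \<in> B" "y \<in> B" "x \<noteq> y"
          then have "min (rad r x) (rad r y) \<le> dist x y" using T by (intro netD(1)[OF S]) (auto simp: B_def)
          then show "s \<le> dist x y" using b(1)[OF xy(1)] b(1)[OF xy(2)] unfolding s_def by linarith
        qed
      qed
    qed simp
    have "{k\<in>T. z \<in> region r k} = A \<union> B" by (auto simp: A_def B_def)
    then show "card {k\<in>T. z \<in> region r k} \<le> N1 + N2"
      using card_Un_le[of A B] A B by simp
  qed
  then show thesis by (rule that)
qed

text \<open>Smallness comes from \<open>\<Psi> (K0 * r)\<close>; the balls on the right have bounded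
  overlap because all their centres have radius \<open>r\<close>.\<close>

definition local_const :: "real \<Rightarrow> bool" where
  "local_const C \<longleftrightarrow> 0 \<le> C \<and> (\<forall>r Y a i k. 0 < r \<and> r \<le> Rmax \<and> coefficients r Y a \<and> adjacent (rad r) i k \<and>
     rad r k = r \<and> active i \<and> ball k (Lam * (K0 * r)) \<subseteq> U \<longrightarrow>
     Jp (ball k r) (\<lambda>x. a i - f x) \<le> ennreal (C * \<Psi> (K0 * r) * measure \<nu> (ball k (Lam * (K0 * r)))))"

lemma local_constD:
  assumes "local_const C"
  shows "0 \<le> C" "0 < r \<Longrightarrow> r \<le> Rmax \<Longrightarrow> coefficients r Y a \<Longrightarrow> adjacent (rad r) i k \<Longrightarrow>
     rad r k = r \<Longrightarrow> active i \<Longrightarrow> ball k (Lam * (K0 * r)) \<subseteq> U \<Longrightarrow>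
     Jp (ball k r) (\<lambda>x. a i - f x) \<le> ennreal (C * \<Psi> (K0 * r) * measure \<nu> (ball k (Lam * (K0 * r))))"
  using assms unfolding local_const_def by simp_all

text \<open>The ball of radius \<open>K0 * r\<close> about \<open>k\<close> contains both the ball
  of radius \<open>r\<close> and the reflected ball of \<open>i\<close>. Its dilation lies in
  \<open>U\<close>, so its own constant \<open>b\<close> links the two without a chain.\<close>

lemma local_const_exists:
  obtains C where "local_const C"
proof -
  obtain Cv where "volume_comparable (2 * K0 / \<sigma>0) Cv" by (rule volume_comparable_exists)
  note Cv = volume_comparableD[OF this]
  define C where "C = 2 powr p * (Cv * (2 powr p * 2) + 1) * CP"
  have C0: "0 \<le> C" using Cv(1) CP by (simp add: C_def)
  have "Jp (ball k r) (\<lambda>x. a i - f x) \<le> ennreal (C * \<Psi> (K0 * r) * measure \<nu> (ball k (Lam * (K0 * r))))"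
    if r: "0 < r" "r \<le> Rmax" and co: "coefficients r Y a" and ik: "adjacent (rad r) i k" and k: "rad r k = r"
      and i: "active i" and sub: "ball k (Lam * (K0 * r)) \<subseteq> U" for r Y a i k
  proof -
    let ?R = "ball k (Lam * (K0 * r))"
    note rb = reflected_ball[OF r co ik i, unfolded k]
    have K0r: "0 < K0 * r" "r \<le> K0 * r" using K0_ge_1 r by auto
    have LK: "K0 * r \<le> Lam * (K0 * r)" using mult_right_mono[OF Lam, of "K0 * r"] K0r by simp
    obtain b where b: "osc k (K0 * r) b" using osc_exists[OF K0r(1) sub] by blast
    define T0 where "T0 = CP * \<Psi> (K0 * r) * measure \<nu> ?R"
    have T0: "0 \<le> T0" using CP \<Psi>_pos[OF K0r(1)] by (simp add: T0_def)
    have 1: "Jp (ball k (K0 * r)) (\<lambda>x. f x - b) \<le> ennreal T0"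
      unfolding T0_def by (rule osc_le[OF b K0r(1)]) auto
    have ti: "0 < \<sigma>0 * rad r i" using \<sigma>0(1) radius_funD(4)[OF rad_radius_fun[OF r]] by simp
    have dk: "(11 * A1 + 4) * r + r \<le> K0 * r"
      using A1 r by (simp add: K0_def algebra_simps)
    have "r / (4 * Au) \<le> r" using Au r mult_right_mono[of 1 Au r] by (simp add: field_simps)
    then have sub2: "ball (Y i) (Lam * (\<sigma>0 * rad r i)) \<subseteq> ball k (K0 * r)"
    proof -
      assume q: "r / (4 * Au) \<le> r"
      show ?thesis
      proof
        fix z assume "z \<in> ball (Y i) (Lam * (\<sigma>0 * rad r i))"
        then have "dist (Y i) z < r" using rb(3) q by simp
        then show "z \<in> ball k (K0 * r)" using dist_triangle[of k z "Y i"] rb(1) dk unfolding mem_ball by linarith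
      qed
    qed
    have 2: "Jp (ball (Y i) (\<sigma>0 * rad r i)) (\<lambda>x. f x - a i) \<le> ennreal T0"
      unfolding T0_def
    proof (rule osc_le[OF coefficientsD(3)[OF co i] ti])
      show "\<sigma>0 * rad r i \<le> K0 * r" using rb(5) K0r by linarith
      show "ball (Y i) (Lam * (\<sigma>0 * rad r i)) \<subseteq> ?R" using sub2 subset_ball[OF LK] by blast
    qed simp
    have s1: "ball (Y i) (\<sigma>0 * rad r i) \<subseteq> ball (Y i) (Lam * (\<sigma>0 * rad r i))"
      using mult_right_mono[OF Lam, of "\<sigma>0 * rad r i"] ti by (intro subset_ball) linarith
    have le: "\<bar>a i - b\<bar> powr p * mb (Y i) (\<sigma>0 * rad r i) \<le> 2 powr p * (T0 + T0)"
      by (rule oscillation_compare[OF f_measurable _ _ _ emeasure_ball 2 1 T0 T0]) (use s1 sub2 in auto)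
    have Kr: "K0 * r \<le> 2 * K0 / \<sigma>0 * (\<sigma>0 * rad r i)"
    proof -
      have "r \<le> 2 * rad r i" using rb(4) \<sigma>0(1) by simp
      then have "K0 * r \<le> K0 * (2 * rad r i)" using K0_ge_1 by (intro mult_left_mono) auto
      then show ?thesis using \<sigma>0(1) by simp
    qed
    have "mb k r \<le> Cv * mb (Y i) (\<sigma>0 * rad r i)"
      using rb(1) dk r K0r Kr by (intro Cv(2)[OF ti]) linarith+
    then have "\<bar>a i - b\<bar> powr p * mb k r \<le> \<bar>a i - b\<bar> powr p * (Cv * mb (Y i) (\<sigma>0 * rad r i))"
      by (intro mult_left_mono) auto
    also have "\<dots> = Cv * (\<bar>a i - b\<bar> powr p * mb (Y i) (\<sigma>0 * rad r i))" by simp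
    also have "\<dots> \<le> Cv * (2 powr p * (T0 + T0))" using le Cv(1) by (intro mult_left_mono) auto
    finally have ab: "\<bar>a i - b\<bar> powr p * mb k r \<le> Cv * (2 powr p * (T0 + T0))" .
    have "Jp (ball k r) (\<lambda>x. a i - f x) \<le> ennreal (2 powr p) * (Jp (ball k r) (\<lambda>x. a i - b) + Jp (ball k r) (\<lambda>x. b - f x))"
      by (rule Jp_diff_trans) auto
    also have "\<dots> \<le> ennreal (2 powr p) * (ennreal (Cv * (2 powr p * (T0 + T0))) + ennreal T0)"
    proof (intro mult_left_mono add_mono)
      have "Jp (ball k r) (\<lambda>x. a i - b) = ennreal (\<bar>a i - b\<bar> powr p * mb k r)"
        by (simp add: Jp_const emeasure_ball ennreal_mult)
      then show "Jp (ball k r) (\<lambda>x. a i - b) \<le> ennreal (Cv * (2 powr p * (T0 + T0)))"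
        using ab by (simp add: ennreal_leI)
      have "Jp (ball k r) (\<lambda>x. f x - b) \<le> Jp (ball k (K0 * r)) (\<lambda>x. f x - b)"
        by (rule Jp_mono_set) (use K0r in auto)
      then show "Jp (ball k r) (\<lambda>x. b - f x) \<le> ennreal T0" using 1 by (simp add: Jp_diff_commute)
    qed simp
    also have "\<dots> = ennreal (2 powr p * (Cv * (2 powr p * (T0 + T0)) + T0))"
      using T0 Cv(1) by (simp add: ennreal_mult ennreal_plus)
    also have "2 powr p * (Cv * (2 powr p * (T0 + T0)) + T0) = C * \<Psi> (K0 * r) * measure \<nu> ?R"
      by (simp add: C_def T0_def algebra_simps)
    finally show ?thesis .
  qed
  then have "local_const C" unfolding local_const_def using C0 by blast
  then show thesis by (rule that)
qed

end

section \<open>Approximants and the extension\<close>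

context uniform_extension
begin

text \<open>Room around a ball for a centre whose net ball meets it (\<open>r\<close>), for the
  dilated ball about that centre (\<open>Lam * K0 * r\<close>), and for its neighbours
  (\<open>3 * A1 * r\<close>).\<close>

definition K2 :: real where "K2 = 1 + Lam * K0 + 3 * A1"

text \<open>Contains the regions of all centres whose balls meet the frontier. The strict inequality
  makes the shells decrease to the empty set, so their measures tend to 0.\<close>

definition shell :: "real \<Rightarrow> 'a set" where
  "shell r = {z. 0 < \<delta> z \<and> \<delta> z \<le> (K1 + 1) * r}"

lemma shell_borel [measurable]: "shell r \<in> sets borel"
proof -
  have "open {z. 0 < \<delta> z}" by (intro open_Collect_less continuous_intros)
  moreover have "closed {z. \<delta> z \<le> (K1 + 1) * r}" by (intro closed_Collect_le continuous_intros)
  moreover have "shell r = {z. 0 < \<delta> z} \<inter> {z. \<delta> z \<le> (K1 + 1) * r}" by (auto simp: shell_def)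
  ultimately show ?thesis by (auto intro: borel_open borel_closed)
qed

text \<open>\<open>J\<close> is the slack by which regions of centres near the truncation radius may
  reach inwards.\<close>

lemma tail_measure_small:
  assumes "0 < e"
  obtains L where "L1 \<le> L" "measure \<nu> (- ball w1 (L - J)) \<le> e"
proof -
  define A where "A n = - ball w1 (real n)" for n
  have "(\<lambda>n. measure \<nu> (A n)) \<longlonglongrightarrow> measure \<nu> (\<Inter>n. A n)"
    by (rule \<nu>.finite_Lim_measure_decseq) (auto simp: A_def sets_\<nu> decseq_def)
  moreover have "(\<Inter>n. A n) = {}"
  proof (rule equals0I)
    fix y assume y: "y \<in> (\<Inter>n. A n)"
    obtain n where "dist w1 y < real n" using reals_Archimedean2 by blast
    then have "y \<notin> A n" by (simp add: A_def)
    then show False using y by blast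
  qed
  ultimately have "\<forall>\<^sub>F n in sequentially. measure \<nu> (A n) < e"
    using assms by (intro order_tendstoD(2)) auto
  then obtain n where n: "measure \<nu> (A n) < e" by (auto simp: eventually_sequentially)
  define L where "L = max L1 (real n + J)"
  have "- ball w1 (L - J) \<subseteq> A n" by (auto simp: A_def L_def)
  then have "measure \<nu> (- ball w1 (L - J)) \<le> measure \<nu> (A n)"
    by (intro \<nu>.finite_measure_mono) (auto simp: A_def sets_\<nu>)
  then show thesis using that[of L] n by (simp add: L_def)
qed

text \<open>The bound \<open>1 / r\<close> confines the local estimate to where the truncation of
  the coefficients is not felt; as \<open>r\<close> tends to 0 this part exhausts the space.\<close>

definition approximant :: "real \<Rightarrow> real \<Rightarrow> ('a \<Rightarrow> real) \<Rightarrow> bool" where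
  "approximant C r u \<longleftrightarrow> u \<in> \<F> \<and> \<E> u \<le> C \<and> Jp UNIV u \<le> ennreal C \<and>
     measure (\<Gamma> u) (frontier U) \<le> C * (measure \<nu> (shell r) + r) \<and>
     (\<forall>z s. 0 < s \<and> ball z (s + K2 * r) \<subseteq> U \<and> dist w1 z + s + K2 * r \<le> 1 / r \<longrightarrow>
        Jp (ball z s) (\<lambda>x. u x - f x) \<le> ennreal (C * \<Psi> (K0 * r)))"

lemma approximantD:
  assumes "approximant C r u"
  shows "u \<in> \<F>" "\<E> u \<le> C" "Jp UNIV u \<le> ennreal C"
    "measure (\<Gamma> u) (frontier U) \<le> C * (measure \<nu> (shell r) + r)"
    "0 < s \<Longrightarrow> ball z (s + K2 * r) \<subseteq> U \<Longrightarrow> dist w1 z + s + K2 * r \<le> 1 / r \<Longrightarrow>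
        Jp (ball z s) (\<lambda>x. u x - f x) \<le> ennreal (C * \<Psi> (K0 * r))"
  using assms unfolding approximant_def by blast+

text \<open>The coefficients are cut off outside a ball so large that the energy created by the cutoff is negligible.\<close>

lemma approximant_exists:
  obtains C where "0 \<le> C" "\<forall>r. 0 < r \<and> r \<le> Rmax \<longrightarrow> (\<exists>u. approximant C r u)"
proof -
  obtain N where N: "nbr_bound N" by (rule nbr_bound_exists)
  obtain Cp where Cp: "0 \<le> Cp" and pou_ex: "\<forall>\<rho> r S. radius_fun \<rho> r \<and> net \<rho> S \<longrightarrow> (\<exists>\<psi>. partition_of_unity \<rho> S \<psi> Cp)"
    by (rule partition_of_unity_exists)
  obtain Cc where Ccc: "coef_const Cc" by (rule coef_const_exists)
  note Cc = coef_constD[OF Ccc]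
  obtain M where M: "overlap_bound M" by (rule overlap_bound_exists)
  obtain Cl where Clc: "local_const Cl" by (rule local_const_exists)
  note Cl = local_constD[OF Clc]
  have LK0: "1 \<le> Lam * K0" using Lam K0_ge_1 mult_mono[of 1 Lam 1 K0] by simp
  obtain M2 where M2: "packing_bound (Lam * K0) M2"
    by (rule packing_bound_exists[of "Lam * K0"]) (use LK0 in simp)
  let ?V = "measure \<nu> UNIV"
  define D where "D = (real N * Cp) powr p * (Cc * real M)"
  define E1 where "E1 = D * (?V + Rmax)"
  define E2 where "E2 = real N * Cc * real M * ?V"
  define E3 where "E3 = real N * Cl * real M2 * ?V"
  define C where "C = E1 + D + E2 + E3"
  have nn: "0 \<le> D" "0 \<le> E1" "0 \<le> E2" "0 \<le> E3"
    using Cc(1) Cl(1) Rmax by (auto simp: D_def E1_def E2_def E3_def)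
  have C0: "0 \<le> C" using nn by (simp add: C_def)
  have V: "measure \<nu> B \<le> ?V" if "B \<in> sets borel" for B
    using that by (intro \<nu>.finite_measure_mono) (auto simp: sets_\<nu>)
  have "\<exists>u. approximant C r u" if r: "0 < r" "r \<le> Rmax" for r
  proof -
    define \<rho> where "\<rho> = rad r"
    have \<rho>f: "radius_fun \<rho> r" unfolding \<rho>_def by (rule rad_radius_fun[OF r])
    note \<rho>D = radius_funD[OF \<rho>f]
    obtain S where S: "net \<rho> S" by (rule net_exists[OF \<rho>f])
    note S' = S[unfolded \<rho>_def]
    obtain Y a where co: "coefficients r Y a" by (rule coefficients_exist[OF r])
    obtain \<psi> where pou: "partition_of_unity \<rho> S \<psi> Cp" using pou_ex \<rho>f S by blast
    note nb = nbr_boundD[OF N \<rho>f S]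
    have Pr: "0 < \<Psi> r" by (rule \<Psi>_pos[OF r(1)])
    have \<rho>R: "\<rho> x \<le> Rmax" for x by (simp add: \<rho>_def rad_le_Rmax)
    \<comment> \<open>Inward reach of an edge centre: it may lie \<open>3 * A1 * Rmax\<close> inside
      the truncation radius, and its region extends at most \<open>K1 * Rmax\<close>
      further.\<close>
    define J where "J = (3 * A1 + K1) * Rmax"
    \<comment> \<open>The tail measure will be divided by \<open>\<Psi> r\<close>; this choice
      leaves a contribution of order \<open>r\<close>.\<close>
    have "0 < r * \<Psi> r" using r Pr by simp
    then obtain L where L: "1 / r \<le> L" "measure \<nu> (- ball w1 (L - J)) \<le> r * \<Psi> r"
      by (rule tail_measure_small)
    define F where "F = S \<inter> ball w1 L"
    have F: "finite F" "F \<subseteq> S" unfolding F_def using net_countable(1)[OF \<rho>f S] by auto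
    define a' where "a' i = (if i \<in> F then a i else 0)" for i
    have a'0: "a' i = 0" if "i \<notin> F" for i using that by (simp add: a'_def)
    define edge where "edge k \<longleftrightarrow> L - 3 * A1 * Rmax \<le> dist w1 k" for k
    define R where "R k = region r k" for k
    have Rb: "R k \<in> sets borel" for k unfolding R_def by (rule deep_region_borel)
    \<comment> \<open>The second summand pays for jumps between kept and removed coefficients, which
      occur at edge centres only.\<close>
    define b where "b k = Cc * measure \<nu> (R k) + (if edge k then Cc / \<Psi> r * measure \<nu> (R k) else 0)" for k
    have adj: "adjacent (rad r) i k" if "i \<in> nbr \<rho> S k" for i k using that by (simp add: nbr_def \<rho>_def)
    have mean: "\<bar>a i\<bar> powr p * mb k (\<rho> k) \<le> Cc * measure \<nu> (R k)" if "i \<in> nbr \<rho> S k" for i k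
      using Cc(3)[OF r co adj[OF that]] by (simp add: \<rho>_def R_def)
    have mean_w: "\<bar>a i\<bar> powr p * weight \<rho> k \<le> Cc / \<Psi> r * measure \<nu> (R k)" if i: "i \<in> nbr \<rho> S k" for i k
    proof -
      have P: "\<Psi> r \<le> \<Psi> (\<rho> k)" using \<rho>D by (intro \<Psi>_mono) auto
      have "\<bar>a i\<bar> powr p * weight \<rho> k \<le> Cc * measure \<nu> (R k) / \<Psi> (\<rho> k)"
        using mean[OF i] P Pr by (simp add: weight_def divide_right_mono)
      also have "\<dots> \<le> Cc * measure \<nu> (R k) / \<Psi> r"
        using P Pr Cc(1) by (intro divide_left_mono) auto
      finally show ?thesis by simp
    qed
    have b: "\<bar>a' i - a' k\<bar> powr p * weight \<rho> k \<le> b k" if k: "k \<in> S" and i: "i \<in> nbr \<rho> S k" for i k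
    proof -
      have iS: "i \<in> S" using i by (simp add: nbr_def)
      have kk: "k \<in> nbr \<rho> S k" by (rule self_nbr[OF \<rho>f k])
      have pos: "0 \<le> Cc * measure \<nu> (R k)" "0 \<le> Cc / \<Psi> r * measure \<nu> (R k)" using Cc(1) Pr by auto
      consider "i \<in> F" "k \<in> F" | "i \<in> F" "k \<notin> F" | "i \<notin> F" "k \<in> F" | "i \<notin> F" "k \<notin> F" by blast
      then show ?thesis
      proof cases
        case 1
        then have "\<bar>a' i - a' k\<bar> powr p * weight \<rho> k \<le> Cc * measure \<nu> (R k)"
          using Cc(2)[OF r co adj[OF i]] by (simp add: a'_def \<rho>_def R_def)
        then show ?thesis using pos by (simp add: b_def)
      next
        case 2
        then have "L \<le> dist w1 k" using k by (auto simp: F_def)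
        moreover have "0 \<le> 3 * A1 * Rmax" using A1 Rmax by simp
        ultimately have "edge k" by (simp add: edge_def)
        then show ?thesis using mean_w[OF i] pos 2 by (simp add: b_def a'_def)
      next
        case 3
        then have "L \<le> dist w1 i" using iS by (auto simp: F_def)
        moreover have "dist i k < 3 * A1 * \<rho> k" using adjacent_dist[OF \<rho>f] i by (simp add: nbr_def)
        moreover have "3 * A1 * \<rho> k \<le> 3 * A1 * Rmax" using \<rho>R[of k] A1 by (intro mult_left_mono) auto
        ultimately have "edge k" using dist_triangle[of w1 i k] by (simp add: edge_def dist_commute)
        then show ?thesis using mean_w[OF kk] pos 3 by (simp add: b_def a'_def)
      next
        case 4
        then show ?thesis using pos by (simp add: b_def a'_def)
      qed
    qed
    define T where "T = (\<Union>i\<in>F. nbr \<rho> S i)"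
    have T: "finite T" "T \<subseteq> S" unfolding T_def using F nb(1) by (auto simp: nbr_def)
    have TF: "k \<in> T" if k: "k \<in> S" and ne: "nbr \<rho> S k \<inter> F \<noteq> {}" for k
    proof -
      obtain i where "i \<in> nbr \<rho> S k" "i \<in> F" using ne by blast
      then have "k \<in> nbr \<rho> S i" using k adjacent_sym by (auto simp: nbr_def)
      then show ?thesis using \<open>i \<in> F\<close> by (auto simp: T_def)
    qed
    define u where "u = (\<lambda>x. \<Sum>i\<in>F. a' i * \<psi> i x)"
    have uF: "u \<in> \<F>" unfolding u_def
      by (rule function_subspace_sum[OF F_subspace F(1)]) (use partition_of_unityD(1)[OF pou] F(2) in auto)
    have ovl: "(\<Sum>k\<in>T'. measure \<nu> (R k)) \<le> real M * measure \<nu> H"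
      if "T' \<subseteq> T" "H \<in> sets borel" "\<And>k. k \<in> T' \<Longrightarrow> R k \<subseteq> H" for T' H
    proof (rule \<nu>.sum_measure_overlap_le)
      show "finite T'" using T(1) that(1) by (rule finite_subset[rotated])
      show "card {k \<in> T'. z \<in> R k} \<le> M" for z
        unfolding R_def by (rule overlap_boundD[OF M r S']) (use that(1) T(2) in blast)
    qed (use that Rb in \<open>auto simp: sets_\<nu>\<close>)
    \<comment> \<open>Used twice: with the whole space for \<open>G\<close> and \<open>H\<close>,
      and with the frontier for \<open>G\<close> and the shell for \<open>H\<close>.\<close>
    have energy: "measure (\<Gamma> u) G \<le> D * (measure \<nu> H + r)"
      if G: "G \<in> sets borel" and H: "H \<in> sets borel" "\<And>k. k \<in> S \<Longrightarrow> ball k (\<rho> k) \<inter> G \<noteq> {} \<Longrightarrow> R k \<subseteq> H" for G H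
    proof -
      let ?T = "{k\<in>T. ball k (\<rho> k) \<inter> G \<noteq> {}}"
      have far: "R k \<subseteq> - ball w1 (L - J)" if "edge k" for k
      proof
        fix z assume "z \<in> R k"
        then have "dist k z < K1 * \<rho> k" by (simp add: R_def \<rho>_def deep_region_def)
        moreover have "K1 * \<rho> k \<le> K1 * Rmax" using \<rho>R K1_ge_1 by (intro mult_left_mono) auto
        ultimately show "z \<in> - ball w1 (L - J)"
          using that dist_triangle[of w1 k z] by (simp add: edge_def J_def algebra_simps dist_commute)
      qed
      have "(\<Sum>k\<in>?T. if edge k then Cc / \<Psi> r * measure \<nu> (R k) else 0)
          = (\<Sum>k\<in>{k\<in>?T. edge k}. Cc / \<Psi> r * measure \<nu> (R k))"
        using T(1) by (intro sum.inter_filter[symmetric]) auto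
      also have "\<dots> = Cc / \<Psi> r * (\<Sum>k\<in>{k\<in>?T. edge k}. measure \<nu> (R k))" by (simp add: sum_distrib_left)
      also have "\<dots> \<le> Cc / \<Psi> r * (real M * measure \<nu> (- ball w1 (L - J)))"
        using Cc(1) Pr far by (intro mult_left_mono ovl) auto
      also have "\<dots> \<le> Cc / \<Psi> r * (real M * (r * \<Psi> r))"
        using Cc(1) Pr L(2) by (intro mult_left_mono) auto
      also have "\<dots> = Cc * real M * r" using Pr by simp
      finally have 1: "(\<Sum>k\<in>?T. if edge k then Cc / \<Psi> r * measure \<nu> (R k) else 0) \<le> Cc * real M * r" .
      have "(\<Sum>k\<in>?T. Cc * measure \<nu> (R k)) = Cc * (\<Sum>k\<in>?T. measure \<nu> (R k))" by (simp add: sum_distrib_left)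
      also have "\<dots> \<le> Cc * (real M * measure \<nu> H)"
        using Cc(1) H T(2) by (intro mult_left_mono ovl) auto
      finally have 2: "(\<Sum>k\<in>?T. Cc * measure \<nu> (R k)) \<le> Cc * real M * measure \<nu> H" by (simp add: mult.assoc)
      have "(\<Sum>k\<in>?T. b k) \<le> Cc * real M * (measure \<nu> H + r)"
        using 1 2 by (simp add: b_def sum.distrib distrib_left)
      moreover have "measure (\<Gamma> u) G \<le> (real N * Cp) powr p * (\<Sum>k\<in>?T. b k)"
        unfolding u_def
      proof (rule discrete_energy[OF \<rho>f S pou N F _ Cp _ T _ G])
        show "a' i = 0" if "i \<notin> F" for i using that by (rule a'0)
        show "\<bar>a' i - a' k\<bar> powr p * weight \<rho> k \<le> b k" if "k \<in> S" "i \<in> nbr \<rho> S k" for k i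
          using that by (rule b)
        show "k \<in> T" if "k \<in> S" "nbr \<rho> S k \<inter> F \<noteq> {}" for k using that by (rule TF)
      qed
      moreover have "(real N * Cp) powr p * (\<Sum>k\<in>?T. b k) \<le> (real N * Cp) powr p * (Cc * real M * (measure \<nu> H + r))"
        using calculation(1) by (intro mult_left_mono) auto
      ultimately show ?thesis by (simp add: D_def mult.assoc)
    qed
    have "approximant C r u"
      unfolding approximant_def
    proof (intro conjI allI impI uF; (elim conjE)?)
      have "\<E> u \<le> D * (?V + r)" unfolding E_eq_\<Gamma>[OF uF] by (rule energy) auto
      also have "\<dots> \<le> E1" unfolding E1_def using nn r by (intro mult_left_mono) auto
      also have "\<dots> \<le> C" using nn by (simp add: C_def)
      finally show "\<E> u \<le> C" .
      have "measure (\<Gamma> u) (frontier U) \<le> D * (measure \<nu> (shell r) + r)"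
      proof (rule energy)
        show "frontier U \<in> sets borel" by (intro borel_closed frontier_closed)
        fix k assume k: "k \<in> S" "ball k (\<rho> k) \<inter> frontier U \<noteq> {}"
        then obtain x where x: "dist k x < \<rho> k" "x \<in> frontier U" by auto
        \<comment> \<open>Being outside the open set \<open>U\<close>, frontier points bound
          \<open>\<delta>\<close> from above; being in its closure, they force the radius
          \<open>r\<close> on every centre whose ball contains them.\<close>
        have xU: "x \<notin> U" "x \<in> closure U" using x(2) openU by (auto simp: frontier_def interior_open)
        have "infdist x U = 0" using xU(2) in_closure_iff_infdist_zero[of U x] w12 by auto
        then have "infdist k U \<le> dist k x" using infdist_triangle[of k U x] by simp
        then have \<rho>k: "\<rho> k = r" using rad_near[OF r, of k] x(1) by (simp add: \<rho>_def)
        show "R k \<subseteq> shell r"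
        proof
          fix z assume "z \<in> R k"
          then have z: "dist k z < K1 * r" "\<kappa>1 * r < \<delta> z" using \<rho>k by (auto simp: R_def deep_region_def \<rho>_def)
          have "\<delta> z \<le> dist z x" by (rule \<delta>_le[OF xU(1)])
          also have "\<dots> \<le> dist k z + dist k x" using dist_triangle[of z x k] by (simp add: dist_commute)
          also have "\<dots> \<le> (K1 + 1) * r" using z(1) x(1) \<rho>k by (simp add: algebra_simps)
          finally have "\<delta> z \<le> (K1 + 1) * r" .
          moreover have "0 < \<kappa>1 * r" using \<kappa>1_pos r by simp
          ultimately show "z \<in> shell r" using z(2) by (simp add: shell_def)
        qed
      qed auto
      also have "\<dots> \<le> C * (measure \<nu> (shell r) + r)"
        using nn r by (intro mult_right_mono) (auto simp: C_def)
      finally show "measure (\<Gamma> u) (frontier U) \<le> C * (measure \<nu> (shell r) + r)" .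
    next
      let ?B = "\<Union>k\<in>T. ball k (\<rho> k)"
      have out: "u x = 0" if "x \<notin> ?B" for x
      proof -
        obtain k where k: "k \<in> S" "dist k x < \<rho> k" using netD(2)[OF S] by blast
        then have "k \<notin> T" using that by auto
        then have "nbr \<rho> S k \<inter> F = {}" using TF k by blast
        then have "(\<Sum>i\<in>nbr \<rho> S k. a' i * \<psi> i x) = 0" using a'0 by (intro sum.neutral) auto
        moreover have "u x = (\<Sum>i\<in>nbr \<rho> S k. a' i * \<psi> i x)"
          unfolding u_def by (rule discrete_sum_local[OF \<rho>f S pou N F a'0 k])
        ultimately show ?thesis by simp
      qed
      have "Jp UNIV u = Jp ?B u"
        unfolding Jp_def
      proof (rule nn_integral_cong)
        fix x show "ennreal (\<bar>u x\<bar> powr p) * indicator UNIV x = ennreal (\<bar>u x\<bar> powr p) * indicator ?B x"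
          using out[of x] by (cases "x \<in> ?B") simp_all
      qed
      also have "\<dots> \<le> (\<Sum>k\<in>T. \<Sum>i\<in>nbr \<rho> S k. Jp (ball k (\<rho> k)) (\<lambda>x. a' i - 0))"
        using discrete_Jp[where h="\<lambda>_. 0" and D="?B", OF \<rho>f S pou N F a'0 T] by (simp add: u_def)
      also have "\<dots> \<le> (\<Sum>k\<in>T. \<Sum>i\<in>nbr \<rho> S k. ennreal (Cc * measure \<nu> (R k)))"
      proof (intro sum_mono)
        fix k i assume ki: "k \<in> T" "i \<in> nbr \<rho> S k"
        have "\<bar>a' i\<bar> powr p * mb k (\<rho> k) \<le> \<bar>a i\<bar> powr p * mb k (\<rho> k)"
          by (intro mult_right_mono) (auto simp: a'_def)
        then have "\<bar>a' i\<bar> powr p * mb k (\<rho> k) \<le> Cc * measure \<nu> (R k)" using mean[OF ki(2)] by linarith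
        then show "Jp (ball k (\<rho> k)) (\<lambda>x. a' i - 0) \<le> ennreal (Cc * measure \<nu> (R k))"
          by (simp add: Jp_const emeasure_ball ennreal_mult[symmetric] ennreal_leI)
      qed
      also have "\<dots> = ennreal (\<Sum>k\<in>T. real (card (nbr \<rho> S k)) * (Cc * measure \<nu> (R k)))"
        using Cc(1) by (simp add: sum_ennreal ennreal_mult[symmetric] ennreal_of_nat_eq_real_of_nat)
      also have "\<dots> \<le> ennreal C"
      proof (rule ennreal_leI)
        have "(\<Sum>k\<in>T. real (card (nbr \<rho> S k)) * (Cc * measure \<nu> (R k))) \<le> (\<Sum>k\<in>T. real N * (Cc * measure \<nu> (R k)))"
          using nb(2) Cc(1) by (intro sum_mono mult_right_mono) auto
        also have "\<dots> = real N * Cc * (\<Sum>k\<in>T. measure \<nu> (R k))" by (simp add: sum_distrib_left mult.assoc)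
        also have "\<dots> \<le> real N * Cc * (real M * ?V)"
          using Cc(1) by (intro mult_left_mono ovl) auto
        also have "\<dots> = E2" by (simp add: E2_def)
        also have "\<dots> \<le> C" using nn by (simp add: C_def)
        finally show "(\<Sum>k\<in>T. real (card (nbr \<rho> S k)) * (Cc * measure \<nu> (R k))) \<le> C" .
      qed
      finally show "Jp UNIV u \<le> ennreal C" .
    next
      fix z s assume s: "0 < s" and zU: "ball z (s + K2 * r) \<subseteq> U" and zL: "dist w1 z + s + K2 * r \<le> 1 / r"
      \<comment> \<open>These centres have radius exactly \<open>r\<close>, and their neighbours are
        active and keep their coefficients under truncation.\<close>
      define TD where "TD = {k\<in>S. ball k (\<rho> k) \<inter> ball z s \<noteq> {}}"
      have K2r: "K2 * r = r + Lam * (K0 * r) + 3 * (A1 * r)" by (simp add: K2_def algebra_simps)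
      have pos3: "0 < Lam * (K0 * r)" "0 < A1 * r" using Lam K0_ge_1 A1 r by auto
      have zs: "ball z s \<subseteq> U" using zU subset_ball[of s "s + K2 * r" z] K2r pos3 r by auto
      have near: "\<rho> k = r \<and> dist z k < s + r \<and> infdist k U < r" if k: "k \<in> TD" for k
      proof -
        obtain x where x: "dist k x < \<rho> k" "dist z x < s" using k by (auto simp: TD_def)
        have "x \<in> U" using x(2) zs by auto
        then have i: "infdist k U \<le> dist k x" by (rule infdist_le)
        then have "\<rho> k = r" using rad_near[OF r, of k] x(1) by (simp add: \<rho>_def)
        then show ?thesis using x i dist_triangle[of z k x] by (simp add: dist_commute)
      qed
      have TDf: "finite TD"
      proof (rule finite_subset)
        show "TD \<subseteq> S \<inter> ball z (s + r)"
        proof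
          fix k assume k: "k \<in> TD"
          then have "k \<in> S" by (simp add: TD_def)
          then show "k \<in> S \<inter> ball z (s + r)" using near[OF k] by simp
        qed
        show "finite (S \<inter> ball z (s + r))" by (rule net_countable(1)[OF \<rho>f S])
      qed
      have subk: "ball k (Lam * (K0 * r)) \<subseteq> U" if k: "k \<in> TD" for k
      proof
        fix x assume "x \<in> ball k (Lam * (K0 * r))"
        then have "x \<in> ball z (s + K2 * r)"
          using near[OF k] dist_triangle[of z x k] K2r pos3 by simp
        then show "x \<in> U" using zU by blast
      qed
      have est: "Jp (ball k (\<rho> k)) (\<lambda>x. a' i - f x) \<le> ennreal (Cl * \<Psi> (K0 * r) * measure \<nu> (ball k (Lam * (K0 * r))))"
        if k: "k \<in> TD" and i: "i \<in> nbr \<rho> S k" for k i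
      proof -
        note nk = near[OF k]
        have d: "dist i k < 3 * A1 * \<rho> k" using adjacent_dist[OF \<rho>f] i by (simp add: nbr_def)
        have "dist w1 i \<le> dist w1 z + dist z k + dist k i"
          using dist_triangle[of w1 i z] dist_triangle[of z i k] by simp
        also have "\<dots> < 1 / r" using d nk zL K2r pos3 by (simp add: dist_commute)
        finally have "i \<in> F" using i L(1) by (simp add: F_def nbr_def)
        then have ai: "a' i = a i" by (simp add: a'_def)
        have "infdist i U \<le> infdist k U + dist i k" by (rule infdist_triangle)
        also have "\<dots> < 4 * A1 * r"
        proof -
          have "r < A1 * r" "dist i k < 3 * A1 * r" "infdist k U < r" using A1 r nk d by simp_all
          then show ?thesis by linarith
        qed
        finally have "infdist i U / (4 * A1) < r" using A1 by (simp add: field_simps)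
        then have "active i" using r by (simp add: active_def)
        moreover have "rad r k = r" using nk by (simp add: \<rho>_def)
        ultimately show ?thesis
          using Cl(2)[OF r co adj[OF i] _ _ subk[OF k]] ai nk by simp
      qed
      have "Jp (ball z s) (\<lambda>x. u x - f x) \<le> (\<Sum>k\<in>TD. \<Sum>i\<in>nbr \<rho> S k. Jp (ball k (\<rho> k)) (\<lambda>x. a' i - f x))"
        unfolding u_def
      proof (rule discrete_Jp[OF \<rho>f S pou N F a'0 TDf])
        show "TD \<subseteq> S" by (auto simp: TD_def)
        show "ball z s \<subseteq> (\<Union>k\<in>TD. ball k (\<rho> k))"
        proof
          fix x assume x: "x \<in> ball z s"
          obtain k where k: "k \<in> S" "dist k x < \<rho> k" using netD(2)[OF S] by blast
          then have xk: "x \<in> ball k (\<rho> k)" by simp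
          then have "k \<in> TD" using x k(1) unfolding TD_def by blast
          then show "x \<in> (\<Union>k\<in>TD. ball k (\<rho> k))" using xk by blast
        qed
      qed auto
      also have "\<dots> \<le> (\<Sum>k\<in>TD. \<Sum>i\<in>nbr \<rho> S k. ennreal (Cl * \<Psi> (K0 * r) * measure \<nu> (ball k (Lam * (K0 * r)))))"
        by (intro sum_mono est)
      also have "\<dots> = ennreal (\<Sum>k\<in>TD. real (card (nbr \<rho> S k)) * (Cl * \<Psi> (K0 * r) * measure \<nu> (ball k (Lam * (K0 * r)))))"
      proof -
        have "0 \<le> Cl * \<Psi> (K0 * r) * measure \<nu> (ball k (Lam * (K0 * r)))" for k
          using Cl(1) \<Psi>_pos[of "K0 * r"] K0_ge_1 r by simp
        then show ?thesis by (simp add: sum_ennreal ennreal_mult[symmetric] ennreal_of_nat_eq_real_of_nat)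
      qed
      also have "\<dots> \<le> ennreal (C * \<Psi> (K0 * r))"
      proof (rule ennreal_leI)
        have PK: "0 < \<Psi> (K0 * r)" using \<Psi>_pos[of "K0 * r"] K0_ge_1 r by simp
        have "(\<Sum>k\<in>TD. real (card (nbr \<rho> S k)) * (Cl * \<Psi> (K0 * r) * measure \<nu> (ball k (Lam * (K0 * r)))))
          \<le> (\<Sum>k\<in>TD. real N * (Cl * \<Psi> (K0 * r) * measure \<nu> (ball k (Lam * (K0 * r)))))"
          using nb(2) Cl(1) PK by (intro sum_mono mult_right_mono) auto
        also have "\<dots> = real N * Cl * \<Psi> (K0 * r) * (\<Sum>k\<in>TD. measure \<nu> (ball k (Lam * (K0 * r))))"
          by (simp add: sum_distrib_left mult.assoc)
        also have "\<dots> \<le> real N * Cl * \<Psi> (K0 * r) * (real M2 * ?V)"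
        proof (intro mult_left_mono \<nu>.sum_measure_overlap_le[OF TDf])
          fix x
          \<comment> \<open>Equal radii make these centres \<open>r\<close>-separated, so packing
            bounds the overlap of the dilated balls.\<close>
          show "card {k \<in> TD. x \<in> ball k (Lam * (K0 * r))} \<le> M2"
          proof (rule packing_boundD(2)[OF M2 r(1)])
            show "{k \<in> TD. x \<in> ball k (Lam * (K0 * r))} \<subseteq> ball x (Lam * K0 * r)"
              by (auto simp: dist_commute mult.assoc)
            show "pairwise (\<lambda>x y. r \<le> dist x y) {k \<in> TD. x \<in> ball k (Lam * (K0 * r))}"
              unfolding pairwise_def
            proof (intro ballI impI)
              fix x' y' assume xy: "x' \<in> {k \<in> TD. x \<in> ball k (Lam * (K0 * r))}"
                "y' \<in> {k \<in> TD. x \<in> ball k (Lam * (K0 * r))}" "x' \<noteq> y'"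
              then have "min (\<rho> x') (\<rho> y') \<le> dist x' y'" by (intro netD(1)[OF S]) (auto simp: TD_def)
              then show "r \<le> dist x' y'" using near xy by simp
            qed
          qed
        qed (use Cl(1) PK in \<open>auto simp: sets_\<nu>\<close>)
        also have "\<dots> = E3 * \<Psi> (K0 * r)" by (simp add: E3_def)
        also have "\<dots> \<le> C * \<Psi> (K0 * r)" using nn PK by (intro mult_right_mono) (auto simp: C_def)
        finally show "(\<Sum>k\<in>TD. real (card (nbr \<rho> S k)) * (Cl * \<Psi> (K0 * r) * measure \<nu> (ball k (Lam * (K0 * r))))) \<le> C * \<Psi> (K0 * r)" .
      qed
      finally show "Jp (ball z s) (\<lambda>x. u x - f x) \<le> ennreal (C * \<Psi> (K0 * r))" .
    qed
    then show ?thesis by (intro exI[of _ u])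
  qed
  then show thesis using that[OF C0] by blast
qed

text \<open>Each bound \<open>gN (frontier U) (u n) \<le> a\<close> survives the weak limit, and
  shrinking shells allow every positive \<open>a\<close>. Agreement with \<open>f\<close> is proved
  on balls whose doubles lie in \<open>U\<close>, countably many of which cover
  \<open>U\<close>.\<close>

lemma extension_exists:
  obtains w where "w \<in> \<F>" "AE x in m. x \<in> U \<longrightarrow> w x = f x" "emeasure (\<Gamma> w) (frontier U) = 0"
proof -
  obtain C where C: "0 \<le> C" "\<forall>r. 0 < r \<and> r \<le> Rmax \<longrightarrow> (\<exists>u. approximant C r u)"
    by (rule approximant_exists)
  define r where "r n = Rmax / real (Suc n)" for n
  have r: "0 < r n" "r n \<le> Rmax" for n
    using Rmax(1) by (auto simp: r_def divide_simps)
  have "(\<lambda>n. Rmax * (1 / real (Suc n))) \<longlonglongrightarrow> Rmax * 0"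
    by (intro tendsto_mult tendsto_const LIMSEQ_Suc[OF lim_1_over_n])
  then have r0: "r \<longlonglongrightarrow> 0" by (simp add: r_def[abs_def])
  have "\<exists>u. approximant C (r n) u" for n using C(2) r by blast
  then obtain u where u: "\<And>n. approximant C (r n) (u n)" by metis
  note uD = approximantD[OF u]
  have bound: "energy_norm m p \<E> (u n) \<le> C powr (1 / p) + C powr (1 / p)" for n
  proof -
    have uL: "u n \<in> Lp_space m p" using uD(1) F_Lp by blast
    have "ennreal (Lp_norm m p (u n) powr p) = Jp UNIV (u n)"
      using nn_integral_Lp_norm[OF p_pos uL] by (simp add: Jp_def)
    then have "ennreal (Lp_norm m p (u n) powr p) \<le> ennreal C" using uD(3)[of n] by simp
    then have "Lp_norm m p (u n) powr p \<le> C" using C(1) by (simp add: ennreal_le_iff)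
    then have "(Lp_norm m p (u n) powr p) powr (1 / p) \<le> C powr (1 / p)"
      using p_pos by (intro powr_mono2) auto
    moreover have "(Lp_norm m p (u n) powr p) powr (1 / p) = Lp_norm m p (u n)"
      using p_pos by (simp add: powr_powr Lp_norm_def)
    moreover have "eN (u n) \<le> C powr (1 / p)"
      using uD(2)[of n] E_nonneg[OF uD(1)] p_pos by (intro powr_mono2) auto
    ultimately show ?thesis by (simp add: energy_norm_def)
  qed
  obtain w where w: "w \<in> \<F>"
    "\<And>A a. A \<in> sets borel \<Longrightarrow> \<forall>\<^sub>F n in sequentially. gN A (u n) \<le> a \<Longrightarrow> gN A w \<le> a"
    "\<And>D f. D \<in> sets borel \<Longrightarrow> f \<in> borel_measurable borel \<Longrightarrow>
        (\<lambda>n. Jp D (\<lambda>x. u n x - f x)) \<longlonglongrightarrow> 0 \<Longrightarrow> AE x in m. x \<in> D \<longrightarrow> w x = f x"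
    by (rule weak_limit[of u, OF uD(1) bound]) blast
  have fr: "frontier U \<in> sets borel" by (intro borel_closed frontier_closed)
  have shell0: "(\<lambda>n. measure \<nu> (shell (r n))) \<longlonglongrightarrow> 0"
  proof -
    have "(\<lambda>n. measure \<nu> (shell (r n))) \<longlonglongrightarrow> measure \<nu> (\<Inter>n. shell (r n))"
    proof (rule \<nu>.finite_Lim_measure_decseq)
      show "range (\<lambda>n. shell (r n)) \<subseteq> sets \<nu>" by (auto simp: sets_\<nu>)
      show "decseq (\<lambda>n. shell (r n))"
        unfolding decseq_def
      proof (intro allI impI subsetI)
        fix i j z assume ij: "i \<le> j" and z: "z \<in> shell (r j)"
        have "r j \<le> r i" using ij Rmax(1) by (simp add: r_def frac_le)
        then have "(K1 + 1) * r j \<le> (K1 + 1) * r i" using K1_ge_1 by (intro mult_left_mono) auto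
        then show "z \<in> shell (r i)" using z by (simp add: shell_def)
      qed
    qed
    moreover have "(\<Inter>n. shell (r n)) = {}"
    proof (rule equals0I)
      fix z assume z: "z \<in> (\<Inter>n. shell (r n))"
      have "(\<lambda>n. (K1 + 1) * r n) \<longlonglongrightarrow> (K1 + 1) * 0" by (intro tendsto_mult tendsto_const r0)
      moreover have "\<delta> z \<le> (K1 + 1) * r n" for n using z by (auto simp: shell_def)
      ultimately have "\<delta> z \<le> 0" by (intro LIMSEQ_le_const[of _ 0]) auto
      moreover have "0 < \<delta> z" using z by (auto simp: shell_def)
      ultimately show False by simp
    qed
    ultimately show ?thesis by simp
  qed
  have small: "gN (frontier U) w \<le> a" if a: "0 < a" for a
  proof (rule w(2)[OF fr])
    have "(\<lambda>n. C * (measure \<nu> (shell (r n)) + r n)) \<longlonglongrightarrow> C * (0 + 0)"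
      by (intro tendsto_mult tendsto_add tendsto_const shell0 r0)
    then have "\<forall>\<^sub>F n in sequentially. C * (measure \<nu> (shell (r n)) + r n) < a powr p"
      using a by (intro order_tendstoD(2)) auto
    then show "\<forall>\<^sub>F n in sequentially. gN (frontier U) (u n) \<le> a"
    proof eventually_elim
      fix n assume "C * (measure \<nu> (shell (r n)) + r n) < a powr p"
      then have "measure (\<Gamma> (u n)) (frontier U) \<le> a powr p" using uD(4)[of n] by linarith
      then have "gN (frontier U) (u n) \<le> (a powr p) powr (1 / p)" using p_pos by (intro powr_mono2) auto
      then show "gN (frontier U) (u n) \<le> a" using a p_pos by (simp add: powr_powr)
    qed
  qed
  have "gN (frontier U) w \<le> 0"
    by (rule field_le_epsilon) (use small in auto)
  then have "measure (\<Gamma> w) (frontier U) = 0" by (simp add: order_antisym)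
  then have frontier0: "emeasure (\<Gamma> w) (frontier U) = 0" by (simp add: emeasure_\<Gamma>[OF w(1)])
  have AE_ball: "AE x in m. x \<in> ball z e \<longrightarrow> w x = f x" if e: "0 < e" and sub: "ball z (2 * e) \<subseteq> U" for z e
  proof (rule w(3))
    show "(\<lambda>n. Jp (ball z e) (\<lambda>x. u n x - f x)) \<longlonglongrightarrow> 0"
    proof (rule tendsto_sandwich[OF _ _ tendsto_const])
      have "(\<lambda>n. \<Psi> (K0 * r n)) \<longlonglongrightarrow> 0"
      proof (rule tendstoI)
        fix d :: real assume d: "0 < d"
        obtain t where t: "0 < t" "\<And>s. 0 < s \<Longrightarrow> s \<le> t \<Longrightarrow> \<Psi> s \<le> d / 2"
          using scale_function_small[OF scale, of "d / 2"] d by (metis half_gt_zero)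
        have "(\<lambda>n. K0 * r n) \<longlonglongrightarrow> K0 * 0" by (intro tendsto_mult tendsto_const r0)
        then have "\<forall>\<^sub>F n in sequentially. K0 * r n < t" using t(1) by (intro order_tendstoD(2)) auto
        then show "\<forall>\<^sub>F n in sequentially. dist (\<Psi> (K0 * r n)) 0 < d"
        proof eventually_elim
          fix n assume n: "K0 * r n < t"
          have pos: "0 < K0 * r n" using K0_ge_1 r[of n] by simp
          show "dist (\<Psi> (K0 * r n)) 0 < d" using t(2)[OF pos] n \<Psi>_pos[OF pos] d by simp
        qed
      qed
      then have "(\<lambda>n. C * \<Psi> (K0 * r n)) \<longlonglongrightarrow> C * 0" by (intro tendsto_mult tendsto_const)
      then have "(\<lambda>n. ennreal (C * \<Psi> (K0 * r n))) \<longlonglongrightarrow> ennreal (C * 0)" by (rule tendsto_ennrealI)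
      then show "(\<lambda>n. ennreal (C * \<Psi> (K0 * r n))) \<longlonglongrightarrow> 0" by simp
      have "(\<lambda>n. K2 * r n) \<longlonglongrightarrow> K2 * 0" by (intro tendsto_mult tendsto_const r0)
      then have 1: "\<forall>\<^sub>F n in sequentially. K2 * r n < e" using e by (intro order_tendstoD(2)) auto
      \<comment> \<open>With \<open>r n < 1 / d\<close> the ball lies in the range
        \<open>1 / r n\<close> of the local estimate; the second \<open>e\<close> absorbs
        \<open>K2 * r n\<close>.\<close>
      define d where "d = dist w1 z + e + e"
      have d: "0 < d" using e zero_le_dist[of w1 z] unfolding d_def by linarith
      have 2: "\<forall>\<^sub>F n in sequentially. r n < 1 / d" using d by (intro order_tendstoD(2)[OF r0]) auto
      show "\<forall>\<^sub>F n in sequentially. Jp (ball z e) (\<lambda>x. u n x - f x) \<le> ennreal (C * \<Psi> (K0 * r n))"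
        using 1 2
      proof eventually_elim
        fix n assume n: "K2 * r n < e" "r n < 1 / d"
        have "d \<le> 1 / r n" using n(2) d r[of n] by (simp add: field_simps)
        then have far: "dist w1 z + e + K2 * r n \<le> 1 / r n" using n(1) by (simp add: d_def)
        have "ball z (e + K2 * r n) \<subseteq> ball z (2 * e)" using n(1) by (intro subset_ball) simp
        then have "ball z (e + K2 * r n) \<subseteq> U" using sub by blast
        then show "Jp (ball z e) (\<lambda>x. u n x - f x) \<le> ennreal (C * \<Psi> (K0 * r n))"
          by (rule uD(5)[OF e _ far])
      qed
    qed simp
  qed auto
  define \<B> where "\<B> = {ball z e |z e. 0 < e \<and> ball z (2 * e) \<subseteq> U}"
  have cover: "U \<subseteq> \<Union>\<B>"
  proof
    fix z assume "z \<in> U"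
    then obtain e where e: "0 < e" "ball z e \<subseteq> U" using openU open_contains_ball by blast
    then have "ball z (e / 2) \<in> \<B>" unfolding \<B>_def by (intro CollectI exI[of _ z] exI[of _ "e / 2"]) auto
    moreover have "z \<in> ball z (e / 2)" using e by simp
    ultimately show "z \<in> \<Union>\<B>" by blast
  qed
  obtain \<B>' where \<B>': "\<B>' \<subseteq> \<B>" "countable \<B>'" "\<Union>\<B>' = \<Union>\<B>"
    by (rule Lindelof[of \<B>]) (auto simp: \<B>_def)
  have "AE x in m. \<forall>B\<in>\<B>'. x \<in> B \<longrightarrow> w x = f x"
    unfolding AE_ball_countable[OF \<B>'(2)]
  proof
    fix B assume "B \<in> \<B>'"
    then have "B \<in> \<B>" using \<B>'(1) by blast
    then obtain z e where B: "B = ball z e" "0 < e" "ball z (2 * e) \<subseteq> U" unfolding \<B>_def by blast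
    show "AE x in m. x \<in> B \<longrightarrow> w x = f x" unfolding B(1) by (rule AE_ball[OF B(2,3)])
  qed
  then have "AE x in m. x \<in> U \<longrightarrow> w x = f x"
  proof eventually_elim
    fix x assume x: "\<forall>B\<in>\<B>'. x \<in> B \<longrightarrow> w x = f x"
    show "x \<in> U \<longrightarrow> w x = f x"
    proof
      assume "x \<in> U"
      then have "x \<in> \<Union>\<B>'" using cover \<B>'(3) by blast
      then show "w x = f x" using x by blast
    qed
  qed
  then show thesis using that w(1) frontier0 by blast
qed

end

text \<open>At an isolated point the indicator function arises as a cutoff. It is constant on two
  complementary open sets, so locality gives it energy 0 and makes it constant almost everywhere,
  against full support and the existence of a second point.\<close>

lemma (in p_energy_space) no_isolated_point: "\<not> open {x::'a}"
proof
  assume o: "open {x}"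
  then obtain e where e: "0 < e" "ball x e \<subseteq> {x}" using open_contains_ball by blast
  obtain t where t: "0 < t" "compact (cball x t)" by (rule compact_cball_ex)
  define s where "s = min e t / 2"
  have s: "0 < s" "2 * s \<le> e" "2 * s \<le> t" using e t by (auto simp: s_def)
  obtain \<phi> where \<phi>: "\<phi> \<in> \<F> \<inter> Cc" "\<And>y. dist x y \<le> s \<Longrightarrow> \<phi> y = 1" "\<And>y. 2 * s \<le> dist x y \<Longrightarrow> \<phi> y = 0"
    by (rule cutoff_exists[OF s(1) compact_cball_mono[OF t(2) s(3)]]) blast
  have \<phi>x: "\<phi> x = 1" using \<phi>(2)[of x] s by simp
  have \<phi>0: "\<phi> y = 0" if "y \<noteq> x" for y
  proof -
    have "y \<notin> ball x e" using e(2) that by blast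
    then show ?thesis using \<phi>(3)[of y] s by simp
  qed
  have oc: "open (- {x})" by (simp add: open_Compl)
  have \<phi>F: "\<phi> \<in> \<F>" using \<phi>(1) by simp
  interpret g: finite_measure "\<Gamma> \<phi>" by (rule \<Gamma>_finite[OF \<phi>F])
  have "measure (\<Gamma> \<phi>) {x} = 0" by (rule \<Gamma>_const_Cc[OF \<phi>(1) o, of 1]) (use \<phi>x in auto)
  moreover have "measure (\<Gamma> \<phi>) (- {x}) = 0" by (rule \<Gamma>_const_Cc[OF \<phi>(1) oc, of 0]) (use \<phi>0 in auto)
  moreover have "measure (\<Gamma> \<phi>) ({x} \<union> - {x}) \<le> measure (\<Gamma> \<phi>) {x} + measure (\<Gamma> \<phi>) (- {x})"
    by (rule measure_Un_le) (use \<Gamma>_borel[OF \<phi>F] in auto)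
  ultimately have "measure (\<Gamma> \<phi>) UNIV = 0"
    by (simp add: Un_commute measure_le_0_iff)
  then have "\<E> \<phi> = 0" using E_eq_\<Gamma>[OF \<phi>F] by simp
  then obtain c where c: "AE y in m. \<phi> y = c" using E_zero[OF \<phi>F] by blast
  have val: "\<exists>y\<in>V. \<phi> y = c" if "open V" "V \<noteq> {}" for V
  proof (rule ccontr)
    assume no: "\<not> ?thesis"
    have "AE y in m. y \<notin> V" using c by eventually_elim (use no in blast)
    then have "emeasure m V = 0"
      using that(1) by (subst (asm) AE_iff_measurable[of V]) (auto intro: borel_open)
    then show False using full_support[OF that] by simp
  qed
  have "\<exists>y. y \<noteq> x" using two_points by metis
  then have "- {x} \<noteq> {}" by blast
  then have "c = 0" using val[OF oc] \<phi>0 by auto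
  moreover have "c = 1" using val[OF o] \<phi>x by auto
  ultimately show False by simp
qed

theorem theorem1p17:
  fixes m :: "'a::polish_space measure"
    and p :: real
    and \<F> :: "('a \<Rightarrow> real) set"
    and \<E> :: "('a \<Rightarrow> real) \<Rightarrow> real"
    and \<Gamma> :: "('a \<Rightarrow> real) \<Rightarrow> 'a measure"
    and \<Psi> :: "real \<Rightarrow> real"
    and U :: "'a set"
  assumes "p_energy_space m p \<F> \<E> \<Gamma>"
    and "scale_function \<Psi>"
    and "volume_doubling m"
    and "poincare_inequality m p \<F> \<Gamma> \<Psi>"
    and "capacity_upper_bound m \<F> \<E> \<Psi>"
    and "uniform_domain U"
  shows "extension_property m p \<F> \<Gamma> U"
proof -
  interpret doubling_energy_space m p \<F> \<E> \<Gamma>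
    using assms(1,3) by (simp add: doubling_energy_space_def doubling_energy_space_axioms_def)
  note scale = assms(2)
  obtain Au where Au: "A_uniform_domain Au U" using assms(6) by (auto simp: uniform_domain_def)
  then have oU: "open U" and nU: "U \<noteq> UNIV" and neU: "U \<noteq> {}" and Au1: "1 \<le> Au"
    by (auto simp: A_uniform_domain_def)
  have curves: "\<forall>x\<in>U. \<forall>y\<in>U. \<exists>\<gamma>.
        path \<gamma> \<and> path_image \<gamma> \<subseteq> U \<and> pathstart \<gamma> = x \<and> pathfinish \<gamma> = y \<and>
        diameter (path_image \<gamma>) \<le> Au * dist x y \<and>
        (\<forall>z \<in> path_image \<gamma>. infdist z (- U) \<ge> inverse Au * min (dist x z) (dist y z))"
    using Au by (simp add: A_uniform_domain_def)
  obtain w1 where w1: "w1 \<in> U" using neU by blast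
  \<comment> \<open>The second point of \<open>U\<close> yields a positive scale below which deep
    points exist.\<close>
  have "U \<noteq> {w1}" using no_isolated_point[of w1] oU by auto
  then obtain w2 where w2: "w2 \<in> U" "w1 \<noteq> w2" using w1 by blast
  obtain C A where CA: "0 < C" "1 \<le> A" "\<forall>x. \<forall>r>0. \<forall>u\<in>\<F>.
           (\<integral>\<^sup>+y\<in>ball x r. ennreal (\<bar>u y - mean_on m (ball x r) u\<bar> powr p) \<partial>m)
             \<le> ennreal (C * \<Psi> r) * emeasure (\<Gamma> u) (ball x (A * r))"
    using assms(4) unfolding poincare_inequality_def by blast
  have PI: "Jp (ball x r) (\<lambda>y. u y - mean_on m (ball x r) u) \<le> ennreal (C * \<Psi> r) * emeasure (\<Gamma> u) (ball x (A * r))"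
    if "0 < r" "u \<in> \<F>" for x r u
    using CA(3) that by (simp add: Jp_def)
  obtain c A1 A2 where cap: "1 < c" "1 < A1" "1 < A2"
    "\<forall>x R. 0 < R \<and> ereal R < ediameter (UNIV :: 'a set) / ereal A2 \<longrightarrow>
           (INF u \<in> {u \<in> \<F>. (AE y in m. y \<in> ball x R \<longrightarrow> u y = 1) \<and>
                            (AE y in m. y \<notin> ball x (A1 * R) \<longrightarrow> u y = 0)}. ennreal (\<E> u))
             \<le> ennreal c * emeasure m (ball x R) / ennreal (\<Psi> R)"
    using assms(5) unfolding capacity_upper_bound_def by blast
  define d where "d = dist w1 w2"
  have d: "0 < d" using w2 by (simp add: d_def)
  have "ereal d \<le> ediameter (UNIV :: 'a set)"
    unfolding ediameter_def d_def by (rule SUP_upper2[of "(w1, w2)"]) auto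
  then have "ereal d / ereal A2 \<le> ediameter (UNIV :: 'a set) / ereal A2"
    using cap(3) by (intro ereal_divide_right_mono) auto
  then have diam: "ereal (d / A2) \<le> ediameter (UNIV :: 'a set) / ereal A2" using cap(3) by simp
  \<comment> \<open>Halving makes the comparison with \<open>d / A2\<close>, a lower bound for the
    range of the capacity estimate, strict.\<close>
  define Rcap where "Rcap = d / A2 / 2"
  have "0 < d / A2" using d cap(3) by simp
  then have Rcap: "0 < Rcap" "Rcap < d / A2"
    using field_less_half_sum[of 0 "d / A2"] field_sum_of_halves[of "d / A2"] unfolding Rcap_def by auto
  \<comment> \<open>The infimum need not be attained; doubling the positive bound makes the
    inequality strict, which yields an actual function.\<close>
  have capacity: "\<exists>u\<in>\<F>. (AE y in m. y \<in> ball x R \<longrightarrow> u y = 1) \<and>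
        (AE y in m. y \<notin> ball x (A1 * R) \<longrightarrow> u y = 0) \<and> \<E> u \<le> 2 * c * mb x R / \<Psi> R"
    if R: "0 < R" "R \<le> Rcap" for x R
  proof -
    have "ereal R < ereal (d / A2)" using R Rcap by simp
    also note diam
    finally have le: "(INF u \<in> {u \<in> \<F>. (AE y in m. y \<in> ball x R \<longrightarrow> u y = 1) \<and>
                            (AE y in m. y \<notin> ball x (A1 * R) \<longrightarrow> u y = 0)}. ennreal (\<E> u))
             \<le> ennreal c * emeasure m (ball x R) / ennreal (\<Psi> R)"
      using cap(4) R(1) by simp
    have P: "0 < \<Psi> R" by (rule scale_function_pos[OF scale R(1)])
    have pos: "0 < mb x R" by (rule mb_pos[OF R(1)])
    have "ennreal c * emeasure m (ball x R) / ennreal (\<Psi> R) = ennreal (c * mb x R / \<Psi> R)"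
      using P cap(1) by (simp add: emeasure_ball ennreal_mult[symmetric] divide_ennreal)
    also have "\<dots> < ennreal (2 * c * mb x R / \<Psi> R)"
      using P cap(1) pos by (intro ennreal_lessI) (auto simp: divide_strict_right_mono)
    finally have "(INF u \<in> {u \<in> \<F>. (AE y in m. y \<in> ball x R \<longrightarrow> u y = 1) \<and>
                            (AE y in m. y \<notin> ball x (A1 * R) \<longrightarrow> u y = 0)}. ennreal (\<E> u)) < ennreal (2 * c * mb x R / \<Psi> R)"
      using le by (rule le_less_trans[rotated])
    then obtain u where "u \<in> \<F>" "AE y in m. y \<in> ball x R \<longrightarrow> u y = 1" "AE y in m. y \<notin> ball x (A1 * R) \<longrightarrow> u y = 0"
      "ennreal (\<E> u) < ennreal (2 * c * mb x R / \<Psi> R)"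
      unfolding INF_less_iff by blast
    moreover from this have "\<E> u \<le> 2 * c * mb x R / \<Psi> R"
      using E_nonneg by (auto simp: ennreal_less_iff)
    ultimately show ?thesis by blast
  qed
  have "\<exists>F\<in>\<F>. (AE x in m. x \<in> U \<longrightarrow> f x = F x) \<and> emeasure (\<Gamma> F) (frontier U) = 0"
    if f: "f \<in> F_on m p \<F> \<Gamma> U" for f
  proof -
    have C0: "0 \<le> C" using CA(1) by simp
    have \<Psi>0: "0 \<le> \<Psi> r" if "0 < r" for r using scale_function_pos[OF scale that] by simp
    obtain \<nu> g where \<nu>: "finite_measure \<nu>" "sets \<nu> = sets borel" "g \<in> borel_measurable borel" "\<forall>x\<in>U. g x = f x"
      and poinc: "\<forall>y s. 0 < s \<and> ball y (2 * A * s) \<subseteq> U \<longrightarrow>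
        (\<exists>a. Jp (ball y s) (\<lambda>x. g x - a) \<le> ennreal (C * \<Psi> s * measure \<nu> (ball y (2 * A * s))))"
      and Jg: "\<forall>E\<in>sets borel. E \<subseteq> U \<longrightarrow> Jp E g \<le> ennreal (measure \<nu> E)"
      by (rule control_measure_exists[OF oU f PI CA(2) C0 \<Psi>0])
    \<comment> \<open>\<open>g\<close> is a globally Borel function equal to \<open>f\<close> on
      \<open>U\<close>. The dilation is \<open>2 * A\<close> because local extensions need the extra
      room.\<close>
    interpret E: uniform_extension m p \<F> \<E> \<Gamma> \<Psi> U g \<nu> C "2 * A" Au w1 w2 "2 * c" A1 Rcap
    proof (intro uniform_extension.intro uniform_extension_axioms.intro)
      show "doubling_energy_space m p \<F> \<E> \<Gamma>" by (rule doubling_energy_space_axioms)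
      show "\<exists>\<gamma>. path \<gamma> \<and> path_image \<gamma> \<subseteq> U \<and> pathstart \<gamma> = x \<and> pathfinish \<gamma> = y \<and>
        diameter (path_image \<gamma>) \<le> Au * dist x y \<and>
        (\<forall>z \<in> path_image \<gamma>. infdist z (- U) \<ge> inverse Au * min (dist x z) (dist y z))"
        if "x \<in> U" "y \<in> U" for x y
        using curves that by blast
      show "\<exists>a. Jp (ball y s) (\<lambda>x. g x - a) \<le> ennreal (C * \<Psi> s * measure \<nu> (ball y (2 * A * s)))"
        if "0 < s" "ball y (2 * A * s) \<subseteq> U" for y s using poinc that by blast
      show "Jp E g \<le> ennreal (measure \<nu> E)" if "E \<in> sets borel" "E \<subseteq> U" for E using Jg that by blast
      show "\<exists>u\<in>\<F>. (AE y in m. y \<in> ball x R \<longrightarrow> u y = 1) \<and>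
        (AE y in m. y \<notin> ball x (A1 * R) \<longrightarrow> u y = 0) \<and> \<E> u \<le> 2 * c * mb x R / \<Psi> R"
        if "0 < R" "R \<le> Rcap" for x R using capacity[OF that] .
    qed (use scale oU nU \<nu> CA Au1 w1 w2 cap Rcap in auto)
    obtain w where w: "w \<in> \<F>" "AE x in m. x \<in> U \<longrightarrow> w x = g x" "emeasure (\<Gamma> w) (frontier U) = 0"
      by (rule E.extension_exists)
    have "AE x in m. x \<in> U \<longrightarrow> f x = w x"
      using w(2) by eventually_elim (use \<nu>(4) in auto)
    then show ?thesis using w by blast
  qed
  then show ?thesis using oU nU by (simp add: extension_property_def)
qed

end
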